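(* There exist a standard $\sigma$-finite measure space $(X,\mathfrak B,\mu)$ with $\mu(X)=\infty$ and a $\mu$-preserving rank-one flow $T=(T_t)_{t\in\mathbb R}$ on it such that for each $t\in\mathbb R$ with $t\neq 0$, the transformation $T_t$ has infinite ergodic index.
   Context: A flow is a measure preserving (measurable) action $T=(T_t)_{t\in\mathbb R}$ of the group $\mathbb R$ on a standard $\sigma$-finite measure space. A measure preserving transformation $S$ of $(X,\mu)$ has infinite ergodic index if for every integer $p\ge 1$ the Cartesian power $S\times\cdots\times S$ ($p$ times), acting on $(X^p,\mu^{p})$ with the product measure, is ergodic. Rank one. Let $S=(S_t)_{t\in\mathbb R}$ be a measure preserving flow on a standard $\sigma$-finite measure space $(Y,\mathfrak C,\nu)$. A Rokhlin tower for $S$ is a triple $(A,f,F)$, where $A\in\mathfrak C$, $F$ is a bounded interval in $\mathbb R$ (a one-dimensional cube), and $f:A\to F$ is a measurable mapping such that for every Borel subset $H\subset F$ and every $t\in\mathbb R$ with $t+H\subset F$ one has $f^{-1}(t+H)=S_tf^{-1}(H)$. The flow $S$ is of rank one if there exists a sequence of Rokhlin towers $(A_n,f_n,F_n)$ such that the length of $F_n$ goes to infinity and for every subset $C\in\mathfrak C$ of finite measure there is a sequence of Borel subsets $H_n\subset F_n$ with $\lim_{n\to\infty}\nu(C\triangle f_n^{-1}(H_n))=0$. *)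

theory Defs
  imports "HOL-Analysis.Analysis"
begin

(* Standard Borel: the sigma-algebra consists of the Borel sets of some Polish topology on the
   carrier. The topology is not part of the data. *)
definition standard_sigma_finite_measure :: "'a measure \<Rightarrow> bool" where
  "standard_sigma_finite_measure M \<longleftrightarrow>
     (\<exists>X. completely_metrizable_space X \<and> separable_space X \<and> topspace X = space M \<and>
          sets M = sigma_sets (topspace X) {U. openin X U}) \<and>
     sigma_finite_measure M"

definition measure_preserving_map :: "'a measure \<Rightarrow> ('a \<Rightarrow> 'a) \<Rightarrow> bool" where
  "measure_preserving_map M S \<longleftrightarrow> S \<in> measurable M M \<and> distr M M S = M"

(* The maps T t are total functions on the type; only their values on the carrier matter. *)
definition measure_preserving_flow :: "'a measure \<Rightarrow> (real \<Rightarrow> 'a \<Rightarrow> 'a) \<Rightarrow> bool" where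
  "measure_preserving_flow M T \<longleftrightarrow>
     (\<lambda>(t, x). T t x) \<in> measurable (borel \<Otimes>\<^sub>M M) M \<and>
     (\<forall>x\<in>space M. T 0 x = x) \<and>
     (\<forall>s t. \<forall>x\<in>space M. T (s + t) x = T s (T t x)) \<and>
     (\<forall>t. measure_preserving_map M (T t))"

definition ergodic :: "'a measure \<Rightarrow> ('a \<Rightarrow> 'a) \<Rightarrow> bool" where
  "ergodic M S \<longleftrightarrow>
     measure_preserving_map M S \<and>
     (\<forall>A\<in>sets M. S -` A \<inter> space M = A \<longrightarrow> A \<in> null_sets M \<or> space M - A \<in> null_sets M)"

definition cartesian_power :: "nat \<Rightarrow> ('a \<Rightarrow> 'a) \<Rightarrow> (nat \<Rightarrow> 'a) \<Rightarrow> (nat \<Rightarrow> 'a)" where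
  "cartesian_power p S x = (\<lambda>i\<in>{..<p}. S (x i))"

definition infinite_ergodic_index :: "'a measure \<Rightarrow> ('a \<Rightarrow> 'a) \<Rightarrow> bool" where
  "infinite_ergodic_index M S \<longleftrightarrow>
     measure_preserving_map M S \<and>
     (\<forall>p\<ge>1. ergodic (Pi\<^sub>M {..<p} (\<lambda>_. M)) (cartesian_power p S))"

(* The map f is defined on A only, so preimages under it are taken inside A. *)
definition rokhlin_tower ::
  "'a measure \<Rightarrow> (real \<Rightarrow> 'a \<Rightarrow> 'a) \<Rightarrow> 'a set \<Rightarrow> ('a \<Rightarrow> real) \<Rightarrow> real set \<Rightarrow> bool" where
  "rokhlin_tower M T A f F \<longleftrightarrow>
     A \<in> sets M \<and> is_interval F \<and> bounded F \<and>
     f \<in> measurable (restrict_space M A) (restrict_space borel F) \<and>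
     (\<forall>H\<in>sets borel. \<forall>t. H \<subseteq> F \<longrightarrow> (+) t ` H \<subseteq> F \<longrightarrow>
        f -` ((+) t ` H) \<inter> A = T t ` (f -` H \<inter> A))"

definition rank_one_flow :: "'a measure \<Rightarrow> (real \<Rightarrow> 'a \<Rightarrow> 'a) \<Rightarrow> bool" where
  "rank_one_flow M T \<longleftrightarrow>
     measure_preserving_flow M T \<and>
     (\<exists>A f F.
        (\<forall>n::nat. rokhlin_tower M T (A n) (f n) (F n)) \<and>
        filterlim (\<lambda>n. measure lborel (F n)) at_top sequentially \<and>
        (\<forall>C\<in>sets M. emeasure M C < \<infinity> \<longrightarrow>
           (\<exists>H. (\<forall>n. H n \<in> sets borel \<and> H n \<subseteq> F n) \<and>
                (\<lambda>n. emeasure M (sym_diff C (f n -` H n \<inter> A n))) \<longlonglongrightarrow> 0)))"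

(* HOL cannot quantify existentially over types, so an existence statement about standard measure
   spaces has to fix the ambient type of points. The type of real sequences is no restriction:
   every Polish space is homeomorphic to a G_delta subset of it, and the carrier space M may be
   any subset. *)
type_synonym point = "nat \<Rightarrow> real"

end

theory Submission
  imports Defs "HOL-Probability.Probability"
begin

text \<open>
  The flow is a cutting and stacking construction in its algebraic form. Fix finite sets
  \<open>C n\<close> of reals and intervals \<open>F n = {-h n..<h n}\<close> such that the translates \<open>F n + c\<close>
  for \<open>c \<in> C n\<close> are disjoint and lie inside \<open>F (Suc n)\<close>, with room to spare at both ends. A sequence
  \<open>z\<close> with \<open>z 0\<close> an arbitrary real and \<open>z (Suc n) \<in> C n\<close> encodes a point: as long as the partial sum
  \<open>height n z = z 0 + \<dots> + z n\<close> lies in \<open>F n\<close>, it is the height of the point in the \<open>n\<close>-th tower, and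
  \<open>z (Suc n)\<close> says into which copy of that tower inside the next one the point falls. Two sequences encode
  the same point iff they agree from some place on and have the same partial sum there, and the flow
  just adds \<open>t\<close> to \<open>z 0\<close>. So the phase space is the quotient of \<open>Z\<close>, which is the product of the line
  and a product of finite sets, by a countable group of digit changes, each compensated in the
  coordinate 0; the natural product measure \<open>m\<close> on \<open>Z\<close> is invariant under all of this. To
  have an actual space of sequences, the quotient is realized on a Borel fundamental domain \<open>D\<close>, which
  is a \<open>G\<^sub>\<delta>\<close> set and hence Polish. The room left in the towers makes the measure infinite and the flow
  defined everywhere (\<open>M_standard\<close>, \<open>M_infinite\<close>, \<open>T_flow\<close>, \<open>T_rank_one\<close>).

  The digit sets are chosen so that return times mix well. \<open>C n\<close> consists of the numbers
  \<open>i * \<beta> + e * r\<close>, where \<open>\<beta>\<close> is large, \<open>r\<close> is a rational, and \<open>e\<close> is the \<open>i\<close>-th letter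
  of the concatenation of all binary words of length \<open>2 * Suc n\<close>; along the stages \<open>r\<close> takes every rational
  value infinitely often. For each \<open>k \<le> Suc n\<close>, precisely one eighth of the digits starts a pair of
  letters \<open>(0, 0)\<close> at distance \<open>k\<close> in the first half of a word, and one eighth a pair \<open>(0, 1)\<close>. On the first
  eighth, translating by \<open>k * \<beta>\<close> is the same as changing one digit; on the second, it is the same as
  changing one digit and translating by \<open>-r\<close> (\<open>offset_pattern\<close>, \<open>kick_same_orbit\<close>).

  Now let \<open>t \<noteq> 0\<close> and let \<open>S\<close> be a set in the \<open>p\<close>-th power that is invariant under the \<open>p\<close>-th power of
  \<open>T t\<close>. By Dirichlet, some \<open>k * \<beta>\<close> with \<open>k \<le> Suc n\<close> is within \<open>\<bar>t\<bar> / Suc n\<close> of an integer multiple of \<open>t\<close>; here it is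
  essential that one pattern serves all \<open>k \<le> Suc n\<close>, as \<open>t\<close> is arbitrary. Choosing the pair \<open>(0, 1)\<close> in one
  coordinate \<open>i\<close> and \<open>(0, 0)\<close> in the others, one sees that on an event of probability \<open>(1/8)\<close> to the
  power \<open>p\<close>, a point lies in \<open>S\<close> iff it does so after translating coordinate \<open>i\<close> by \<open>-r\<close>, apart from a tiny
  translation and a change of the digits number \<open>Suc n\<close>. As \<open>n\<close> grows these perturbations become invisible
  and the event becomes independent of any given set (\<open>joining_tendsto\<close> and its companions),
  so \<open>S\<close> is invariant mod null sets under every rational translation of every single coordinate
  (\<open>coordinate_shift_invariant\<close>). The weight \<open>(1/8)\<close> to the power \<open>p\<close> only has to be positive, hence nothing
  prevents \<open>p\<close> from being arbitrary. Finally, rational translations are ergodic on the line, digit rotations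
  are ergodic on the product of finite sets, and a Fubini argument combines these facts
  (\<open>ergodic_symmetries\<close>, \<open>ergodic_family_power\<close>) to show that \<open>S\<close> is null or conull.
\<close>

section \<open>Convergence of joinings\<close>

text \<open>
  A Dynkin system argument. The common finite majorant \<open>\<nu>\<close> is what makes countable disjoint unions
  work: it dominates the series of measures, so that limit and sum may be interchanged by Tannery's theorem.
\<close>

lemma tendsto_measure_Dynkin:
  fixes \<mu> :: "nat \<Rightarrow> 'a measure" and \<mu>' \<nu> :: "'a measure" and c :: real
  assumes G: "Int_stable G" "G \<subseteq> Pow \<Omega>" "\<Omega> \<in> G"
    and sets: "\<And>n. sets (\<mu> n) = sigma_sets \<Omega> G" "sets \<mu>' = sigma_sets \<Omega> G" "sets \<nu> = sigma_sets \<Omega> G"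
    and fin: "finite_measure \<mu>'" "finite_measure \<nu>"
    and dom: "\<And>n A. A \<in> sigma_sets \<Omega> G \<Longrightarrow> emeasure (\<mu> n) A \<le> emeasure \<nu> A"
    and lim: "\<And>A. A \<in> G \<Longrightarrow> (\<lambda>n. measure (\<mu> n) A) \<longlonglongrightarrow> c * measure \<mu>' A"
    and A: "A \<in> sigma_sets \<Omega> G"
  shows "(\<lambda>n. measure (\<mu> n) A) \<longlonglongrightarrow> c * measure \<mu>' A"
  using G(1,2) A
proof (induction rule: sigma_sets_induct_disjoint)
  case (basic A)
  then show ?case by (rule lim)
next
  case empty
  then show ?case by simp
next
  interpret \<nu>: finite_measure \<nu> by fact
  interpret \<mu>': finite_measure \<mu>' by fact
  have \<Omega>: "\<Omega> \<in> sigma_sets \<Omega> G" by (rule sigma_sets_top)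
  have fin_n: "finite_measure (\<mu> n)" for n
  proof
    have "space (\<mu> n) \<in> sigma_sets \<Omega> G" using sets(1)[of n] sets.top[of "\<mu> n"] by simp
    from dom[OF this, of n] show "emeasure (\<mu> n) (space (\<mu> n)) \<noteq> \<infinity>"
      by (metis \<nu>.emeasure_finite infinity_ennreal_def neq_top_trans)
  qed
  {
    case (compl A)
    have "measure (\<mu> n) (\<Omega> - A) = measure (\<mu> n) \<Omega> - measure (\<mu> n) A" for n
    proof -
      interpret finite_measure "\<mu> n" by (rule fin_n)
      have "A \<subseteq> \<Omega>" using compl(1) sigma_sets_into_sp[OF G(2)] by auto
      then show ?thesis using compl(1) \<Omega> by (intro finite_measure_Diff) (auto simp: sets)
    qed
    moreover have "measure \<mu>' (\<Omega> - A) = measure \<mu>' \<Omega> - measure \<mu>' A"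
    proof -
      have "A \<subseteq> \<Omega>" using compl(1) sigma_sets_into_sp[OF G(2)] by auto
      then show ?thesis using compl(1) \<Omega> by (intro \<mu>'.finite_measure_Diff) (auto simp: sets)
    qed
    ultimately show ?case
      using tendsto_diff[OF lim[OF G(3)] compl(2)] by (simp only: right_diff_distrib)
  next
    case (union A)
    have r: "A i \<in> sigma_sets \<Omega> G" for i using union(2) by auto
    have s_n: "(\<lambda>i. measure (\<mu> n) (A i)) sums measure (\<mu> n) (\<Union>i. A i)" for n
    proof -
      interpret finite_measure "\<mu> n" by (rule fin_n)
      show ?thesis using union by (intro finite_measure_UNION) (auto simp: sets)
    qed
    have s: "(\<lambda>i. measure \<mu>' (A i)) sums measure \<mu>' (\<Union>i. A i)"
      using union by (intro \<mu>'.finite_measure_UNION) (auto simp: sets)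
    have s\<nu>: "(\<lambda>i. measure \<nu> (A i)) sums measure \<nu> (\<Union>i. A i)"
      using union by (intro \<nu>.finite_measure_UNION) (auto simp: sets)
    have le: "measure (\<mu> n) (A i) \<le> measure \<nu> (A i)" for n i
      using dom[OF r] by (simp add: measure_def enn2real_mono \<nu>.emeasure_finite less_top[symmetric])
    have "\<forall>\<^sub>F (i, n) in sequentially \<times>\<^sub>F sequentially. norm (measure (\<mu> n) (A i)) \<le> measure \<nu> (A i)"
      using le by (intro always_eventually) auto
    then have "(\<lambda>n. suminf (\<lambda>i. measure (\<mu> n) (A i))) \<longlonglongrightarrow> suminf (\<lambda>i. c * measure \<mu>' (A i))"
      using tannerys_theorem[OF union(3)] s\<nu> by (simp add: sums_iff)
    then show ?case using s_n s
      by (simp add: sums_iff suminf_mult)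
  }
qed

text \<open>
  The sets \<open>Y n \<inter> \<Psi> n -` E \<inter> F\<close> measure how \<open>\<Psi> n\<close>, restricted to \<open>Y n\<close>, correlates \<open>E\<close> and \<open>F\<close>. The limit
  says that \<open>\<Psi> n\<close> tends to the identity while \<open>Y n\<close> becomes independent of any fixed set with density \<open>c\<close> in
  \<open>K\<close>. The expression is a measure in each of the two arguments. It is dominated by a fixed finite
  measure in both cases; for \<open>E\<close> this is because \<open>\<Psi> n\<close> preserves the measure and maps \<open>K\<close> into \<open>K'\<close>. Hence the
  preceding lemma applies first to \<open>E\<close> and then to \<open>F\<close>, and it is enough to know the limit on generators.
\<close>

lemma joining_tendsto:
  fixes N :: "'a measure" and c :: real
  assumes G: "Int_stable G" "G \<subseteq> Pow (space N)" "space N \<in> G" "sets N = sigma_sets (space N) G"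
    and mp: "\<And>n. measure_preserving_map N (\<Psi> n)"
    and Y: "\<And>n. Y n \<in> sets N" "\<And>n. Y n \<subseteq> K"
    and K: "K \<in> sets N" "emeasure N K < \<infinity>" "K' \<in> sets N" "emeasure N K' < \<infinity>"
    and KK': "\<And>n x. x \<in> K \<Longrightarrow> \<Psi> n x \<in> K'"
    and lim: "\<And>E F. E \<in> G \<Longrightarrow> F \<in> G \<Longrightarrow>
       (\<lambda>n. measure N (Y n \<inter> \<Psi> n -` E \<inter> F)) \<longlonglongrightarrow> c * measure N (K \<inter> E \<inter> F)"
    and E: "E \<in> sets N" and F: "F \<in> sets N"
  shows "(\<lambda>n. measure N (Y n \<inter> \<Psi> n -` E \<inter> F)) \<longlonglongrightarrow> c * measure N (K \<inter> E \<inter> F)"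
proof -
  have \<Psi>[measurable]: "\<Psi> n \<in> measurable N N" and d: "distr N N (\<Psi> n) = N" for n
    using mp unfolding measure_preserving_map_def by auto
  note [measurable] = Y(1) K(1,3) E F
  have dens: "emeasure (density N (indicator A)) B = emeasure N (A \<inter> B)"
    if "A \<in> sets N" "B \<in> sets N" for A B
    using that by (rule emeasure_restricted)
  have mdens: "measure (density N (indicator A)) B = measure N (A \<inter> B)"
    if "A \<in> sets N" "B \<in> sets N" for A B
    using that by (rule measure_restricted)
  have findens: "finite_measure (density N (indicator A))" if "A \<in> sets N" "A \<subseteq> L" "L \<in> sets N" "emeasure N L < \<infinity>" for A L
    using that emeasure_mono[OF that(2,3)]
    by (intro finite_measureI) (auto simp: dens intro: le_less_trans)
  have Gs: "B \<in> sets N" if "B \<in> G" for B using that G(4) by auto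
  have vY: "Y n \<inter> \<Psi> n -` B \<in> sets N" if "B \<in> sets N" for n B
  proof -
    have "Y n \<inter> \<Psi> n -` B = Y n \<inter> (\<Psi> n -` B \<inter> space N)"
      using sets.sets_into_space[OF Y(1)[of n]] by auto
    with that show ?thesis by simp
  qed
  have 1: "(\<lambda>n. measure N (Y n \<inter> \<Psi> n -` B \<inter> F)) \<longlonglongrightarrow> c * measure N (K \<inter> B \<inter> F)"
    if F: "F \<in> G" and B: "B \<in> sets N" for F B
  proof -
    note [measurable] = Gs[OF F]
    let ?\<mu> = "\<lambda>n. distr (density N (indicator (Y n \<inter> F))) N (\<Psi> n)"
    have em: "emeasure (?\<mu> n) B = emeasure N (Y n \<inter> \<Psi> n -` B \<inter> F)" if "B \<in> sets N" for n B
    proof -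
      have "emeasure (?\<mu> n) B = emeasure N (Y n \<inter> F \<inter> (\<Psi> n -` B \<inter> space N))"
        using that Gs[OF F] by (subst emeasure_distr) (auto simp: dens)
      also have "Y n \<inter> F \<inter> (\<Psi> n -` B \<inter> space N) = Y n \<inter> \<Psi> n -` B \<inter> F"
        using sets.sets_into_space[OF Y(1)[of n]] by auto
      finally show ?thesis .
    qed
    have "(\<lambda>n. measure (?\<mu> n) B) \<longlonglongrightarrow> c * measure (density N (indicator (K \<inter> F))) B"
    proof (rule tendsto_measure_Dynkin[OF G(1-3), where \<nu>="density N (indicator K')"])
      show "finite_measure (density N (indicator (K \<inter> F)))"
        by (rule findens[of _ K]) (use K in auto)
      show "finite_measure (density N (indicator K'))"
        by (rule findens[of _ K']) (use K in auto)
    next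
      fix n B assume "B \<in> sigma_sets (space N) G"
      then have B[measurable]: "B \<in> sets N" by (simp add: G)
      have "emeasure (?\<mu> n) B \<le> emeasure N (\<Psi> n -` (K' \<inter> B) \<inter> space N)"
        unfolding em[OF B] using sets.sets_into_space[OF Y(1)[of n]] Y(2)[of n] KK'[of _ n]
        by (intro emeasure_mono) auto
      also have "\<dots> = emeasure (distr N N (\<Psi> n)) (K' \<inter> B)"
        by (subst emeasure_distr) auto
      also have "\<dots> = emeasure (density N (indicator K')) B" unfolding d by (simp add: dens)
      finally show "emeasure (?\<mu> n) B \<le> emeasure (density N (indicator K')) B" .
    next
      fix B assume "B \<in> G"
      then show "(\<lambda>n. measure (?\<mu> n) B) \<longlonglongrightarrow> c * measure (density N (indicator (K \<inter> F))) B"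
        using lim[of B F] F Gs[of B] by (simp add: em measure_def dens) (simp add: ac_simps)
    qed (use G(4) B in auto)
    then show ?thesis using B Gs[OF F] by (simp add: em measure_def dens) (simp add: ac_simps)
  qed
  have "(\<lambda>n. measure (density N (indicator (Y n \<inter> \<Psi> n -` E))) F) \<longlonglongrightarrow> c * measure (density N (indicator (K \<inter> E))) F"
  proof (rule tendsto_measure_Dynkin[OF G(1-3), where \<nu>="density N (indicator K)"])
    show "finite_measure (density N (indicator (K \<inter> E)))"
      by (rule findens[of _ K]) (use K in auto)
    show "finite_measure (density N (indicator K))"
      by (rule findens[of _ K]) (use K in auto)
  next
    fix n B assume "B \<in> sigma_sets (space N) G"
    then have B[measurable]: "B \<in> sets N" by (simp add: G)
    show "emeasure (density N (indicator (Y n \<inter> \<Psi> n -` E))) B \<le> emeasure (density N (indicator K)) B"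
      using Y(2)[of n] vY[OF E, of n] by (auto simp: dens intro!: emeasure_mono)
  next
    fix B assume "B \<in> G"
    then show "(\<lambda>n. measure (density N (indicator (Y n \<inter> \<Psi> n -` E))) B) \<longlonglongrightarrow> c * measure (density N (indicator (K \<inter> E))) B"
      using 1[of B E] E Gs[of B] vY[OF E] by (simp add: mdens)
  qed (use G(4) F in auto)
  then show ?thesis using vY[OF E] by (simp add: mdens)
qed

section \<open>Translations of the line\<close>

lemma lborel_translation: "measure_preserving_map lborel (\<lambda>y::real. y + t)"
  unfolding measure_preserving_map_def
  using lborel_distr_plus[of t] by (simp add: add.commute cong: distr_cong)

text \<open>
  Continuity of translations in measure, read off from half-lines, for which the measures are explicit.
\<close>

lemma lborel_translation_tendsto:
  fixes \<epsilon> :: "nat \<Rightarrow> real"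
  assumes \<epsilon>: "\<epsilon> \<longlonglongrightarrow> 0" and E: "E \<in> sets borel" and F: "F \<in> sets borel"
  shows "(\<lambda>n. measure lborel ({-R..R} \<inter> {y. y + \<epsilon> n \<in> E} \<inter> F)) \<longlonglongrightarrow> measure lborel ({-R..R} \<inter> E \<inter> F)"
proof -
  obtain b where b: "\<And>n. \<bar>\<epsilon> n\<bar> \<le> b"
    using Bseq_def convergentI[OF \<epsilon>, THEN convergent_imp_Bseq] by (auto simp: Bseq_def)
  let ?G = "insert UNIV (range (\<lambda>a::real. {..a}))"
  have sG: "sets (lborel::real measure) = sigma_sets (space lborel) ?G"
  proof -
    have "sets (lborel::real measure) = sigma_sets UNIV (range (\<lambda>a::real. {..a}))"
      by (subst sets_lborel, subst borel_eq_atMost) (auto simp: sets_measure_of_conv)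
    also have "\<dots> = sigma_sets UNIV ?G"
      by (rule sigma_sets_eqI) (auto intro: sigma_sets_top)
    finally show ?thesis by simp
  qed
  have ml: "measure lborel ({-R..R} \<inter> {y. y \<le> x}) = max 0 (min R x + R)" for x
  proof -
    have "{-R..R} \<inter> {y. y \<le> x} = {-R..min R x}" by auto
    moreover have "measure lborel {-R..min R x} = max 0 (min R x + R)"
    proof (cases "-R \<le> min R x")
      case True
      then have "measure lborel {-R..min R x} = min R x - - R" by (rule measure_lborel_Icc)
      moreover have "0 \<le> min R x + R" using True by linarith
      ultimately show ?thesis by (simp only: max_absorb2 diff_minus_eq_add)
    next
      case False
      then have "{-R..min R x} = {}" by simp
      moreover have "min R x + R \<le> 0" using False by linarith
      ultimately show ?thesis by (simp only: measure_empty max_absorb1)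
    qed
    ultimately show ?thesis by (simp only:)
  qed
  have "(\<lambda>n. measure lborel ({-R..R} \<inter> (\<lambda>y. y + \<epsilon> n) -` E \<inter> F)) \<longlonglongrightarrow> 1 * measure lborel ({-R..R} \<inter> E \<inter> F)"
  proof (rule joining_tendsto[where G="?G" and K'="{-(\<bar>R\<bar>+b)..\<bar>R\<bar>+b}"])
    show "Int_stable ?G" by (auto simp: Int_stable_def)
    show "sets (lborel::real measure) = sigma_sets (space lborel) ?G" by (rule sG)
    fix n x assume "x \<in> {-R..R}" then show "x + \<epsilon> n \<in> {-(\<bar>R\<bar>+b)..\<bar>R\<bar>+b}"
      using b[of n] by (auto simp: abs_le_iff)
  next
    fix E F :: "real set" assume "E \<in> ?G" "F \<in> ?G"
    then consider "E = UNIV" "F = UNIV" | a where "E = UNIV" "F = {..a}" | a where "E = {..a}" "F = UNIV"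
      | a b where "E = {..a}" "F = {..b}" by auto
    then show "(\<lambda>n. measure lborel ({-R..R} \<inter> (\<lambda>y. y + \<epsilon> n) -` E \<inter> F)) \<longlonglongrightarrow> 1 * measure lborel ({-R..R} \<inter> E \<inter> F)"
    proof cases
      case (3 a)
      have "{-R..R} \<inter> (\<lambda>y. y + \<epsilon> n) -` E \<inter> F = {-R..R} \<inter> {y. y \<le> a - \<epsilon> n}" for n using 3 by auto
      moreover have "{-R..R} \<inter> E \<inter> F = {-R..R} \<inter> {y. y \<le> a - 0}" using 3 by auto
      ultimately show ?thesis by (simp only: mult_1 ml) (intro tendsto_intros \<epsilon>)
    next
      case (4 a b)
      have "{-R..R} \<inter> (\<lambda>y. y + \<epsilon> n) -` E \<inter> F = {-R..R} \<inter> {y. y \<le> min (a - \<epsilon> n) b}" for n using 4 by auto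
      moreover have "{-R..R} \<inter> E \<inter> F = {-R..R} \<inter> {y. y \<le> min (a - 0) b}" using 4 by auto
      ultimately show ?thesis by (simp only: mult_1 ml) (intro tendsto_intros \<epsilon>)
    qed simp_all
  qed (use E F lborel_translation in \<open>auto simp: emeasure_lborel_Icc_eq\<close>)
  then show ?thesis by (simp add: vimage_def)
qed

text \<open>
  Continuity of translations extends the invariance from rational to all real translations. By Fubini,
  almost every \<open>y\<close> then has the property that \<open>y + s\<close> lies in \<open>A\<close> for almost all \<open>s\<close> or for almost no
  \<open>s\<close>, according to whether \<open>y \<in> A\<close>; one such \<open>y\<close> in \<open>A\<close> is enough to make \<open>A\<close> conull.
\<close>

lemma lborel_rational_invariant_trivial:
  assumes A[measurable]: "A \<in> sets (borel::real measure)"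
    and inv: "\<And>q. q \<in> \<rat> \<Longrightarrow> AE y in lborel. y \<in> A \<longleftrightarrow> y + q \<in> A"
  shows "(AE y in lborel. y \<in> A) \<or> (AE y in lborel. y \<notin> A)"
proof -
  have all: "AE y in lborel. y \<in> A \<longleftrightarrow> y + s \<in> A" for s
  proof -
    define A' where "A' = {y. y + s \<in> A}"
    have A'[measurable]: "A' \<in> sets borel" unfolding A'_def by measurable
    have "\<exists>q\<in>\<rat>. \<bar>q - s\<bar> < 1 / Suc n" for n
    proof -
      obtain q where "q \<in> \<rat>" "s < q" "q < s + 1 / Suc n"
        using Rats_dense_in_real[of s "s + 1 / Suc n"] by auto
      then show ?thesis by (intro bexI[of _ q]) auto
    qed
    then obtain q where q: "\<And>n. q n \<in> \<rat>" "\<And>n. \<bar>q n - s\<bar> < 1 / Suc n" by metis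
    \<comment> \<open>\<open>y + (q n - s)\<close> lies in \<open>A'\<close> iff \<open>y + q n\<close> lies in \<open>A\<close>, that is, for almost all \<open>y\<close>, iff \<open>y\<close> does;
      so the sequences below are constant, and continuity identifies their limit\<close>
    have lim0: "(\<lambda>n. q n - s) \<longlonglongrightarrow> 0"
    proof (rule tendsto_rabs_zero_cancel, rule tendsto_sandwich[OF _ _ tendsto_const])
      show "(\<lambda>n. 1 / real (Suc n)) \<longlonglongrightarrow> 0" using LIMSEQ_inverse_real_of_nat by (simp add: inverse_eq_divide)
    qed (use q(2) in \<open>auto intro!: always_eventually less_imp_le\<close>)
    have eq: "measure lborel ({-R..R} \<inter> A \<inter> F) = measure lborel ({-R..R} \<inter> A' \<inter> F)"
      if [measurable]: "F \<in> sets borel" for F R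
    proof -
      have "measure lborel ({-R..R} \<inter> {y. y + (q n - s) \<in> A'} \<inter> F) = measure lborel ({-R..R} \<inter> A \<inter> F)" for n
        unfolding measure_def
        by (rule arg_cong[where f=enn2real], rule emeasure_eq_AE) (use inv[OF q(1)[of n]] in \<open>auto simp: A'_def\<close>)
      with lborel_translation_tendsto[OF lim0 A', of F R] show ?thesis
        by (simp add: LIMSEQ_const_iff)
    qed
    have z: "AE y in lborel. y \<notin> B" if [measurable]: "B \<in> sets borel" and "\<And>R::nat. measure lborel ({-real R..real R} \<inter> B) = 0" for B
    proof -
      have "AE y in lborel. \<forall>R::nat. y \<notin> {-real R..real R} \<inter> B"
      proof (subst AE_all_countable, rule allI, rule AE_not_in)
        fix R :: nat
        have "emeasure lborel ({-real R..real R} \<inter> B) \<le> emeasure lborel {-real R..real R}" by (intro emeasure_mono) auto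
        then have "emeasure lborel ({-real R..real R} \<inter> B) < \<infinity>" by (auto simp: emeasure_lborel_Icc_eq intro: le_less_trans)
        with that(2)[of R] show "{-real R..real R} \<inter> B \<in> null_sets lborel"
          by (auto simp: null_sets_def measure_def enn2real_eq_0_iff)
      qed
      moreover have "\<exists>R::nat. y \<in> {-real R..real R}" for y :: real
      proof -
        obtain n :: nat where "\<bar>y\<bar> \<le> real n" using real_arch_simple by blast
        then show ?thesis by (intro exI[of _ n]) (auto simp: abs_le_iff)
      qed
      ultimately show ?thesis by (auto elim!: eventually_mono)
    qed
    have "AE y in lborel. y \<notin> A \<inter> - A'"
      by (rule z) (use eq[of "-A'"] in \<open>auto simp: Int_assoc\<close>)
    moreover have "AE y in lborel. y \<notin> A' \<inter> - A"
      by (rule z) (use eq[of "-A"] in \<open>auto simp: Int_assoc\<close>)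
    ultimately show ?thesis by eventually_elim (auto simp: A'_def)
  qed
  have "AE y in lborel. AE s in lborel. y \<in> A \<longleftrightarrow> y + s \<in> A"
  proof (subst lborel_pair.AE_commute)
    show "{x \<in> space (lborel \<Otimes>\<^sub>M lborel). (fst x \<in> A) = (fst x + snd x \<in> A)} \<in> sets (lborel \<Otimes>\<^sub>M lborel)"
      by measurable
  qed (use all in auto)
  then show ?thesis
  proof (cases "\<exists>y\<in>A. AE s in lborel. y + s \<in> A")
    case True
    then obtain y where "AE s in lborel. y + s \<in> A" by auto
    then have "AE x in distr lborel borel ((+) y). x \<in> A" by (subst AE_distr_iff) auto
    then show ?thesis unfolding lborel_distr_plus ..
  next
    case False
    then show ?thesis using \<open>AE y in lborel. AE s in lborel. y \<in> A \<longleftrightarrow> y + s \<in> A\<close>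
      by (intro disjI2) (auto elim!: eventually_mono)
  qed
qed

section \<open>Finite powers\<close>

lemma (in sigma_finite_measure) pred_AE:
  assumes [measurable]: "Measurable.pred (N \<Otimes>\<^sub>M M) (\<lambda>p. Q (fst p) (snd p))"
  shows "Measurable.pred N (\<lambda>x. AE y in M. Q x y)"
proof -
  have eq: "(AE y in M. Q x y) \<longleftrightarrow> (\<integral>\<^sup>+ y. indicator {p. \<not> Q (fst p) (snd p)} (x, y) \<partial>M) = 0"
    if x[measurable]: "x \<in> space N" for x
  proof -
    have "(\<lambda>y. indicator {p. \<not> Q (fst p) (snd p)} (x, y)) \<in> borel_measurable M"
      by (rule measurable_compose[OF measurable_Pair1'[OF x]]) measurable
    then show ?thesis by (subst nn_integral_0_iff_AE) (auto simp: indicator_def)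
  qed
  have "(\<lambda>x. \<integral>\<^sup>+ y. indicator {p. \<not> Q (fst p) (snd p)} (x, y) \<partial>M) \<in> borel_measurable N"
    by (intro borel_measurable_nn_integral) simp
  then have "Measurable.pred N (\<lambda>x. (\<integral>\<^sup>+ y. indicator {p. \<not> Q (fst p) (snd p)} (x, y) \<partial>M) = 0)"
    by measurable
  then show ?thesis by (rule measurable_cong[THEN iffD2, rotated]) (rule eq)
qed

lemma (in product_sigma_finite) AE_PiM_insert:
  assumes I: "finite I" "i \<notin> I" and P: "Measurable.pred (PiM (insert i I) M) P"
  shows "(AE x in PiM (insert i I) M. P x) \<longleftrightarrow> (AE x in PiM I M. AE y in M i. P (x(i := y)))"
proof -
  interpret I: finite_product_sigma_finite M I by standard fact
  interpret Mi: sigma_finite_measure "M i" by (rule sigma_finite_measures)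
  note P[measurable]
  let ?N = "{x \<in> space (PiM (insert i I) M). \<not> P x}"
  have upd: "(\<lambda>(x, y). x(i := y)) \<in> measurable (PiM I M \<Otimes>\<^sub>M M i) (PiM (insert i I) M)"
    by (rule measurable_add_dim)
  have upd1: "(\<lambda>y. x(i := y)) \<in> measurable (M i) (PiM (insert i I) M)" if "x \<in> space (PiM I M)" for x
    using measurable_component_update[OF that I(2)] .
  have "(AE x in PiM (insert i I) M. P x) \<longleftrightarrow> integral\<^sup>N (PiM (insert i I) M) (indicator ?N) = 0"
    by (simp add: AE_iff_null[of "PiM (insert i I) M" P] null_sets_def)
  also have "integral\<^sup>N (PiM (insert i I) M) (indicator ?N) = (\<integral>\<^sup>+ x. (\<integral>\<^sup>+ y. indicator ?N (x(i := y)) \<partial>(M i)) \<partial>(PiM I M))"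
    by (rule product_nn_integral_insert[OF I]) simp
  also have "\<dots> = 0 \<longleftrightarrow> (AE x in PiM I M. (\<integral>\<^sup>+ y. indicator ?N (x(i := y)) \<partial>(M i)) = 0)"
  proof (rule nn_integral_0_iff_AE)
    have "(\<lambda>p. indicator ?N ((\<lambda>(x, y). x(i := y)) p)) \<in> borel_measurable (PiM I M \<Otimes>\<^sub>M M i)"
      by (rule measurable_compose[OF upd]) simp
    then show "(\<lambda>x. \<integral>\<^sup>+ y. indicator ?N (x(i := y)) \<partial>(M i)) \<in> borel_measurable (PiM I M)"
      by (intro sigma_finite_measure.borel_measurable_nn_integral[OF sigma_finite_measures]) (simp add: split_beta')
  qed
  also have "\<dots> \<longleftrightarrow> (AE x in PiM I M. AE y in M i. P (x(i := y)))"
  proof (rule AE_cong)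
    fix x assume x: "x \<in> space (PiM I M)"
    note [measurable] = upd1[OF x]
    have "(\<integral>\<^sup>+ y. indicator ?N (x(i := y)) \<partial>(M i)) = 0 \<longleftrightarrow> (AE y in M i. indicator ?N (x(i := y)) = (0::ennreal))"
      by (rule nn_integral_0_iff_AE) simp
    also have "\<dots> \<longleftrightarrow> (AE y in M i. P (x(i := y)))"
      by (rule AE_cong) (use measurable_space[OF upd1[OF x]] in \<open>auto simp: indicator_def\<close>)
    finally show "((\<integral>\<^sup>+ y. indicator ?N (x(i := y)) \<partial>(M i)) = 0) = (AE y in M i. P (x(i := y)))" .
  qed
  finally show ?thesis .
qed

text \<open>
  Invariance is only required up to null sets, so that it is inherited by sections of invariant sets in a
  product; countability allows the exceptional null sets of all members to be collected into one.
\<close>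

definition ergodic_family :: "'a measure \<Rightarrow> ('a \<Rightarrow> 'a) set \<Rightarrow> bool" where
  "ergodic_family M \<S> \<longleftrightarrow> countable \<S> \<and> \<S> \<subseteq> measurable M M \<and>
     (\<forall>A\<in>sets M. (\<forall>S\<in>\<S>. AE x in M. x \<in> A \<longleftrightarrow> S x \<in> A) \<longrightarrow>
        (AE x in M. x \<in> A) \<or> (AE x in M. x \<notin> A))"

text \<open>
  Induction on the number of coordinates. Almost every section in the new coordinate is invariant under
  the whole family, hence null or conull. The set \<open>B\<close> of the base points with conull section is
  invariant under the family in the remaining coordinates, so it is null or conull by the induction hypothesis,
  and so is \<open>A\<close>.
\<close>

lemma ergodic_family_power:
  fixes M :: "'a measure"
  assumes sf: "sigma_finite_measure M" and erg: "ergodic_family M \<S>"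
    and I: "finite I"
    and A: "A \<in> sets (PiM I (\<lambda>_. M))"
    and inv: "\<And>i S. i \<in> I \<Longrightarrow> S \<in> \<S> \<Longrightarrow> AE x in PiM I (\<lambda>_. M). x \<in> A \<longleftrightarrow> x(i := S (x i)) \<in> A"
  shows "(AE x in PiM I (\<lambda>_. M). x \<in> A) \<or> (AE x in PiM I (\<lambda>_. M). x \<notin> A)"
  using I A inv
proof (induction I arbitrary: A rule: finite_induct)
  case empty
  have "AE x in PiM {} (\<lambda>_. M). x = (\<lambda>_. undefined)"
    by (auto intro!: AE_I2 simp: space_PiM)
  then have "AE x in PiM {} (\<lambda>_. M). x \<in> A \<longleftrightarrow> (\<lambda>_. undefined) \<in> A"
    by eventually_elim simp
  then show ?case
    by (cases "(\<lambda>_. undefined) \<in> A") simp_all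
next
  case (insert i I)
  interpret product_sigma_finite "\<lambda>_. M" using sf by (simp add: product_sigma_finite_def)
  interpret M: sigma_finite_measure M by fact
  have cS: "countable \<S>" and mS: "\<And>S. S \<in> \<S> \<Longrightarrow> S \<in> measurable M M"
    using erg unfolding ergodic_family_def by blast+
  note A[measurable] = insert.prems(1)
  note I = insert.hyps(1,2)
  have upd[measurable]: "(\<lambda>p. (fst p)(i := snd p)) \<in> measurable (PiM I (\<lambda>_. M) \<Otimes>\<^sub>M M) (PiM (insert i I) (\<lambda>_. M))"
    using measurable_add_dim[of i I "\<lambda>_. M"] by (simp add: split_beta')
  have upd1: "(\<lambda>y. x(i := y)) \<in> measurable M (PiM (insert i I) (\<lambda>_. M))" if "x \<in> space (PiM I (\<lambda>_. M))" for x
    using measurable_component_update[OF that I(2)] .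
  have updS: "(\<lambda>x. x(j := S (x j))) \<in> measurable (PiM J (\<lambda>_. M)) (PiM J (\<lambda>_. M))" if "j \<in> J" "S \<in> \<S>" for j J S
  proof -
    have c: "(\<lambda>x. x k) \<in> measurable (PiM J (\<lambda>_. M)) M" if "k \<in> J" for k
      using that by (rule measurable_component_singleton)
    have "(\<lambda>x. if k = j then S (x j) else x k) \<in> measurable (PiM J (\<lambda>_. M)) M" if "k \<in> J" for k
      using c[OF that] measurable_compose[OF c[OF \<open>j \<in> J\<close>] mS[OF \<open>S \<in> \<S>\<close>]] by (cases "k = j") simp_all
    then have "(\<lambda>x. \<lambda>k\<in>J. if k = j then S (x j) else x k) \<in> measurable (PiM J (\<lambda>_. M)) (PiM J (\<lambda>_. M))"
      by (rule measurable_restrict)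
    then show ?thesis
      by (rule measurable_cong[THEN iffD1, rotated])
         (use that(1) in \<open>auto simp: space_PiM PiE_iff extensional_def fun_eq_iff\<close>)
  qed
  have pr: "Measurable.pred (PiM (insert i I) (\<lambda>_. M)) (\<lambda>x. x \<in> A \<longleftrightarrow> x(j := S (x j)) \<in> A)"
    if "j \<in> insert i I" "S \<in> \<S>" for j S
  proof -
    have inA: "Measurable.pred (PiM (insert i I) (\<lambda>_. M)) (\<lambda>x. x \<in> A)" by simp
    show ?thesis
      by (rule pred_intros_logic(6)[OF inA measurable_compose[OF updS[OF that] inA]])
  qed
  have AEi: "AE x in PiM I (\<lambda>_. M). AE y in M. x(i := y) \<in> A \<longleftrightarrow> (x(i := y))(j := S ((x(i := y)) j)) \<in> A"
    if "j \<in> insert i I" "S \<in> \<S>" for j S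
    using insert.prems(2)[OF that] unfolding AE_PiM_insert[OF I pr[OF that]] .
  have "AE x in PiM I (\<lambda>_. M). \<forall>S\<in>\<S>. AE y in M. x(i := y) \<in> A \<longleftrightarrow> x(i := S y) \<in> A"
    unfolding AE_ball_countable[OF cS]
  proof
    fix S assume "S \<in> \<S>"
    from AEi[OF insertI1 this] show "AE x in PiM I (\<lambda>_. M). AE y in M. x(i := y) \<in> A \<longleftrightarrow> x(i := S y) \<in> A"
      by (simp only: fun_upd_same fun_upd_upd)
  qed
  then have triv: "AE x in PiM I (\<lambda>_. M). (AE y in M. x(i := y) \<in> A) \<or> (AE y in M. x(i := y) \<notin> A)"
  proof (rule AE_mp, intro AE_I2 impI)
    fix x assume x: "x \<in> space (PiM I (\<lambda>_. M))" and "\<forall>S\<in>\<S>. AE y in M. x(i := y) \<in> A \<longleftrightarrow> x(i := S y) \<in> A"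
    moreover have "{y \<in> space M. x(i := y) \<in> A} \<in> sets M"
      using measurable_sets[OF upd1[OF x] A] by (simp add: vimage_def Collect_conj_eq Int_commute)
    moreover have "AE y in M. (y \<in> {y \<in> space M. x(i := y) \<in> A}) = (S y \<in> {y \<in> space M. x(i := y) \<in> A})"
      if "S \<in> \<S>" "AE y in M. x(i := y) \<in> A \<longleftrightarrow> x(i := S y) \<in> A" for S
      using that(2) AE_space by eventually_elim (use measurable_space[OF mS[OF that(1)]] in auto)
    ultimately have "(AE y in M. y \<in> {y \<in> space M. x(i := y) \<in> A}) \<or> (AE y in M. y \<notin> {y \<in> space M. x(i := y) \<in> A})"
      using erg unfolding ergodic_family_def by blast
    then show "(AE y in M. x(i := y) \<in> A) \<or> (AE y in M. x(i := y) \<notin> A)"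
    proof (elim disjE)
      assume "AE y in M. y \<in> {y \<in> space M. x(i := y) \<in> A}"
      then show ?thesis by (intro disjI1) (auto elim: eventually_mono)
    next
      assume "AE y in M. y \<notin> {y \<in> space M. x(i := y) \<in> A}"
      then have "AE y in M. x(i := y) \<notin> A" using AE_space by eventually_elim auto
      then show ?thesis ..
    qed
  qed
  define B where "B = {x \<in> space (PiM I (\<lambda>_. M)). AE y in M. x(i := y) \<in> A}"
  have B: "B \<in> sets (PiM I (\<lambda>_. M))"
  proof -
    have "Measurable.pred (PiM I (\<lambda>_. M) \<Otimes>\<^sub>M M) (\<lambda>p. (fst p)(i := snd p) \<in> A)"
      by measurable
    then have "Measurable.pred (PiM I (\<lambda>_. M)) (\<lambda>x. AE y in M. x(i := y) \<in> A)"
      by (intro M.pred_AE) (simp add: split_beta')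
    then show ?thesis unfolding B_def by measurable
  qed
  have "(AE x in PiM I (\<lambda>_. M). x \<in> B) \<or> (AE x in PiM I (\<lambda>_. M). x \<notin> B)"
  proof (rule insert.IH[OF B])
    fix j S assume j: "j \<in> I" and S: "S \<in> \<S>"
    have "j \<noteq> i" using j I by auto
    have "AE x in PiM I (\<lambda>_. M). AE y in M. x(i := y) \<in> A \<longleftrightarrow> (x(j := S (x j)))(i := y) \<in> A"
    proof -
      have "(x(i := y))(j := S ((x(i := y)) j)) = (x(j := S (x j)))(i := y)" for x y
        using \<open>j \<noteq> i\<close> by auto
      with AEi[OF insertI2[OF j] S] show ?thesis by (simp only:)
    qed
    then show "AE x in PiM I (\<lambda>_. M). (x \<in> B) = (x(j := S (x j)) \<in> B)"
    proof (rule AE_mp, intro AE_I2 impI)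
      fix x assume x: "x \<in> space (PiM I (\<lambda>_. M))"
        and eq: "AE y in M. (x(i := y) \<in> A) = ((x(j := S (x j)))(i := y) \<in> A)"
      have "(AE y in M. x(i := y) \<in> A) \<longleftrightarrow> (AE y in M. (x(j := S (x j)))(i := y) \<in> A)"
      proof
        assume "AE y in M. x(i := y) \<in> A"
        with eq show "AE y in M. (x(j := S (x j)))(i := y) \<in> A" by eventually_elim simp
      next
        assume "AE y in M. (x(j := S (x j)))(i := y) \<in> A"
        with eq show "AE y in M. x(i := y) \<in> A" by eventually_elim simp
      qed
      then show "(x \<in> B) = (x(j := S (x j)) \<in> B)"
        using x measurable_space[OF updS[OF j S] x] by (auto simp: B_def)
    qed
  qed
  then show ?case
  proof
    assume "AE x in PiM I (\<lambda>_. M). x \<in> B"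
    then have "AE x in PiM I (\<lambda>_. M). AE y in M. x(i := y) \<in> A" by eventually_elim (auto simp: B_def)
    then have "AE x in PiM (insert i I) (\<lambda>_. M). x \<in> A" by (subst AE_PiM_insert[OF I]) simp_all
    then show ?thesis ..
  next
    assume "AE x in PiM I (\<lambda>_. M). x \<notin> B"
    then have "AE x in PiM I (\<lambda>_. M). AE y in M. x(i := y) \<notin> A" using triv AE_space
      by eventually_elim (unfold B_def, blast)
    then have "AE x in PiM (insert i I) (\<lambda>_. M). x \<notin> A" by (subst AE_PiM_insert[OF I]) simp_all
    then show ?thesis ..
  qed
qed

lemma measure_preserving_map_power:
  assumes sf: "sigma_finite_measure M" and I: "finite I"
    and mp: "\<And>i. i \<in> I \<Longrightarrow> measure_preserving_map M (S i)"
  shows "measure_preserving_map (PiM I (\<lambda>_. M)) (\<lambda>x. \<lambda>i\<in>I. S i (x i))"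
proof -
  interpret product_sigma_finite "\<lambda>_. M" using sf by (simp add: product_sigma_finite_def)
  have S: "S i \<in> measurable M M" "distr M M (S i) = M" if "i \<in> I" for i
    using mp[OF that] by (auto simp: measure_preserving_map_def)
  have mS: "(\<lambda>x. \<lambda>i\<in>I. S i (x i)) \<in> measurable (PiM I (\<lambda>_. M)) (PiM I (\<lambda>_. M))"
    by (rule measurable_restrict, rule measurable_compose[OF _ S(1)], rule measurable_component_singleton)
  have "distr (PiM I (\<lambda>_. M)) (PiM I (\<lambda>_. M)) (\<lambda>x. \<lambda>i\<in>I. S i (x i)) = PiM I (\<lambda>_. M)"
  proof (rule PiM_eqI[OF I])
    fix A assume A: "\<And>i. i \<in> I \<Longrightarrow> A i \<in> sets M"
    have "(\<lambda>x. \<lambda>i\<in>I. S i (x i)) -` Pi\<^sub>E I A \<inter> space (PiM I (\<lambda>_. M)) = Pi\<^sub>E I (\<lambda>i. S i -` A i \<inter> space M)"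
      by (auto simp: space_PiM PiE_iff)
    then have "emeasure (distr (PiM I (\<lambda>_. M)) (PiM I (\<lambda>_. M)) (\<lambda>x. \<lambda>i\<in>I. S i (x i))) (Pi\<^sub>E I A)
      = (\<Prod>i\<in>I. emeasure M (S i -` A i \<inter> space M))"
      using A S by (subst emeasure_distr[OF mS]) (auto intro!: emeasure_PiM sets_PiM_I_finite I)
    also have "\<dots> = (\<Prod>i\<in>I. emeasure M (A i))"
      using A S by (intro prod.cong refl) (metis emeasure_distr)
    finally show "emeasure (distr (PiM I (\<lambda>_. M)) (PiM I (\<lambda>_. M)) (\<lambda>x. \<lambda>i\<in>I. S i (x i))) (Pi\<^sub>E I A) = (\<Prod>i\<in>I. emeasure M (A i))" .
  qed simp
  with mS show ?thesis by (simp add: measure_preserving_map_def)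
qed

lemma measure_power:
  assumes sf: "sigma_finite_measure M" and I: "finite I" and A: "\<And>i. i \<in> I \<Longrightarrow> A i \<in> sets M"
  shows "measure (PiM I (\<lambda>_. M)) (Pi\<^sub>E I A) = (\<Prod>i\<in>I. measure M (A i))"
proof -
  interpret product_sigma_finite "\<lambda>_. M" using sf by (simp add: product_sigma_finite_def)
  have "enn2real (\<Prod>i\<in>I. emeasure M (A i)) = (\<Prod>i\<in>I. enn2real (emeasure M (A i)))"
    using I by induction (auto simp: enn2real_mult)
  then show ?thesis using emeasure_PiM[OF I, of A] A by (simp add: measure_def)
qed

text \<open>
  On boxes the expression is the product of its one-coordinate versions, and boxes generate the product
  \<open>\<sigma>\<close>-algebra.
\<close>

lemma joining_tendsto_power:
  fixes M :: "'a measure" and c :: "'i \<Rightarrow> real"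
  assumes sf: "sigma_finite_measure M" and I: "finite I"
    and mp: "\<And>i n. i \<in> I \<Longrightarrow> measure_preserving_map M (\<psi> i n)"
    and Y: "\<And>i n. i \<in> I \<Longrightarrow> Y i n \<in> sets M" "\<And>i n. i \<in> I \<Longrightarrow> Y i n \<subseteq> K"
    and K: "K \<in> sets M" "emeasure M K < \<infinity>" "K' \<in> sets M" "emeasure M K' < \<infinity>"
    and KK': "\<And>i n x. i \<in> I \<Longrightarrow> x \<in> K \<Longrightarrow> \<psi> i n x \<in> K'"
    and lim: "\<And>i E F. i \<in> I \<Longrightarrow> E \<in> sets M \<Longrightarrow> F \<in> sets M \<Longrightarrow>
       (\<lambda>n. measure M (Y i n \<inter> \<psi> i n -` E \<inter> F)) \<longlonglongrightarrow> c i * measure M (K \<inter> E \<inter> F)"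
    and E: "E \<in> sets (PiM I (\<lambda>_. M))" and F: "F \<in> sets (PiM I (\<lambda>_. M))"
  shows "(\<lambda>n. measure (PiM I (\<lambda>_. M)) ((\<Pi>\<^sub>E i\<in>I. Y i n) \<inter> (\<lambda>x. \<lambda>i\<in>I. \<psi> i n (x i)) -` E \<inter> F))
     \<longlonglongrightarrow> (\<Prod>i\<in>I. c i) * measure (PiM I (\<lambda>_. M)) ((\<Pi>\<^sub>E i\<in>I. K) \<inter> E \<inter> F)"
proof -
  interpret product_sigma_finite "\<lambda>_. M" using sf by (simp add: product_sigma_finite_def)
  let ?G = "{Pi\<^sub>E I E | E. \<forall>i\<in>I. E i \<in> sets M}"
  have \<psi>: "\<psi> i n \<in> measurable M M" if "i \<in> I" for i n
    using mp[OF that] by (auto simp: measure_preserving_map_def)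
  have sp: "Y i n \<subseteq> space M" if "i \<in> I" for i n using sets.sets_into_space[OF Y(1)[OF that]] .
  show ?thesis
  proof (rule joining_tendsto[where G="?G" and K'="\<Pi>\<^sub>E i\<in>I. K'"])
    show "Int_stable ?G" by (rule Int_stable_PiE)
    show "?G \<subseteq> Pow (space (PiM I (\<lambda>_. M)))"
      using sets.sets_into_space by (fastforce simp: space_PiM PiE_iff)
    show "space (PiM I (\<lambda>_. M)) \<in> ?G" by (auto simp: space_PiM)
    show "sets (PiM I (\<lambda>_. M)) = sigma_sets (space (PiM I (\<lambda>_. M))) ?G"
      using prod_algebra_eq_finite[OF I, of "\<lambda>_. M"] by (simp add: sets_PiM space_PiM Pi_iff)
    show "measure_preserving_map (PiM I (\<lambda>_. M)) (\<lambda>x. \<lambda>i\<in>I. \<psi> i n (x i))" for n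
      by (rule measure_preserving_map_power[OF sf I mp])
    show "(\<Pi>\<^sub>E i\<in>I. Y i n) \<in> sets (PiM I (\<lambda>_. M))" for n using Y by (intro sets_PiM_I_finite I) auto
    show "(\<Pi>\<^sub>E i\<in>I. Y i n) \<subseteq> (\<Pi>\<^sub>E i\<in>I. K)" for n using Y by (intro PiE_mono) auto
    show "(\<Pi>\<^sub>E i\<in>I. K) \<in> sets (PiM I (\<lambda>_. M))" "(\<Pi>\<^sub>E i\<in>I. K') \<in> sets (PiM I (\<lambda>_. M))"
      using K by (auto intro!: sets_PiM_I_finite I)
    show "emeasure (PiM I (\<lambda>_. M)) (\<Pi>\<^sub>E i\<in>I. K) < \<infinity>" "emeasure (PiM I (\<lambda>_. M)) (\<Pi>\<^sub>E i\<in>I. K') < \<infinity>"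
      using K I by (simp_all add: emeasure_PiM less_top[symmetric] ennreal_prod_eq_top del: prod_constant)
    show "(\<lambda>i\<in>I. \<psi> i n (x i)) \<in> (\<Pi>\<^sub>E i\<in>I. K')" if "x \<in> (\<Pi>\<^sub>E i\<in>I. K)" for n x
      using that KK' by (auto simp: PiE_iff)
  next
    fix E' F' assume "E' \<in> ?G" "F' \<in> ?G"
    then obtain E F where E: "E' = Pi\<^sub>E I E" "\<And>i. i \<in> I \<Longrightarrow> E i \<in> sets M"
      and F: "F' = Pi\<^sub>E I F" "\<And>i. i \<in> I \<Longrightarrow> F i \<in> sets M" by auto
    have 1: "(\<Pi>\<^sub>E i\<in>I. Y i n) \<inter> (\<lambda>x. \<lambda>i\<in>I. \<psi> i n (x i)) -` E' \<inter> F' = (\<Pi>\<^sub>E i\<in>I. Y i n \<inter> \<psi> i n -` E i \<inter> F i)" for n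
      unfolding E F by (auto simp: PiE_iff)
    have m1: "Y i n \<inter> \<psi> i n -` E i \<inter> F i \<in> sets M" if "i \<in> I" for i n
    proof -
      have "Y i n \<inter> \<psi> i n -` E i \<inter> F i = Y i n \<inter> (\<psi> i n -` E i \<inter> space M) \<inter> F i" using sp[OF that, of n] by auto
      then show ?thesis using Y(1)[OF that] measurable_sets[OF \<psi>[OF that] E(2)[OF that]] F(2)[OF that] by auto
    qed
    have 2: "(\<Pi>\<^sub>E i\<in>I. K) \<inter> E' \<inter> F' = (\<Pi>\<^sub>E i\<in>I. K \<inter> E i \<inter> F i)"
      unfolding E F by (auto simp: PiE_iff)
    have "(\<lambda>n. \<Prod>i\<in>I. measure M (Y i n \<inter> \<psi> i n -` E i \<inter> F i)) \<longlonglongrightarrow> (\<Prod>i\<in>I. c i * measure M (K \<inter> E i \<inter> F i))"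
      by (intro tendsto_prod lim E F)
    then show "(\<lambda>n. measure (PiM I (\<lambda>_. M)) ((\<Pi>\<^sub>E i\<in>I. Y i n) \<inter> (\<lambda>x. \<lambda>i\<in>I. \<psi> i n (x i)) -` E' \<inter> F'))
       \<longlonglongrightarrow> (\<Prod>i\<in>I. c i) * measure (PiM I (\<lambda>_. M)) ((\<Pi>\<^sub>E i\<in>I. K) \<inter> E' \<inter> F')"
      unfolding 1 2 using m1 K E F by (simp add: measure_power[OF sf I] prod.distrib)
  qed (use E F in auto)
qed

section \<open>Codes of points and the flow\<close>

text \<open>
  The numbers \<open>c \<in> C n\<close> are the positions of the copies of the tower \<open>F n\<close> in \<open>F (Suc n)\<close>. Assumption
  \<open>C_sep\<close> makes the copies disjoint. The summand 1 in \<open>C_nest\<close> leaves a margin at both ends of every tower; the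
  margins add up to infinity, so every finite translate of a point stays inside all late towers
  and the flow is defined everywhere. By \<open>h_grow\<close> the copies fill at most half of the next tower, so
  the total measure is infinite.
\<close>

locale cut_and_stack =
  fixes C :: "nat \<Rightarrow> real set" and h :: "nat \<Rightarrow> real"
  assumes C_finite: "finite (C n)"
    and C_zero: "0 \<in> C n"
    and h_pos: "0 < h 0"
    and C_sep: "\<lbrakk>c \<in> C n; c' \<in> C n; c \<noteq> c'\<rbrakk> \<Longrightarrow> 2 * h n \<le> \<bar>c - c'\<bar>"
    and C_nest: "c \<in> C n \<Longrightarrow> \<bar>c\<bar> + h n + 1 \<le> h (Suc n)"
    and h_grow: "2 * h n * card (C n) \<le> h (Suc n)"
begin

definition F :: "nat \<Rightarrow> real set" where "F n = {-h n..<h n}"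

definition Z :: "point set" where "Z = {z. \<forall>n. z (Suc n) \<in> C n}"

definition height :: "nat \<Rightarrow> point \<Rightarrow> real" where "height n z = (\<Sum>k\<le>n. z k)"

text \<open>
  The equivalence of codes; it refers to the group of digit changes, not to the flow.
\<close>

definition same_orbit :: "point \<Rightarrow> point \<Rightarrow> bool" where
  "same_orbit z w \<longleftrightarrow> (\<exists>n. height n z = height n w \<and> (\<forall>k>n. z k = w k))"

definition covered :: "nat \<Rightarrow> real \<Rightarrow> bool" where
  "covered n s \<longleftrightarrow> (\<exists>c\<in>C n. s - c \<in> F n)"

text \<open>
  At most one summand is present, because the copies of \<open>F n\<close> are disjoint; the value is 0 outside of
  the copies.
\<close>

definition digit :: "nat \<Rightarrow> real \<Rightarrow> real" where
  "digit n s = (\<Sum>c\<in>C n. if s - c \<in> F n then c else 0)"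

text \<open>
  The fundamental domain. A point lies in the \<open>n\<close>-th tower exactly for those \<open>n\<close> from some first one on;
  \<open>D\<close> selects the code whose digits before this tower are 0. So \<open>z 0\<close> is the height in the first
  tower of the point, and it lies outside of all copies of earlier towers.
\<close>

definition D :: "point set" where
  "D = {z \<in> Z. \<forall>n. z 0 \<in> F n \<or> z (Suc n) = 0 \<and> \<not> covered n (z 0)}"

text \<open>
  Reads a height in the \<open>n\<close>-th tower downwards, through copies of lower and lower towers, until it lies in no
  copy any more. For \<open>s \<in> F n\<close> the result is the beginning of the code in \<open>D\<close> of a point of height \<open>s\<close>.
\<close>

primrec expand :: "nat \<Rightarrow> real \<Rightarrow> point" where
  "expand 0 s = (\<lambda>k. if k = 0 then s else 0)"
| "expand (Suc n) s =
     (if covered n s then (expand n (s - digit n s))(Suc n := digit n s)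
      else (\<lambda>k. if k = 0 then s else 0))"

definition glue :: "nat \<Rightarrow> point \<Rightarrow> point" where
  "glue n z = (\<lambda>k. if k \<le> n then expand n (height n z) k else z k)"

text \<open>
  The representative in \<open>D\<close> of the point coded by \<open>z\<close>. Any \<open>n\<close> with \<open>height n z \<in> F n\<close> would give the same
  result (\<open>rep_eq_glue\<close>). The value outside of \<open>Z\<close> is an arbitrary element of \<open>D\<close>.
\<close>

definition rep :: "point \<Rightarrow> point" where
  "rep z = (if z \<in> Z then glue (LEAST n. height n z \<in> F n) z else (\<lambda>_. 0))"

definition shift :: "real \<Rightarrow> point \<Rightarrow> point" where "shift t z = z(0 := z 0 + t)"

definition T :: "real \<Rightarrow> point \<Rightarrow> point" where "T t z = rep (shift t z)"

lemma h_gt_0: "0 < h n"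
proof (induction n)
  case (Suc n)
  then show ?case using C_nest[OF C_zero, of n] by simp
qed (rule h_pos)

lemma F_shift: "s \<in> F n \<Longrightarrow> c \<in> C n \<Longrightarrow> s + c \<in> F (Suc n)"
  using C_nest[of c n] by (auto simp: F_def abs_if split: if_splits)

lemma F_mono: "n \<le> m \<Longrightarrow> F n \<subseteq> F m"
proof (rule lift_Suc_mono_le[of F])
  show "F k \<subseteq> F (Suc k)" for k using F_shift[OF _ C_zero, of _ k] by auto
qed

lemma zero_in_F: "0 \<in> F n"
  using h_gt_0[of n] by (simp add: F_def)

lemma digit_eq:
  assumes c: "c \<in> C n" and s: "s - c \<in> F n"
  shows "digit n s = c"
proof -
  have uniq: "c' = c" if "c' \<in> C n" "s - c' \<in> F n" for c'
  proof (rule ccontr)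
    assume "c' \<noteq> c"
    from C_sep[OF that(1) c this] that(2) s show False by (auto simp: F_def abs_if split: if_splits)
  qed
  have "digit n s = (\<Sum>c'\<in>C n. if c' = c then c else 0)"
    unfolding digit_def
  proof (rule sum.cong[OF refl])
    fix c' assume "c' \<in> C n"
    then show "(if s - c' \<in> F n then c' else 0) = (if c' = c then c else 0)"
      using uniq[of c'] s by (cases "c' = c") auto
  qed
  then show ?thesis using c C_finite by simp
qed

lemma digit_in_C: "digit n s \<in> C n"
proof (cases "covered n s")
  case True
  then show ?thesis using digit_eq unfolding covered_def by metis
next
  case False
  then have "digit n s = 0" unfolding digit_def covered_def by (intro sum.neutral) auto
  then show ?thesis using C_zero by simp
qed

lemma height_0: "height 0 z = z 0" and height_Suc: "height (Suc n) z = height n z + z (Suc n)"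
  by (simp_all add: height_def)

lemma height_cong: "(\<And>k. k \<le> n \<Longrightarrow> z k = w k) \<Longrightarrow> height n z = height n w"
  unfolding height_def by (intro sum.cong) auto

lemma height_in_F_mono:
  assumes "z \<in> Z" "n \<le> m" "height n z \<in> F n" shows "height m z \<in> F m"
  using assms(2)
proof (induction m rule: dec_induct)
  case (step m)
  have "z (Suc m) \<in> C m" using assms(1) by (simp add: Z_def)
  from F_shift[OF step.IH this] show ?case by (simp add: height_Suc)
qed (rule assms(3))

lemma height_bound: "z \<in> Z \<Longrightarrow> \<bar>height n z\<bar> + n \<le> \<bar>z 0\<bar> + h n"
proof (induction n)
  case 0 then show ?case using h_pos by (simp add: height_0)
next
  case (Suc n)
  have "z (Suc n) \<in> C n" using Suc.prems by (auto simp: Z_def)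
  from C_nest[OF this] Suc.IH[OF Suc.prems] show ?case by (simp add: height_Suc)
qed

text \<open>
  The margins in \<open>C_nest\<close> give \<open>\<bar>height n z\<bar> \<le> \<bar>z 0\<bar> + h n - n\<close>, which is less than \<open>h n - \<bar>t\<bar>\<close> for large \<open>n\<close>.
\<close>

lemma eventually_in_tower:
  assumes "z \<in> Z"
  shows "\<forall>\<^sub>F n in sequentially. height n z + t \<in> F n"
proof -
  obtain N :: nat where N: "\<bar>z 0\<bar> + \<bar>t\<bar> < real N" using reals_Archimedean2 by blast
  show ?thesis
  proof (rule eventually_sequentiallyI)
    fix n assume "N \<le> n"
    with N height_bound[OF assms, of n] have "\<bar>height n z\<bar> + \<bar>t\<bar> < h n" by linarith
    then show "height n z + t \<in> F n" by (auto simp: F_def abs_if split: if_splits)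
  qed
qed

lemma ex_in_tower: "z \<in> Z \<Longrightarrow> \<exists>n. height n z \<in> F n"
  using eventually_in_tower[of z 0] by (auto simp: eventually_sequentially)

lemma shift_in_Z[simp]: "shift t z \<in> Z \<longleftrightarrow> z \<in> Z"
  by (simp add: shift_def Z_def)

lemma height_shift: "height n (shift t z) = height n z + t"
  by (induction n) (simp_all add: height_0 height_Suc, simp_all add: shift_def)

lemma height_expand: "height n (expand n s) = s"
proof (induction n arbitrary: s)
  case (Suc n)
  show ?case
  proof (cases "covered n s")
    case True
    have "height n ((expand n (s - digit n s))(Suc n := digit n s)) = height n (expand n (s - digit n s))"
      by (rule height_cong) auto
    then show ?thesis using True Suc.IH by (simp add: height_Suc fun_upd_same del: fun_upd_apply)
  next
    case False
    then show ?thesis by (simp add: height_def)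
  qed
qed (simp add: height_0)

lemma expand_in_F: "s \<in> F n \<Longrightarrow> expand n s 0 \<in> F n"
proof (induction n arbitrary: s)
  case (Suc n)
  show ?case
  proof (cases "covered n s")
    case True
    then have "s - digit n s \<in> F n" using digit_eq unfolding covered_def by metis
    from Suc.IH[OF this] F_mono[of n "Suc n"] True show ?thesis by auto
  qed (use Suc.prems in simp)
qed simp

text \<open>
  If \<open>s\<close> lies in no copy of \<open>F n\<close>, it lies in no copy of an earlier \<open>F j\<close> either, because such a copy is part of
  \<open>F n\<close>, which is its own copy at position 0.
\<close>

lemma expand_in_D: "s \<in> F n \<Longrightarrow> expand n s \<in> D"
proof (induction n arbitrary: s)
  case 0
  then show ?case using F_mono[of 0] C_zero by (auto simp: D_def Z_def)
next
  case (Suc n)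
  show ?case
  proof (cases "covered n s")
    case True
    then have s: "s - digit n s \<in> F n" using digit_eq unfolding covered_def by metis
    with Suc.IH[OF s] expand_in_F[OF s] digit_in_C[of n s] True show ?thesis
      by (auto simp: D_def Z_def)
  next
    case False
    have "s \<in> F j \<or> \<not> covered j s" for j
    proof (cases "j \<le> n")
      case True
      have "\<not> covered j s" if "j \<noteq> n"
      proof
        assume "covered j s"
        then obtain c where "c \<in> C j" "s - c \<in> F j" unfolding covered_def by blast
        from F_shift[OF this(2,1)] F_mono[of "Suc j" n] True that have "s - 0 \<in> F n" by auto
        with C_zero False show False unfolding covered_def by blast
      qed
      with False show ?thesis by auto
    next
      case False
      then show ?thesis using F_mono[of "Suc n" j] Suc.prems by auto
    qed
    with False C_zero show ?thesis by (auto simp: D_def Z_def)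
  qed
qed

lemma D_subset_Z: "D \<subseteq> Z" by (auto simp: D_def)

lemma D_low_digits:
  assumes "z \<in> D" "z 0 \<notin> F n" "k \<le> Suc n" shows "height k z = z 0"
  using assms(3)
proof (induction k)
  case (Suc k)
  then have "z 0 \<notin> F k" using F_mono[of k n] assms(2) by auto
  with assms(1) have "z (Suc k) = 0" unfolding D_def by blast
  with Suc show ?case by (simp add: height_Suc)
qed (simp add: height_0)

lemma D_height_in_F:
  assumes z: "z \<in> D" shows "height n z \<in> F n \<longleftrightarrow> z 0 \<in> F n"
proof (induction n)
  case (Suc n)
  show ?case
  proof (cases "z 0 \<in> F n")
    case True
    with Suc have "height n z \<in> F n" by simp
    with height_in_F_mono[of z n "Suc n"] D_subset_Z z True F_mono[of n "Suc n"] show ?thesis by auto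
  next
    case False
    with D_low_digits[OF z False, of "Suc n"] show ?thesis by simp
  qed
qed (simp add: height_0)

lemma expand_Suc_glue:
  assumes z: "z \<in> Z" and n: "height n z \<in> F n"
  shows "expand (Suc n) (height (Suc n) z) = (expand n (height n z))(Suc n := z (Suc n))"
proof -
  have c: "z (Suc n) \<in> C n" using z by (auto simp: Z_def)
  have e: "height (Suc n) z - z (Suc n) = height n z" by (simp add: height_Suc)
  with c n have "covered n (height (Suc n) z)" unfolding covered_def by (intro bexI[of _ "z (Suc n)"]) simp_all
  moreover have "digit n (height (Suc n) z) = z (Suc n)" using c n e by (intro digit_eq) simp_all
  ultimately show ?thesis using e by simp
qed

text \<open>
  Reading downwards inverts taking partial sums on \<open>D\<close>: while \<open>z 0\<close> is in an earlier tower, the last step down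
  recovers the last digit; once it is not, all digits are 0 and the height is \<open>z 0\<close> itself.
\<close>

lemma D_expand:
  assumes z: "z \<in> D" shows "z 0 \<in> F n \<Longrightarrow> k \<le> n \<Longrightarrow> expand n (height n z) k = z k"
proof (induction n arbitrary: k)
  case (Suc n)
  show ?case
  proof (cases "z 0 \<in> F n")
    case True
    then have "height n z \<in> F n" using D_height_in_F[OF z] by simp
    then have e: "expand (Suc n) (height (Suc n) z) = (expand n (height n z))(Suc n := z (Suc n))"
      using D_subset_Z z by (intro expand_Suc_glue) auto
    show ?thesis unfolding e using Suc.IH[OF True, of k] Suc.prems(2) by (cases "k = Suc n") auto
  next
    case False
    have hn: "height (Suc n) z = z 0" by (rule D_low_digits[OF z False]) simp
    have nc: "\<not> covered n (z 0)" using z False unfolding D_def by blast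
    have "z k = 0" if "k \<noteq> 0"
    proof -
      obtain j where j: "k = Suc j" "j \<le> n" using Suc.prems(2) \<open>k \<noteq> 0\<close> by (cases k) auto
      then have "z 0 \<notin> F j" using F_mono[of j n] False by auto
      with z j show ?thesis unfolding D_def by blast
    qed
    with hn nc show ?thesis by simp
  qed
qed (simp add: height_0)

lemma glue_Suc:
  assumes "z \<in> Z" "height n z \<in> F n" shows "glue (Suc n) z = glue n z"
  using expand_Suc_glue[OF assms] by (auto simp: glue_def fun_eq_iff le_Suc_eq)

lemma glue_mono:
  assumes "z \<in> Z" "height n z \<in> F n" "n \<le> m" shows "glue m z = glue n z"
  using assms(3)
proof (induction m rule: dec_induct)
  case (step m)
  with glue_Suc[OF assms(1) height_in_F_mono[OF assms(1) step(1) assms(2)]] show ?case by simp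
qed simp

lemma rep_eq_glue:
  assumes "z \<in> Z" "height n z \<in> F n" shows "rep z = glue n z"
proof -
  let ?m = "LEAST n. height n z \<in> F n"
  have 1: "height ?m z \<in> F ?m" by (rule LeastI[of _ n]) (rule assms(2))
  have 2: "?m \<le> n" by (rule Least_le) (rule assms(2))
  have "rep z = glue ?m z" using assms(1) unfolding rep_def by (rule if_P)
  also have "\<dots> = glue n z" by (rule glue_mono[OF assms(1) 1 2, symmetric])
  finally show ?thesis .
qed

lemma rep_tower:
  assumes "z \<in> Z" "height n z \<in> F n"
  shows "height n (rep z) = height n z" "rep z 0 \<in> F n" "k > n \<Longrightarrow> rep z k = z k"
proof -
  have "height n (rep z) = height n (expand n (height n z))"
    unfolding rep_eq_glue[OF assms] by (rule height_cong) (simp add: glue_def)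
  then show "height n (rep z) = height n z" by (simp add: height_expand)
  show "rep z 0 \<in> F n" unfolding rep_eq_glue[OF assms] using expand_in_F[OF assms(2)] by (simp add: glue_def)
  show "k > n \<Longrightarrow> rep z k = z k" unfolding rep_eq_glue[OF assms] by (simp add: glue_def)
qed

lemma rep_in_D: "rep z \<in> D"
proof (cases "z \<in> Z")
  case True
  then obtain n where n: "height n z \<in> F n" using ex_in_tower by blast
  have e: "expand n (height n z) \<in> D" "expand n (height n z) 0 \<in> F n"
    using expand_in_D[OF n] expand_in_F[OF n] by auto
  have "glue n z (Suc j) \<in> C j" for j
    using True e by (auto simp: glue_def Z_def D_def)
  moreover have "glue n z 0 \<in> F j \<or> glue n z (Suc j) = 0 \<and> \<not> covered j (glue n z 0)" for j
    using e F_mono[of n j] by (cases "Suc j \<le> n") (auto simp: glue_def D_def)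
  ultimately show ?thesis unfolding rep_eq_glue[OF True n] D_def Z_def by blast
next
  case False
  then show ?thesis using C_zero zero_in_F by (auto simp: rep_def D_def Z_def)
qed

lemma rep_id: assumes "z \<in> D" shows "rep z = z"
proof -
  have z: "z \<in> Z" using assms D_subset_Z by auto
  then obtain n where n: "height n z \<in> F n" using ex_in_tower by blast
  then have "z 0 \<in> F n" using D_height_in_F[OF assms] by simp
  then show ?thesis unfolding rep_eq_glue[OF z n] using D_expand[OF assms] by (auto simp: glue_def fun_eq_iff)
qed

lemma rep_same_orbit: assumes "z \<in> Z" shows "same_orbit (rep z) z"
proof -
  obtain n where n: "height n z \<in> F n" using ex_in_tower[OF assms] by blast
  show ?thesis unfolding same_orbit_def using rep_tower[OF assms n] by blast
qed

lemma height_tail: "height n z = height n w \<Longrightarrow> (\<And>k. k > n \<Longrightarrow> z k = w k) \<Longrightarrow> n \<le> m \<Longrightarrow> height m z = height m w"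
  by (induction m) (auto simp: height_Suc le_Suc_eq height_0)

text \<open>
  Far enough up, both codes lie in a common tower with equal heights and equal later digits, and \<open>rep\<close> can be
  computed from there.
\<close>

lemma rep_cong:
  assumes "z \<in> Z" "w \<in> Z" "same_orbit z w" shows "rep z = rep w"
proof -
  obtain n where n: "height n z = height n w" "\<And>k. k > n \<Longrightarrow> z k = w k" using assms(3) unfolding same_orbit_def by blast
  obtain m0 where m0: "height m0 z \<in> F m0" using ex_in_tower[OF assms(1)] by blast
  define m where "m = max n m0"
  have m: "height m z \<in> F m" using height_in_F_mono[OF assms(1) _ m0] by (simp add: m_def)
  moreover have e: "height m z = height m w" using height_tail[OF n] by (simp add: m_def)
  ultimately show ?thesis
    using rep_eq_glue[OF assms(1), of m] rep_eq_glue[OF assms(2), of m] n(2) by (auto simp: glue_def m_def)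
qed

lemma same_orbit_shift: "same_orbit z w \<Longrightarrow> same_orbit (shift t z) (shift t w)"
  unfolding same_orbit_def height_shift by (auto simp: shift_def)

lemma rep_shift_rep: "z \<in> Z \<Longrightarrow> rep (shift t (rep z)) = rep (shift t z)"
  using rep_in_D D_subset_Z by (intro rep_cong same_orbit_shift rep_same_orbit) auto

lemma T_in_D: "T t z \<in> D"
  unfolding T_def by (rule rep_in_D)

lemma T_0: "z \<in> D \<Longrightarrow> T 0 z = z"
  by (simp add: T_def shift_def rep_id)

lemma T_add: "z \<in> D \<Longrightarrow> T (s + t) z = T s (T t z)"
proof -
  assume "z \<in> D"
  then have "shift t z \<in> Z" using D_subset_Z by auto
  then have "T s (T t z) = rep (shift s (shift t z))" unfolding T_def by (rule rep_shift_rep)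
  also have "shift s (shift t z) = shift (s + t) z" by (simp add: shift_def ac_simps)
  finally show ?thesis by (simp add: T_def)
qed

lemma T_minus: "z \<in> D \<Longrightarrow> T (-t) (T t z) = z"
  using T_add[of z "-t" t] by (simp add: T_0)

end

section \<open>The invariant measure\<close>

context cut_and_stack
begin

definition U :: "nat \<Rightarrow> real measure" where "U n = distr (measure_pmf (pmf_of_set (C n))) borel (\<lambda>x. x)"

definition \<Omega> :: "point measure" where "\<Omega> = PiM UNIV U"

text \<open>
  Lebesgue measure in coordinate 0 and the uniform measures \<open>U n\<close> in the coordinates \<open>Suc n\<close>, with the
  coordinate 0 put in front of the sequence of digits.
\<close>

definition m :: "point measure" where
  "m = distr (lborel \<Otimes>\<^sub>M \<Omega>) borel (\<lambda>p. case_nat (fst p) (snd p))"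

lemma C_ne: "C n \<noteq> {}" using C_zero by auto

lemma card_C_pos: "0 < card (C n)" using C_finite C_ne by (simp add: card_gt_0_iff)

lemma sets_U[simp, measurable_cong]: "sets (U n) = sets borel" and space_U[simp]: "space (U n) = UNIV"
  by (simp_all add: U_def)

lemma measure_U:
  assumes "E \<in> sets borel" shows "measure (U n) E = card (C n \<inter> E) / card (C n)"
proof -
  have "measure (U n) E = measure (measure_pmf (pmf_of_set (C n))) E"
    using assms unfolding U_def by (subst measure_distr) auto
  then show ?thesis using C_ne C_finite by (simp add: measure_pmf_of_set)
qed

lemma prob_U: "prob_space (U n)"
  unfolding U_def by (rule measure_pmf.prob_space_distr) simp

lemma product_U: "product_prob_space U"
  by (simp add: product_prob_space_def product_sigma_finite_def product_prob_space_axioms_def prob_U prob_space_imp_sigma_finite)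

lemma emeasure_U: "E \<in> sets borel \<Longrightarrow> emeasure (U n) E = ennreal (card (C n \<inter> E) / card (C n))"
  using finite_measure.emeasure_eq_measure[of "U n" E] prob_U[of n] measure_U[of E n]
  by (simp add: prob_space_def)

lemma sets_\<Omega>[simp, measurable_cong]: "sets \<Omega> = sets borel"
proof -
  have "sets \<Omega> = sets (PiM UNIV (\<lambda>_. borel))" unfolding \<Omega>_def by (rule sets_PiM_cong) simp_all
  then show ?thesis by (simp add: sets_PiM_equal_borel)
qed

lemma space_\<Omega>[simp]: "space \<Omega> = UNIV"
  by (simp add: \<Omega>_def space_PiM PiE_def)

lemma prob_\<Omega>: "prob_space \<Omega>"
  unfolding \<Omega>_def by (rule prob_space_PiM) (rule prob_U)

lemma coordinate[measurable]: "(\<lambda>z::point. z k) \<in> borel_measurable borel"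
  by (rule measurable_product_coordinates)

lemma point_measurable: "(\<And>k. (\<lambda>x. f x k) \<in> borel_measurable M) \<Longrightarrow> f \<in> measurable M (borel :: point measure)"
  by (rule measurable_coordinatewise_then_product)

lemma case_nat_borel:
  assumes [measurable]: "f \<in> borel_measurable M" "g \<in> measurable M (borel :: point measure)"
  shows "(\<lambda>x. case_nat (f x) (g x)) \<in> measurable M (borel :: point measure)"
proof (rule point_measurable)
  fix k show "(\<lambda>x. case_nat (f x) (g x) k) \<in> borel_measurable M"
    by (cases k) simp_all
qed

lemma case_nat_pair[measurable]: "(\<lambda>p. case_nat (fst p) (snd p)) \<in> measurable (lborel \<Otimes>\<^sub>M \<Omega>) (borel :: point measure)"
  by (rule case_nat_borel) simp_all

lemma sets_m[simp, measurable_cong]: "sets m = sets borel" and space_m[simp]: "space m = UNIV"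
  by (simp_all add: m_def)

lemma nn_integral_m:
  assumes f[measurable]: "f \<in> borel_measurable borel"
  shows "integral\<^sup>N m f = (\<integral>\<^sup>+ c. (\<integral>\<^sup>+ y. f (case_nat y c) \<partial>lborel) \<partial>\<Omega>)"
proof -
  interpret prob_space \<Omega> by (rule prob_\<Omega>)
  interpret pair_sigma_finite lborel \<Omega> ..
  have "integral\<^sup>N m f = (\<integral>\<^sup>+ p. f (case_nat (fst p) (snd p)) \<partial>(lborel \<Otimes>\<^sub>M \<Omega>))"
    unfolding m_def by (rule nn_integral_distr) measurable
  also have "\<dots> = (\<integral>\<^sup>+ c. (\<integral>\<^sup>+ y. f (case_nat y c) \<partial>lborel) \<partial>\<Omega>)"
    by (subst nn_integral_snd[symmetric]) simp_all
  finally show ?thesis .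
qed

lemma AE_m:
  assumes [measurable]: "Measurable.pred borel P"
  shows "(AE z in m. P z) \<longleftrightarrow> (AE c in \<Omega>. AE y in lborel. P (case_nat y c))"
proof -
  interpret prob_space \<Omega> by (rule prob_\<Omega>)
  interpret pair_sigma_finite lborel \<Omega> ..
  have pm: "Measurable.pred (lborel \<Otimes>\<^sub>M \<Omega>) (\<lambda>p. P (case_nat (fst p) (snd p)))"
    by (rule measurable_compose[OF case_nat_pair]) simp
  have ps: "{p \<in> space (lborel \<Otimes>\<^sub>M \<Omega>). P (case_nat (fst p) (snd p))} \<in> sets (lborel \<Otimes>\<^sub>M \<Omega>)"
    using pm by (rule predE)
  have "(AE z in m. P z) \<longleftrightarrow> (AE p in lborel \<Otimes>\<^sub>M \<Omega>. P (case_nat (fst p) (snd p)))"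
    unfolding m_def by (rule AE_distr_iff) simp_all
  also have "\<dots> \<longleftrightarrow> (AE y in lborel. AE c in \<Omega>. P (case_nat y c))"
    by (rule AE_pair_iff[OF ps, symmetric])
  also have "\<dots> \<longleftrightarrow> (AE c in \<Omega>. AE y in lborel. P (case_nat y c))"
    by (rule AE_commute[OF ps])
  finally show ?thesis .
qed

lemma emeasure_m_rect:
  assumes [measurable]: "E \<in> sets borel" "B \<in> sets (borel :: point measure)"
  shows "emeasure m {z. z 0 \<in> E \<and> (\<lambda>n. z (Suc n)) \<in> B} = emeasure lborel E * emeasure \<Omega> B"
proof -
  interpret prob_space \<Omega> by (rule prob_\<Omega>)
  have [measurable]: "(\<lambda>z n. z (Suc n)) \<in> measurable (borel :: point measure) (borel :: point measure)"
    by (rule point_measurable) simp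
  have s: "{z. z 0 \<in> E \<and> (\<lambda>n. z (Suc n)) \<in> B} \<in> sets (borel :: point measure)"
    by measurable
  have "emeasure m {z. z 0 \<in> E \<and> (\<lambda>n. z (Suc n)) \<in> B}
     = emeasure (lborel \<Otimes>\<^sub>M \<Omega>) ((\<lambda>p. case_nat (fst p) (snd p)) -` {z. z 0 \<in> E \<and> (\<lambda>n. z (Suc n)) \<in> B} \<inter> space (lborel \<Otimes>\<^sub>M \<Omega>))"
    unfolding m_def by (rule emeasure_distr) (use s in simp_all)
  also have "(\<lambda>p. case_nat (fst p) (snd p)) -` {z. z 0 \<in> E \<and> (\<lambda>n. z (Suc n)) \<in> B} \<inter> space (lborel \<Otimes>\<^sub>M \<Omega>) = E \<times> B"
    by (auto simp: space_pair_measure)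
  also have "emeasure (lborel \<Otimes>\<^sub>M \<Omega>) (E \<times> B) = emeasure lborel E * emeasure \<Omega> B"
    by (rule emeasure_pair_measure_Times) simp_all
  finally show ?thesis .
qed

definition window :: "real \<Rightarrow> point set" where "window R = {z. z 0 \<in> {-R..R}}"

lemma window_borel[measurable]: "window R \<in> sets (borel :: point measure)"
  unfolding window_def by measurable

lemma emeasure_window: "emeasure m (window R) < \<infinity>"
proof -
  interpret prob_space \<Omega> by (rule prob_\<Omega>)
  have "emeasure m (window R) = emeasure lborel {-R..R} * emeasure \<Omega> UNIV"
    unfolding window_def using emeasure_m_rect[of "{-R..R}" UNIV] by simp
  then show ?thesis using emeasure_space_1 by (simp add: emeasure_lborel_Icc_eq)
qed

lemma UN_window: "(\<Union>R::nat. window (real R)) = UNIV"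
proof -
  have "\<exists>R::nat. z \<in> window (real R)" for z
  proof -
    obtain R :: nat where "\<bar>z 0\<bar> \<le> real R" using real_arch_simple by blast
    then show ?thesis by (intro exI[of _ R]) (auto simp: window_def abs_le_iff)
  qed
  then show ?thesis by auto
qed

lemma sigma_finite_m: "sigma_finite_measure m"
proof
  show "\<exists>A. countable A \<and> A \<subseteq> sets m \<and> \<Union>A = space m \<and> (\<forall>a\<in>A. emeasure m a \<noteq> \<infinity>)"
    using UN_window emeasure_window by (intro exI[of _ "range (\<lambda>R::nat. window (real R))"]) (auto simp: less_top)
qed

lemma Z_borel[measurable]: "Z \<in> sets (borel :: point measure)"
proof -
  have "closed (C n)" for n using C_finite by (rule finite_imp_closed)
  then have [measurable]: "C n \<in> sets borel" for n by simp
  show ?thesis unfolding Z_def by measurable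
qed

lemma AE_\<Omega>_digits: "AE c in \<Omega>. \<forall>n. c n \<in> C n"
  unfolding AE_all_countable
proof
  fix n
  have "closed (C n)" using C_finite by (rule finite_imp_closed)
  then have [measurable]: "C n \<in> sets borel" by simp
  interpret Un: prob_space "U n" by (rule prob_U)
  have "Un.prob (C n) = 1" using card_C_pos[of n] by (simp add: measure_U)
  then have "AE x in U n. x \<in> C n" by (subst (asm) Un.prob_eq_1) auto
  then show "AE c in \<Omega>. c n \<in> C n"
    unfolding \<Omega>_def by (intro AE_PiM_component) (auto intro: prob_U)
qed

lemma AE_Z: "AE z in m. z \<in> Z"
proof -
  have "AE c in \<Omega>. AE y in lborel. case_nat y c \<in> Z"
    using AE_\<Omega>_digits by eventually_elim (auto simp: Z_def)
  then show ?thesis by (subst AE_m) measurable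
qed

subsection \<open>Measure-preserving moves\<close>

text \<open>
  Digitwise changes \<open>\<sigma>\<close> together with a translation of coordinate 0 that may depend on the digits. The flow on
  codes, the digit rotations and the perturbations in the mixing argument are all of this form.
\<close>

definition move :: "(point \<Rightarrow> real) \<Rightarrow> (nat \<Rightarrow> real \<Rightarrow> real) \<Rightarrow> point \<Rightarrow> point" where
  "move \<alpha> \<sigma> z = case_nat (z 0 + \<alpha> (\<lambda>n. z (Suc n))) (\<lambda>n. \<sigma> n (z (Suc n)))"

lemma move_0: "move \<alpha> \<sigma> z 0 = z 0 + \<alpha> (\<lambda>n. z (Suc n))"
  and move_Suc: "move \<alpha> \<sigma> z (Suc n) = \<sigma> n (z (Suc n))"
  by (simp_all add: move_def)

lemma tail_measurable[measurable]: "(\<lambda>z n. z (Suc n)) \<in> measurable (borel :: point measure) (borel :: point measure)"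
  by (rule point_measurable) simp

text \<open>
  A permutation of \<open>C n\<close> preserves the uniform measure.
\<close>

lemma \<Omega>_preserving:
  assumes bij: "\<And>n. bij_betw (\<sigma> n) (C n) (C n)" and \<sigma>: "\<And>n. \<sigma> n \<in> borel_measurable borel"
  shows "measure_preserving_map \<Omega> (\<lambda>c n. \<sigma> n (c n))"
proof -
  have meas: "(\<lambda>c n. \<sigma> n (c n)) \<in> measurable \<Omega> \<Omega>"
    by (subst measurable_cong_sets[OF sets_\<Omega> sets_\<Omega>], rule point_measurable) (rule measurable_compose[OF coordinate \<sigma>])
  interpret product_prob_space U UNIV by (rule product_U)
  have U\<sigma>: "emeasure (U n) (\<sigma> n -` E) = emeasure (U n) E" if [measurable]: "E \<in> sets borel" for n E
  proof -
    have "bij_betw (\<sigma> n) (C n \<inter> \<sigma> n -` E) (C n \<inter> E)"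
    proof (rule bij_betw_subset[OF bij])
      have "\<sigma> n ` (C n \<inter> \<sigma> n -` E) = \<sigma> n ` C n \<inter> E" by auto
      then show "\<sigma> n ` (C n \<inter> \<sigma> n -` E) = C n \<inter> E" using bij[of n] by (simp add: bij_betw_def)
    qed simp
    then have "card (C n \<inter> \<sigma> n -` E) = card (C n \<inter> E)" by (rule bij_betw_same_card)
    moreover have "\<sigma> n -` E \<in> sets borel" using measurable_sets[OF \<sigma>, of E] that by simp
    ultimately show ?thesis by (simp add: emeasure_U)
  qed
  have "distr \<Omega> \<Omega> (\<lambda>c n. \<sigma> n (c n)) = \<Omega>"
    unfolding \<Omega>_def
  proof (rule PiM_eq)
    fix J :: "nat set" and E assume J: "finite J" and E: "\<And>j. j \<in> J \<Longrightarrow> E j \<in> sets (U j)"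
    have pre: "(\<lambda>c n. \<sigma> n (c n)) -` prod_emb UNIV U J (Pi\<^sub>E J E) \<inter> space (PiM UNIV U) = prod_emb UNIV U J (\<Pi>\<^sub>E j\<in>J. \<sigma> j -` E j)"
      by (auto simp: prod_emb_def space_PiM PiE_iff)
    have "emeasure (distr (PiM UNIV U) (PiM UNIV U) (\<lambda>c n. \<sigma> n (c n))) (prod_emb UNIV U J (Pi\<^sub>E J E)) =
      emeasure (PiM UNIV U) (prod_emb UNIV U J (\<Pi>\<^sub>E j\<in>J. \<sigma> j -` E j))"
      using meas J E by (subst emeasure_distr) (auto simp: \<Omega>_def pre intro!: sets_PiM_I)
    also have "\<dots> = (\<Prod>j\<in>J. emeasure (U j) (\<sigma> j -` E j))"
    proof (rule emeasure_PiM_emb)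
      fix i assume "i \<in> J" then show "\<sigma> i -` E i \<in> sets (U i)" using E measurable_sets[OF \<sigma>, of "E i" i] by simp
    qed (use J in auto)
    also have "\<dots> = (\<Prod>j\<in>J. emeasure (U j) (E j))"
      using E by (intro prod.cong refl U\<sigma>) simp
    finally show "emeasure (distr (PiM UNIV U) (PiM UNIV U) (\<lambda>c n. \<sigma> n (c n))) (prod_emb UNIV U J (Pi\<^sub>E J E)) = (\<Prod>j\<in>J. emeasure (U j) (E j))" .
  qed simp
  with meas show ?thesis by (simp add: measure_preserving_map_def)
qed

lemma move_measurable:
  assumes \<sigma>: "\<And>n. \<sigma> n \<in> borel_measurable borel" and \<alpha>: "\<alpha> \<in> borel_measurable borel"
  shows "move \<alpha> \<sigma> \<in> measurable (borel :: point measure) borel"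
  unfolding move_def[abs_def]
proof (rule case_nat_borel)
  show "(\<lambda>z n. \<sigma> n (z (Suc n))) \<in> measurable (borel :: point measure) borel"
    by (rule point_measurable) (rule measurable_compose[OF coordinate \<sigma>])
  show "(\<lambda>z. z 0 + \<alpha> (\<lambda>n. z (Suc n))) \<in> borel_measurable borel"
    by (rule borel_measurable_add[OF coordinate measurable_compose[OF tail_measurable \<alpha>]])
qed

text \<open>
  For fixed digits the translation preserves Lebesgue measure, so it may be dropped under the inner integral; the
  rest is the invariance of \<open>\<Omega>\<close>.
\<close>

lemma move_preserving:
  assumes bij: "\<And>n. bij_betw (\<sigma> n) (C n) (C n)" and \<sigma>: "\<And>n. \<sigma> n \<in> borel_measurable borel"
    and \<alpha>: "\<alpha> \<in> borel_measurable borel"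
  shows "measure_preserving_map m (move \<alpha> \<sigma>)"
proof -
  note mm[measurable] = move_measurable[OF \<sigma> \<alpha>]
  have \<Omega>p: "(\<lambda>c n. \<sigma> n (c n)) \<in> measurable \<Omega> \<Omega>" "distr \<Omega> \<Omega> (\<lambda>c n. \<sigma> n (c n)) = \<Omega>"
    using \<Omega>_preserving[OF bij \<sigma>] by (simp_all add: measure_preserving_map_def)
  have mm': "move \<alpha> \<sigma> \<in> measurable m m" by (subst measurable_cong_sets[OF sets_m sets_m]) (rule mm)
  have "distr m m (move \<alpha> \<sigma>) = m"
  proof (rule measure_eqI)
    fix E assume "E \<in> sets (distr m m (move \<alpha> \<sigma>))"
    then have E[measurable]: "E \<in> sets borel" by simp
    have cm: "(\<lambda>y. case_nat y c) \<in> measurable lborel (borel :: point measure)" for c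
      by (rule case_nat_borel) simp_all
    have "emeasure (distr m m (move \<alpha> \<sigma>)) E = (\<integral>\<^sup>+ z. indicator E (move \<alpha> \<sigma> z) \<partial>m)"
    proof -
      have "emeasure (distr m m (move \<alpha> \<sigma>)) E = (\<integral>\<^sup>+ z. indicator E z \<partial>(distr m m (move \<alpha> \<sigma>)))"
        by (rule nn_integral_indicator[symmetric]) simp
      also have "\<dots> = (\<integral>\<^sup>+ z. indicator E (move \<alpha> \<sigma> z) \<partial>m)"
        by (rule nn_integral_distr[OF mm']) simp
      finally show ?thesis .
    qed
    also have "\<dots> = (\<integral>\<^sup>+ c. (\<integral>\<^sup>+ y. indicator E (case_nat (y + \<alpha> c) (\<lambda>n. \<sigma> n (c n))) \<partial>lborel) \<partial>\<Omega>)"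
      by (subst nn_integral_m[OF measurable_compose[OF mm]]) (simp_all add: move_def)
    also have "\<dots> = (\<integral>\<^sup>+ c. (\<integral>\<^sup>+ y. indicator E (case_nat y (\<lambda>n. \<sigma> n (c n))) \<partial>lborel) \<partial>\<Omega>)"
    proof (rule nn_integral_cong)
      fix c
      note [measurable] = cm[of "\<lambda>n. \<sigma> n (c n)"]
      have "(\<integral>\<^sup>+ y. indicator E (case_nat y (\<lambda>n. \<sigma> n (c n))) \<partial>lborel) =
        (\<integral>\<^sup>+ y. indicator E (case_nat y (\<lambda>n. \<sigma> n (c n))) \<partial>(distr lborel borel ((+) (\<alpha> c))))"
        by (simp add: lborel_distr_plus)
      also have "\<dots> = (\<integral>\<^sup>+ y. indicator E (case_nat (\<alpha> c + y) (\<lambda>n. \<sigma> n (c n))) \<partial>lborel)"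
        by (rule nn_integral_distr) simp_all
      finally show "(\<integral>\<^sup>+ y. indicator E (case_nat (y + \<alpha> c) (\<lambda>n. \<sigma> n (c n))) \<partial>lborel) = (\<integral>\<^sup>+ y. indicator E (case_nat y (\<lambda>n. \<sigma> n (c n))) \<partial>lborel)"
        by (simp add: add.commute)
    qed
    also have "\<dots> = (\<integral>\<^sup>+ c. (\<integral>\<^sup>+ y. indicator E (case_nat y c) \<partial>lborel) \<partial>(distr \<Omega> \<Omega> (\<lambda>c n. \<sigma> n (c n))))"
    proof -
      have "(\<lambda>p. indicator E (case_nat (snd p) (fst p)) :: ennreal) \<in> borel_measurable (\<Omega> \<Otimes>\<^sub>M lborel)"
        by (rule measurable_compose[OF case_nat_borel[of snd _ fst], of _ "indicator E"]) simp_all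
      then have "(\<lambda>c. \<integral>\<^sup>+ y. indicator E (case_nat y c) \<partial>lborel) \<in> borel_measurable \<Omega>"
        by (intro lborel.borel_measurable_nn_integral) (simp add: split_beta')
      then show ?thesis by (subst nn_integral_distr[OF \<Omega>p(1)]) simp_all
    qed
    also have "\<dots> = emeasure m E"
      unfolding \<Omega>p(2) by (subst nn_integral_m[symmetric]) simp_all
    finally show "emeasure (distr m m (move \<alpha> \<sigma>)) E = emeasure m E" .
  qed simp
  with mm' show ?thesis by (simp add: measure_preserving_map_def)
qed

lemma shift_eq_move: "shift t = move (\<lambda>_. t) (\<lambda>_ x. x)"
  by (auto simp: fun_eq_iff shift_def move_def split: nat.split)

lemma shift_preserving: "measure_preserving_map m (shift t)"
  unfolding shift_eq_move by (rule move_preserving) (auto simp: bij_betw_def)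

end

context cut_and_stack
begin

subsection \<open>Digit rotations\<close>

lemma C_borel[measurable]: "C n \<in> sets borel"
  using C_finite by (intro borel_closed finite_imp_closed)

lemma F_borel[measurable]: "F n \<in> sets borel"
  by (simp add: F_def)

definition enum :: "nat \<Rightarrow> nat \<Rightarrow> real" where
  "enum n = (SOME e. bij_betw e {0..<card (C n)} (C n))"

lemma enum: "bij_betw (enum n) {0..<card (C n)} (C n)"
  unfolding enum_def using someI_ex[OF ex_bij_betw_nat_finite[OF C_finite[of n]]] .

text \<open>
  The cyclic rotations of an enumeration of \<open>C n\<close>: a group of permutations acting simply
  transitively (\<open>rot_ex1\<close>), extended by the identity.
\<close>

definition rot :: "nat \<Rightarrow> nat \<Rightarrow> real \<Rightarrow> real" where
  "rot n g c = (if c \<in> C n then enum n ((the_inv_into {0..<card (C n)} (enum n) c + g) mod card (C n)) else c)"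

lemma enum_ex:
  assumes "c \<in> C n" shows "\<exists>i<card (C n). c = enum n i"
proof -
  have "c \<in> enum n ` {0..<card (C n)}" using assms bij_betw_imp_surj_on[OF enum, of n] by simp
  then show ?thesis by (rule imageE) auto
qed

lemma enum_inj: "i < card (C n) \<Longrightarrow> j < card (C n) \<Longrightarrow> enum n i = enum n j \<longleftrightarrow> i = j"
  using bij_betw_imp_inj_on[OF enum, of n] by (auto simp: inj_on_eq_iff)

lemma rot_enum: "i < card (C n) \<Longrightarrow> rot n g (enum n i) = enum n ((i + g) mod card (C n))"
  using enum[of n] by (auto simp: rot_def bij_betw_def the_inv_into_f_f)

lemma rot_ex1:
  assumes "c \<in> C n" "c' \<in> C n"
  shows "\<exists>!g. g < card (C n) \<and> rot n g c = c'"
proof -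
  let ?L = "card (C n)"
  obtain i i' where i: "i < ?L" "c = enum n i" and i': "i' < ?L" "c' = enum n i'"
    using enum_ex assms by metis
  have eq: "rot n g c = c' \<longleftrightarrow> (i + g) mod ?L = i'" for g
    using i i' card_C_pos[of n] by (simp add: rot_enum enum_inj)
  show ?thesis unfolding eq
  proof (rule ex1I)
    show "(i' + ?L - i) mod ?L < ?L \<and> (i + (i' + ?L - i) mod ?L) mod ?L = i'"
      using i i' card_C_pos[of n] by (simp add: mod_add_right_eq)
  next
    fix g assume g: "g < ?L \<and> (i + g) mod ?L = i'"
    show "g = (i' + ?L - i) mod ?L"
    proof (cases "i + g < ?L")
      case True
      with g have "i' = i + g" by simp
      with g show ?thesis by simp
    next
      case False
      then have "(i + g) mod ?L = (i + g - ?L) mod ?L" by (simp add: le_mod_geq)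
      also have "i + g - ?L < ?L" using g i False by linarith
      then have "(i + g - ?L) mod ?L = i + g - ?L" by (rule mod_less)
      finally have "i' = i + g - ?L" using g by simp
      with g i False have "i' + ?L - i = g" by simp
      with g show ?thesis by simp
    qed
  qed
qed

lemma rot_zero: "rot n 0 c = c"
proof (cases "c \<in> C n")
  case True
  then obtain i where "i < card (C n)" "c = enum n i"
    using enum_ex by metis
  then show ?thesis by (simp add: rot_enum)
qed (simp add: rot_def)

lemma enum_in_C: "i < card (C n) \<Longrightarrow> enum n i \<in> C n"
  using enum[of n] by (auto simp: bij_betw_def)

lemma rot_in_C: "rot n g c \<in> C n \<longleftrightarrow> c \<in> C n"
  using card_C_pos[of n] by (auto simp: rot_def intro!: enum_in_C)

lemma rot_bij: "bij_betw (rot n g) (C n) (C n)"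
proof -
  have "rot n g ` C n \<subseteq> C n" using rot_in_C by auto
  moreover have "inj_on (rot n g) (C n)"
  proof (rule inj_onI)
    fix c c' assume c: "c \<in> C n" "c' \<in> C n" "rot n g c = rot n g c'"
    let ?L = "card (C n)"
    obtain i i' where i: "i < ?L" "c = enum n i" and i': "i' < ?L" "c' = enum n i'"
      using enum_ex c(1,2) by metis
    have "(i + g) mod ?L = (i' + g) mod ?L"
      using c(3) i i' card_C_pos[of n] by (simp add: rot_enum enum_inj)
    moreover have "(j + g) mod ?L = (if j + g mod ?L < ?L then j + g mod ?L else j + g mod ?L - ?L)" if "j < ?L" for j
    proof -
      have "(j + g) mod ?L = (j + g mod ?L) mod ?L" by (simp add: mod_add_right_eq)
      moreover have "g mod ?L < ?L" using card_C_pos[of n] by simp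
      moreover from this have "j + g mod ?L - ?L < ?L" using that by linarith
      then have "(j + g mod ?L - ?L) mod ?L = j + g mod ?L - ?L" by (rule mod_less)
      ultimately show ?thesis by (simp add: le_mod_geq not_less)
    qed
    ultimately have "i = i'" using i i' by (auto split: if_splits)
    with i i' show "c = c'" by simp
  qed
  ultimately show ?thesis using C_finite by (simp add: bij_betw_def endo_inj_surj)
qed

lemma finite_perm_measurable:
  fixes \<sigma> :: "real \<Rightarrow> real"
  assumes "\<And>c. c \<notin> C n \<Longrightarrow> \<sigma> c = c" shows "\<sigma> \<in> borel_measurable borel"
  by (rule measurable_discrete_difference[of "\<lambda>x. x" borel borel "C n"])
     (use assms C_finite in \<open>auto intro: countable_finite\<close>)

lemma rot_measurable: "rot n g \<in> borel_measurable borel"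
  by (rule finite_perm_measurable[of n]) (simp add: rot_def)

text \<open>
  The direct sum of the cyclic groups. Simple transitivity in every digit makes it act on \<open>Z\<close> so that any two codes of
  the same point are related by exactly one element (\<open>rotate_digits_ex1\<close>).
\<close>

definition rotations :: "(nat \<Rightarrow> nat) set" where
  "rotations = {g. (\<forall>n. g n < card (C n)) \<and> (\<exists>N. \<forall>n\<ge>N. g n = 0)}"

definition compensation :: "(nat \<Rightarrow> nat) \<Rightarrow> point \<Rightarrow> real" where
  "compensation g c = (\<Sum>n | g n \<noteq> 0. c n - rot n (g n) (c n))"

definition rotate_digits :: "(nat \<Rightarrow> nat) \<Rightarrow> point \<Rightarrow> point" where
  "rotate_digits g = move (compensation g) (\<lambda>n. rot n (g n))"

lemma rotations_countable: "countable rotations"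
proof (rule countable_subset)
  show "rotations \<subseteq> range (\<lambda>l::nat list. \<lambda>n. if n < length l then l ! n else 0)"
  proof
    fix g assume "g \<in> rotations"
    then obtain N where "\<And>n. n \<ge> N \<Longrightarrow> g n = 0" by (auto simp: rotations_def)
    then have "g = (\<lambda>n. if n < length (map g [0..<N]) then map g [0..<N] ! n else 0)" by auto
    then show "g \<in> range (\<lambda>l::nat list. \<lambda>n. if n < length l then l ! n else 0)" by blast
  qed
qed simp

lemma rotate_digits_preserving: "measure_preserving_map m (rotate_digits g)"
  unfolding rotate_digits_def
proof (rule move_preserving)
  have "(\<lambda>c. c n - rot n (g n) (c n)) \<in> borel_measurable borel" for n
    by (intro borel_measurable_diff coordinate measurable_compose[OF coordinate rot_measurable])
  then show "compensation g \<in> borel_measurable borel"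
    unfolding compensation_def[abs_def] by (rule borel_measurable_sum)
qed (rule rot_bij rot_measurable)+

lemma rotate_digits_Suc: "rotate_digits g z (Suc n) = rot n (g n) (z (Suc n))"
  by (simp add: rotate_digits_def move_Suc)

lemma rotate_digits_in_Z: "rotate_digits g z \<in> Z \<longleftrightarrow> z \<in> Z"
  by (simp add: Z_def rotate_digits_Suc rot_in_C)

lemma height_alt: "height n z = z 0 + (\<Sum>k<n. z (Suc k))"
  unfolding height_def by (simp add: sum.atMost_shift)

lemma rotate_digits_same_orbit:
  assumes "g \<in> rotations" shows "same_orbit (rotate_digits g z) z"
proof -
  obtain N where N: "\<And>n. n \<ge> N \<Longrightarrow> g n = 0" using assms by (auto simp: rotations_def)
  have "compensation g c = (\<Sum>n<N. c n - rot n (g n) (c n))" for c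
    unfolding compensation_def
  proof (rule sum.mono_neutral_left)
    show "{n. g n \<noteq> 0} \<subseteq> {..<N}"
    proof
      fix n assume "n \<in> {n. g n \<noteq> 0}"
      then show "n \<in> {..<N}" using N[of n] by (cases "N \<le> n") simp_all
    qed
  qed (auto simp: rot_zero)
  then have "height N (rotate_digits g z) = height N z"
    by (simp add: height_alt rotate_digits_Suc sum_subtractf) (simp add: rotate_digits_def move_0 sum_subtractf)
  moreover have "rotate_digits g z k = z k" if "k > N" for k
    using that N by (cases k) (auto simp: rotate_digits_Suc rot_zero)
  ultimately show ?thesis unfolding same_orbit_def by blast
qed

lemma same_orbit_sym: "same_orbit z w \<Longrightarrow> same_orbit w z"
  unfolding same_orbit_def by metis

lemma same_orbit_trans:
  assumes "same_orbit z w" "same_orbit w v" shows "same_orbit z v"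
proof -
  obtain n n' where n: "height n z = height n w" "\<And>k. k > n \<Longrightarrow> z k = w k"
    and n': "height n' w = height n' v" "\<And>k. k > n' \<Longrightarrow> w k = v k"
    using assms unfolding same_orbit_def by blast
  have "height (max n n') z = height (max n n') w" by (rule height_tail[OF n]) auto
  also have "\<dots> = height (max n n') v" by (rule height_tail[OF n']) auto
  finally show ?thesis unfolding same_orbit_def using n(2) n'(2) by (intro exI[of _ "max n n'"]) auto
qed

lemma same_orbit_eqI:
  assumes "same_orbit z w" "\<And>n. z (Suc n) = w (Suc n)" shows "z = w"
proof
  obtain n where "height n z = height n w" using assms(1) unfolding same_orbit_def by blast
  with assms(2) have "z 0 = w 0" by (simp add: height_alt)
  then show "z k = w k" for k using assms(2) by (cases k) auto
qed

lemma rotate_digits_ex1: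
  assumes z: "z \<in> Z" and w: "w \<in> Z" and zw: "same_orbit z w"
  shows "\<exists>!g. g \<in> rotations \<and> rotate_digits g z = w"
proof -
  have digits: "z (Suc n) \<in> C n" "w (Suc n) \<in> C n" for n using z w by (auto simp: Z_def)
  have "\<forall>n. \<exists>g. g < card (C n) \<and> rot n g (z (Suc n)) = w (Suc n)"
    using rot_ex1[OF digits] by blast
  then obtain g where g: "\<And>n. g n < card (C n)" "\<And>n. rot n (g n) (z (Suc n)) = w (Suc n)" by metis
  obtain N where N: "\<And>k. k > N \<Longrightarrow> z k = w k" using zw unfolding same_orbit_def by blast
  have "g n = 0" if "n \<ge> N" for n
  proof -
    have "rot n 0 (z (Suc n)) = w (Suc n)" using N[of "Suc n"] that by (simp add: rot_zero)
    with rot_ex1[OF digits, of n] g[of n] card_C_pos[of n] show ?thesis by blast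
  qed
  then have gr: "g \<in> rotations" using g(1) by (auto simp: rotations_def)
  moreover have "rotate_digits g z = w"
  proof (rule same_orbit_eqI)
    show "same_orbit (rotate_digits g z) w"
      by (rule same_orbit_trans[OF rotate_digits_same_orbit[OF gr] zw])
    show "rotate_digits g z (Suc n) = w (Suc n)" for n by (simp add: rotate_digits_Suc g)
  qed
  moreover have "g' = g" if g': "g' \<in> rotations" "rotate_digits g' z = w" for g'
  proof
    fix n
    have "rot n (g' n) (z (Suc n)) = w (Suc n)" using g'(2) rotate_digits_Suc[of g' z n] by simp
    moreover have "g' n < card (C n)" using g'(1) by (simp add: rotations_def)
    ultimately show "g' n = g n" using rot_ex1[OF digits, of n] g[of n] by blast
  qed
  ultimately show ?thesis by blast
qed

lemma rotate_digits_unique: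
  assumes "z \<in> Z" "g \<in> rotations" "g' \<in> rotations" "rotate_digits g z = rotate_digits g' z"
  shows "g = g'"
proof -
  have "\<exists>!g''. g'' \<in> rotations \<and> rotate_digits g'' z = rotate_digits g z"
    using assms(1,2) by (intro rotate_digits_ex1 same_orbit_sym[OF rotate_digits_same_orbit])
      (simp_all only: rotate_digits_in_Z)
  with assms show ?thesis by metis
qed

lemma rotate_digits_inj:
  assumes "z \<in> Z" "w \<in> Z" "g \<in> rotations" "rotate_digits g z = rotate_digits g w"
  shows "z = w"
proof (rule same_orbit_eqI)
  show "same_orbit z w"
    using same_orbit_trans[OF same_orbit_sym[OF rotate_digits_same_orbit[OF assms(3), of z]]]
      rotate_digits_same_orbit[OF assms(3), of w] assms(4) by simp
  fix n
  have "rot n (g n) (z (Suc n)) = rot n (g n) (w (Suc n))"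
    using assms(4) by (metis rotate_digits_Suc)
  then show "z (Suc n) = w (Suc n)"
    using rot_bij[of n "g n"] assms(1,2) by (auto simp: bij_betw_def inj_on_def Z_def)
qed

subsection \<open>Measurability of the flow\<close>

lemma digit_measurable[measurable]: "digit n \<in> borel_measurable borel"
  unfolding digit_def[abs_def] by measurable

lemma covered_pred[measurable]: "Measurable.pred borel (covered n)"
  unfolding covered_def[abs_def] using C_finite by (intro pred_intros_finite) measurable

lemma expand_measurable: "(\<lambda>s. expand n s k) \<in> borel_measurable borel"
proof (induction n arbitrary: k)
  case 0
  then show ?case by (cases k) simp_all
next
  case (Suc n)
  have "(\<lambda>s. expand n (s - digit n s) k) \<in> borel_measurable borel"
  proof (rule measurable_compose[where g="\<lambda>s. expand n s k"])
    show "(\<lambda>s. s - digit n s) \<in> borel_measurable borel"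
      by (intro borel_measurable_diff digit_measurable) simp
  qed (rule Suc)
  then have 1: "(\<lambda>s. if k = Suc n then digit n s else expand n (s - digit n s) k) \<in> borel_measurable borel"
    using digit_measurable[of n] by (cases "k = Suc n") (simp_all only: if_True if_False simp_thms)
  have 2: "(\<lambda>s::real. if k = 0 then s else 0) \<in> borel_measurable borel" by (cases "k = 0") simp_all
  have 3: "{s \<in> space borel. covered n s} \<in> sets borel" using covered_pred by (rule predE)
  have "(\<lambda>s. if covered n s then (if k = Suc n then digit n s else expand n (s - digit n s) k) else if k = 0 then s else 0) \<in> borel_measurable borel"
    by (rule measurable_If[OF 1 2 3])
  moreover have "expand (Suc n) s k = (if covered n s then (if k = Suc n then digit n s else expand n (s - digit n s) k) else if k = 0 then s else 0)" for s
    by simp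
  ultimately show ?case by presburger
qed

lemma height_measurable[measurable]: "height n \<in> borel_measurable borel"
  unfolding height_def[abs_def] by (intro borel_measurable_sum coordinate)

lemma glue_measurable: "glue n \<in> measurable borel (borel :: point measure)"
proof (rule point_measurable)
  fix k
  have "(\<lambda>z. expand n (height n z) k) \<in> borel_measurable borel"
    by (rule measurable_compose[OF height_measurable expand_measurable])
  then show "(\<lambda>z. glue n z k) \<in> borel_measurable borel"
    using coordinate[of k] by (cases "k \<le> n") (simp_all only: glue_def if_True if_False)
qed

lemma D_borel[measurable]: "D \<in> sets (borel :: point measure)"
proof -
  have "D = {z. z \<in> Z \<and> (\<forall>n. z 0 \<in> F n \<or> z (Suc n) = 0 \<and> \<not> covered n (z 0))}"
    by (auto simp: D_def)
  also have "\<dots> \<in> sets borel"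
  proof -
    have c: "Measurable.pred borel (\<lambda>z::point. covered n (z 0))" for n
      by (rule measurable_compose[OF coordinate covered_pred])
    have "Measurable.pred borel (\<lambda>z::point. z \<in> Z \<and> (\<forall>n. z 0 \<in> F n \<or> z (Suc n) = 0 \<and> \<not> covered n (z 0)))"
      by (intro pred_intros_logic pred_intros_countable c) measurable
    then show ?thesis by (simp add: pred_def)
  qed
  finally show ?thesis .
qed

definition M :: "point measure" where "M = restrict_space m D"

lemma space_M[simp]: "space M = D" by (simp add: M_def space_restrict_space)

lemma sets_M: "sets M = {A \<in> sets borel. A \<subseteq> D}"
proof -
  have "sets M = (\<inter>) D ` sets borel" by (simp add: M_def sets_restrict_space)
  also have "\<dots> = {A \<in> sets borel. A \<subseteq> D}" using D_borel by (auto simp: image_iff)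
  finally show ?thesis .
qed

lemma emeasure_M: "A \<in> sets M \<Longrightarrow> emeasure M A = emeasure m A"
  unfolding M_def by (rule emeasure_restrict_space) (auto simp: sets_restrict_space)

lemma measurable_M_iff: "f \<in> measurable N M \<longleftrightarrow> f \<in> measurable N borel \<and> (\<forall>x\<in>space N. f x \<in> D)"
  unfolding M_def by (subst measurable_restrict_space2_iff) (auto cong: measurable_cong_sets)

lemma rep_measurable: "rep \<in> measurable borel M"
proof -
  have hF: "Measurable.pred borel (\<lambda>z. height n z \<in> F n)" for n
    by (rule measurable_compose[OF height_measurable]) simp
  have "(\<lambda>z. glue (LEAST n. height n z \<in> F n) z) \<in> measurable borel (borel :: point measure)"
  proof (rule measurable_compose_countable[where f="\<lambda>n z. glue n z"])
    show "(\<lambda>z. LEAST n. height n z \<in> F n) \<in> measurable borel (count_space UNIV)"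
      by (rule measurable_Least) (rule hF)
  qed (rule glue_measurable)
  then have "rep \<in> measurable borel (borel :: point measure)"
    unfolding rep_def[abs_def] by (rule measurable_If) simp_all
  then show ?thesis by (simp add: measurable_M_iff rep_in_D)
qed

lemma shift_joint: "(\<lambda>p. shift (fst p) (snd p)) \<in> measurable (borel \<Otimes>\<^sub>M borel) (borel :: point measure)"
proof (rule point_measurable)
  have [measurable]: "(\<lambda>p. (snd p) k) \<in> borel_measurable (borel \<Otimes>\<^sub>M (borel :: point measure))" for k
    by (rule measurable_compose[OF measurable_snd coordinate])
  fix k show "(\<lambda>p. shift (fst p) (snd p) k) \<in> borel_measurable (borel \<Otimes>\<^sub>M borel)"
    by (cases "k = 0") (simp_all add: shift_def)
qed

lemma id_M_borel: "(\<lambda>z. z) \<in> measurable M (borel :: point measure)"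
  unfolding M_def by (rule measurable_restrict_space1) simp

lemma T_joint: "(\<lambda>(t, z). T t z) \<in> measurable (borel \<Otimes>\<^sub>M M) M"
proof -
  have "(\<lambda>p. (fst p, snd p)) \<in> measurable (borel \<Otimes>\<^sub>M M) (borel \<Otimes>\<^sub>M (borel :: point measure))"
    by (intro measurable_Pair measurable_fst measurable_compose[OF measurable_snd id_M_borel])
  from measurable_compose[OF measurable_compose[OF this shift_joint] rep_measurable]
  show ?thesis by (simp add: T_def split_beta')
qed

lemma shift_measurable: "shift t \<in> measurable borel (borel :: point measure)"
  using shift_preserving[of t] by (simp add: measure_preserving_map_def cong: measurable_cong_sets)

lemma T_measurable: "T t \<in> measurable M M"
  unfolding T_def[abs_def]
  by (rule measurable_compose[OF measurable_compose[OF id_M_borel shift_measurable] rep_measurable])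

subsection \<open>Invariance of the measure\<close>

text \<open>
  \<open>D\<close> meets every class of \<open>same_orbit\<close> in one point, and the group of rotations acts freely with these classes as
  orbits. Hence the preimage of \<open>E\<close> in \<open>D\<close> is cut into pieces \<open>X g\<close>, on which the flow is the translation of codes
  followed by the rotation \<open>g\<close>, and \<open>E\<close> is cut into the images \<open>Y g\<close> of these pieces. Each
  piece and its image have the same measure, because translations and rotations preserve \<open>m\<close>.
\<close>

lemma T_preserving: "measure_preserving_map M (T t)"
proof -
  have "distr M M (T t) = M"
  proof (rule measure_eqI)
    fix E assume "E \<in> sets (distr M M (T t))"
    then have E: "E \<in> sets borel" "E \<subseteq> D" by (auto simp: sets_M)
    let ?\<chi> = "\<lambda>g z. rotate_digits g (shift t z)"
    have \<chi>: "?\<chi> g \<in> measurable borel borel" and \<chi>p: "distr m m (?\<chi> g) = m" for g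
    proof -
      have r: "rotate_digits g \<in> measurable m m" "distr m m (rotate_digits g) = m"
        and s: "shift t \<in> measurable m m" "distr m m (shift t) = m"
        using rotate_digits_preserving shift_preserving by (auto simp: measure_preserving_map_def)
      show "distr m m (?\<chi> g) = m"
        using distr_distr[OF r(1) s(1)] r s by (simp add: comp_def)
      show "?\<chi> g \<in> measurable borel borel"
        using measurable_compose[OF s(1) r(1)] by (simp cong: measurable_cong_sets)
    qed
    define X where "X g = {z \<in> D. ?\<chi> g z \<in> E}" for g
    \<comment> \<open>the image of \<open>X g\<close>, written without images so that it is visibly measurable\<close>
    define Y where "Y g = {w \<in> E. ?\<chi> g (T (-t) w) = w}" for g
    have repE: "rep (shift t z) \<in> E \<longleftrightarrow> (\<exists>g\<in>rotations. z \<in> X g)" if z: "z \<in> D" for z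
    proof
      assume *: "rep (shift t z) \<in> E"
      have "shift t z \<in> Z" using z D_subset_Z by auto
      with rep_same_orbit[OF this] rep_in_D D_subset_Z obtain g where "g \<in> rotations" "?\<chi> g z = rep (shift t z)"
        using rotate_digits_ex1[of "shift t z" "rep (shift t z)"] same_orbit_sym[of "rep (shift t z)"] by blast
      with * z show "\<exists>g\<in>rotations. z \<in> X g" by (auto simp: X_def intro!: bexI[of _ g])
    next
      assume "\<exists>g\<in>rotations. z \<in> X g"
      then obtain g where g: "g \<in> rotations" "?\<chi> g z \<in> E" by (auto simp: X_def)
      have "rep (shift t z) = rep (?\<chi> g z)"
        using z D_subset_Z g by (intro rep_cong same_orbit_sym[OF rotate_digits_same_orbit]) (auto simp: rotate_digits_in_Z)
      also have "\<dots> = ?\<chi> g z" using g E by (intro rep_id) auto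
      finally show "rep (shift t z) \<in> E" using g by simp
    qed
    have disX: "disjoint_family_on X rotations"
      unfolding disjoint_family_on_def
    proof (intro ballI impI, rule ccontr)
      fix g g' assume g: "g \<in> rotations" "g' \<in> rotations" "g \<noteq> g'" and "X g \<inter> X g' \<noteq> {}"
      then obtain z where z: "z \<in> D" "?\<chi> g z \<in> E" "?\<chi> g' z \<in> E" by (auto simp: X_def)
      have w: "shift t z \<in> Z" using z D_subset_Z by auto
      have so: "same_orbit (shift t z) (?\<chi> g z)" "same_orbit (shift t z) (?\<chi> g' z)"
        by (rule same_orbit_sym, rule rotate_digits_same_orbit, rule g)+
      have "rep (?\<chi> g z) = rep (?\<chi> g' z)"
        by (rule rep_cong[OF _ _ same_orbit_trans[OF same_orbit_sym[OF so(1)] so(2)]])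
           (simp_all only: rotate_digits_in_Z w)
      then have "?\<chi> g z = ?\<chi> g' z" using z E by (simp add: rep_id subset_iff)
      then show False
        using rotate_digits_unique[OF w g(1,2)] g(3) by blast
    qed
    have disY: "disjoint_family_on Y rotations"
      unfolding disjoint_family_on_def
    proof (intro ballI impI, rule ccontr)
      fix g g' assume g: "g \<in> rotations" "g' \<in> rotations" "g \<noteq> g'" and "Y g \<inter> Y g' \<noteq> {}"
      then obtain w where w: "w \<in> E" "?\<chi> g (T (-t) w) = w" "?\<chi> g' (T (-t) w) = w" by (auto simp: Y_def)
      have u: "shift t (T (-t) w) \<in> Z" using T_in_D D_subset_Z by auto
      show False using rotate_digits_unique[OF u g(1,2)] w g(3) by simp
    qed
    have UY: "(\<Union>g\<in>rotations. Y g) = E"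
    proof
      show "E \<subseteq> (\<Union>g\<in>rotations. Y g)"
      proof
        fix w assume w: "w \<in> E"
        then have wZ: "w \<in> Z" using E D_subset_Z by auto
        have u: "shift t (T (-t) w) \<in> Z" using T_in_D D_subset_Z by auto
        have "same_orbit (shift t (T (-t) w)) (shift t (shift (-t) w))"
          unfolding T_def using wZ by (intro same_orbit_shift rep_same_orbit) simp
        then have "same_orbit (shift t (T (-t) w)) w" by (simp add: shift_def)
        from rotate_digits_ex1[OF u wZ this] w show "w \<in> (\<Union>g\<in>rotations. Y g)"
          by (auto simp: Y_def)
      qed
    qed (auto simp: Y_def)
    have mX: "X g \<in> sets borel" for g
    proof -
      have "X g = D \<inter> (?\<chi> g -` E \<inter> space borel)" by (auto simp: X_def)
      then show ?thesis using measurable_sets[OF \<chi> E(1)] D_borel by simp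
    qed
    have mY: "Y g \<in> sets borel" for g
    proof -
      have c: "rep \<in> measurable borel (borel :: point measure)" using rep_measurable by (simp add: measurable_M_iff)
      have "(\<lambda>w. ?\<chi> g (T (-t) w)) \<in> measurable borel borel"
        unfolding T_def by (rule measurable_compose[OF measurable_compose[OF shift_measurable c] \<chi>])
      then have "(\<lambda>w. ?\<chi> g (T (-t) w) k) \<in> borel_measurable borel" for k
        by (rule measurable_compose[OF _ coordinate])
      then have "{w \<in> space borel. ?\<chi> g (T (-t) w) k = w k} \<in> sets borel" for k
        by (intro borel_measurable_eq coordinate)
      then have "E \<inter> (\<Inter>k. {w \<in> space borel. ?\<chi> g (T (-t) w) k = w k}) \<in> sets borel"
        using E(1) by (intro sets.Int sets.countable_INT) auto
      also have "E \<inter> (\<Inter>k. {w \<in> space borel. ?\<chi> g (T (-t) w) k = w k}) = Y g"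
        by (auto simp: Y_def fun_eq_iff)
      finally show ?thesis .
    qed
    have XY: "emeasure m (X g) = emeasure m (Y g)" if g: "g \<in> rotations" for g
    proof -
      have "?\<chi> g -` Y g = X g"
      proof (intro equalityI subsetI)
        fix z assume "z \<in> ?\<chi> g -` Y g"
        then have z: "?\<chi> g z \<in> E" "?\<chi> g (T (-t) (?\<chi> g z)) = ?\<chi> g z" by (auto simp: Y_def)
        have "z \<in> Z" using z(1) E D_subset_Z by (auto simp: rotate_digits_in_Z subset_iff)
        have "shift t (T (-t) (?\<chi> g z)) = shift t z"
          by (rule rotate_digits_inj[OF _ _ g z(2)]) (use \<open>z \<in> Z\<close> T_in_D D_subset_Z in auto)
        then have "T (-t) (?\<chi> g z) = z" by (auto simp: shift_def fun_eq_iff split: if_splits)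
        with T_in_D[of "-t" "?\<chi> g z"] z(1) show "z \<in> X g" by (simp add: X_def)
      next
        fix z assume "z \<in> X g"
        then have z: "z \<in> D" "?\<chi> g z \<in> E" by (auto simp: X_def)
        have zZ: "z \<in> Z" using z D_subset_Z by auto
        have "T (-t) (?\<chi> g z) = rep (shift (-t) (shift t z))"
          unfolding T_def using zZ g
          by (intro rep_cong same_orbit_shift rotate_digits_same_orbit) (auto simp: rotate_digits_in_Z)
        also have "\<dots> = z" using z(1) by (simp add: shift_def rep_id)
        finally show "z \<in> ?\<chi> g -` Y g" using z by (simp add: Y_def)
      qed
      moreover have "emeasure m (Y g) = emeasure m (?\<chi> g -` Y g \<inter> space m)"
        using emeasure_distr[of "?\<chi> g" m m "Y g"] \<chi>[of g] \<chi>p[of g] mY by (simp cong: measurable_cong_sets)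
      ultimately show ?thesis by simp
    qed
    have "emeasure (distr M M (T t)) E = emeasure M (T t -` E \<inter> space M)"
      using E by (intro emeasure_distr T_measurable) (simp add: sets_M)
    also have "\<dots> = emeasure m (T t -` E \<inter> D)"
      using measurable_sets[OF T_measurable[of t], of E] E by (subst emeasure_M) (auto simp: sets_M)
    also have "T t -` E \<inter> D = (\<Union>g\<in>rotations. X g)"
      using repE by (auto simp: T_def X_def)
    also have "emeasure m \<dots> = (\<integral>\<^sup>+g. emeasure m (X g) \<partial>count_space rotations)"
      using mX by (intro emeasure_UN_countable rotations_countable disX) simp
    also have "\<dots> = (\<integral>\<^sup>+g. emeasure m (Y g) \<partial>count_space rotations)"
      by (rule nn_integral_cong) (simp add: XY)
    also have "\<dots> = emeasure m (\<Union>g\<in>rotations. Y g)"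
      using mY by (intro emeasure_UN_countable[symmetric] rotations_countable disY) simp
    also have "\<dots> = emeasure M E" unfolding UY using E by (subst emeasure_M) (auto simp: sets_M)
    finally show "emeasure (distr M M (T t)) E = emeasure M E" .
  qed simp
  with T_measurable show ?thesis by (simp add: measure_preserving_map_def)
qed

lemma T_flow: "measure_preserving_flow M T"
  unfolding measure_preserving_flow_def
  using T_joint T_0 T_add T_preserving by simp

end

text \<open>
  Choosing, at every \<open>n\<close>, a value within \<open>1 / Suc n\<close> of the infimum replaces a diagonal argument.
\<close>

lemma choose_tendsto_0:
  fixes v :: "nat \<Rightarrow> 'b \<Rightarrow> ennreal"
  assumes ev: "\<And>e. 0 < e \<Longrightarrow> \<forall>\<^sub>F n in sequentially. \<exists>H. P n H \<and> v n H \<le> ennreal e"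
    and ex: "\<And>n. \<exists>H. P n H"
  shows "\<exists>H. (\<forall>n. P n (H n)) \<and> (\<lambda>n. v n (H n)) \<longlonglongrightarrow> 0"
proof -
  define d where "d n = (INF H\<in>{H. P n H}. v n H)" for n
  have "\<exists>H. P n H \<and> v n H \<le> d n + ennreal (1 / Suc n)" for n
  proof (cases "d n = \<top>")
    case True
    then show ?thesis using ex[of n] by auto
  next
    case False
    then have "d n < d n + ennreal (1 / Suc n)"
      by (cases "d n") (auto simp: ennreal_less_iff simp flip: ennreal_plus)
    then show ?thesis unfolding d_def INF_less_iff by (auto intro: less_imp_le)
  qed
  then obtain H where H: "\<And>n. P n (H n)" "\<And>n. v n (H n) \<le> d n + ennreal (1 / Suc n)" by metis
  have d0: "d \<longlonglongrightarrow> 0"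
  proof (rule order_tendstoI)
    fix a :: ennreal assume "0 < a"
    obtain e where e: "0 < e" "ennreal e < a"
    proof (cases a)
      case (real r)
      with \<open>0 < a\<close> show ?thesis by (intro that[of "r / 2"]) (auto simp: ennreal_less_iff)
    next
      case top
      then show ?thesis by (intro that[of 1]) auto
    qed
    from ev[OF e(1)] show "\<forall>\<^sub>F n in sequentially. d n < a"
    proof eventually_elim
      case (elim n)
      then obtain H where "P n H" "v n H \<le> ennreal e" by blast
      then have "d n \<le> ennreal e" unfolding d_def by (intro INF_lower2[of H]) auto
      with e(2) show ?case by order
    qed
  qed simp
  have "(\<lambda>n. ennreal (1 / Suc n)) \<longlonglongrightarrow> ennreal 0"
    by (rule tendsto_ennrealI) (use LIMSEQ_inverse_real_of_nat in \<open>simp add: inverse_eq_divide\<close>)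
  then have "(\<lambda>n. d n + ennreal (1 / Suc n)) \<longlonglongrightarrow> 0 + 0"
    by (intro tendsto_add d0) simp
  then have lim: "(\<lambda>n. d n + ennreal (1 / Suc n)) \<longlonglongrightarrow> 0" by simp
  have "(\<lambda>n. v n (H n)) \<longlonglongrightarrow> 0"
    by (rule tendsto_sandwich[OF _ always_eventually tendsto_const lim]) (simp_all only: H(2) zero_le eventually_True simp_thms)
  with H(1) show ?thesis by blast
qed

context cut_and_stack
begin

subsection \<open>The measure is infinite\<close>

lemma h_ge_product: "h 0 * 2 ^ n * (\<Prod>k<n. real (card (C k))) \<le> h n"
proof (induction n)
  case (Suc n)
  have "h 0 * 2 ^ Suc n * (\<Prod>k<Suc n. real (card (C k))) = 2 * (h 0 * 2 ^ n * (\<Prod>k<n. real (card (C k)))) * card (C n)"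
    by (simp add: ac_simps)
  also have "\<dots> \<le> 2 * h n * card (C n)" using Suc by (intro mult_right_mono mult_left_mono) auto
  also have "\<dots> \<le> h (Suc n)" by (rule h_grow)
  finally show ?case .
qed simp

lemma covered_mono:
  assumes "k < n" "covered k s" shows "covered n s"
proof -
  obtain c where "c \<in> C k" "s - c \<in> F k" using assms(2) unfolding covered_def by blast
  from F_shift[OF this(2,1)] F_mono[of "Suc k" n] assms(1) have "s - 0 \<in> F n" by auto
  with C_zero show ?thesis unfolding covered_def by blast
qed

text \<open>
  The copies of \<open>F n\<close> have total length \<open>2 * h n * card (C n)\<close>, which is at most half of the length of
  \<open>F (Suc n)\<close>.
\<close>

lemma emeasure_uncovered: "ennreal (h (Suc n)) \<le> emeasure lborel {s \<in> F (Suc n). \<not> covered n s}"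
proof -
  have cov: "{s. covered n s} = (\<Union>c\<in>C n. {c - h n..<c + h n})"
  proof -
    have "s - c \<in> F n \<longleftrightarrow> s \<in> {c - h n..<c + h n}" for s c by (auto simp: F_def)
    then show ?thesis unfolding covered_def by blast
  qed
  have "emeasure lborel {s. covered n s} \<le> (\<Sum>c\<in>C n. emeasure lborel {c - h n..<c + h n})"
    unfolding cov using C_finite by (intro emeasure_subadditive_finite) auto
  also have "\<dots> = ennreal (2 * h n * card (C n))"
    using h_gt_0[of n] by (simp add: ennreal_of_nat_eq_real_of_nat ennreal_mult[symmetric] mult.commute)
  also have "\<dots> \<le> ennreal (h (Suc n))" using h_grow by (intro ennreal_leI)
  finally have c: "emeasure lborel {s. covered n s} \<le> ennreal (h (Suc n))" .
  have cb: "{s. covered n s} \<in> sets borel" unfolding cov using C_finite by (intro sets.finite_UN) auto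
  have ub: "{s \<in> F (Suc n). \<not> covered n s} \<in> sets borel"
  proof -
    have "{s \<in> F (Suc n). \<not> covered n s} = F (Suc n) - {s. covered n s}" by auto
    with cb show ?thesis by simp
  qed
  have "ennreal (h (Suc n)) + ennreal (h (Suc n)) = emeasure lborel (F (Suc n))"
    using h_gt_0[of "Suc n"] by (simp add: F_def flip: ennreal_plus)
  also have "\<dots> \<le> emeasure lborel ({s \<in> F (Suc n). \<not> covered n s} \<union> {s. covered n s})"
    using cb ub by (intro emeasure_mono) auto
  also have "\<dots> \<le> emeasure lborel {s \<in> F (Suc n). \<not> covered n s} + emeasure lborel {s. covered n s}"
    using cb ub by (intro emeasure_subadditive) auto
  also have "\<dots> \<le> emeasure lborel {s \<in> F (Suc n). \<not> covered n s} + ennreal (h (Suc n))"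
    using c by (intro add_left_mono)
  also have "\<dots> = ennreal (h (Suc n)) + emeasure lborel {s \<in> F (Suc n). \<not> covered n s}"
    by (rule add.commute)
  finally show ?thesis unfolding ennreal_add_left_cancel_le by simp
qed

lemma uncovered_subset_D: "Z \<inter> {z. z 0 \<in> {s \<in> F (Suc n). \<not> covered n s} \<and> (\<forall>k\<le>n. z (Suc k) = 0)} \<subseteq> D"
proof
  fix z assume z: "z \<in> Z \<inter> {z. z 0 \<in> {s \<in> F (Suc n). \<not> covered n s} \<and> (\<forall>k\<le>n. z (Suc k) = 0)}"
  have "z 0 \<in> F j \<or> z (Suc j) = 0 \<and> \<not> covered j (z 0)" for j
  proof (cases "j \<le> n")
    case True
    then have "\<not> covered j (z 0)" using z covered_mono[of j n "z 0"] by (cases "j = n") auto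
    with z True show ?thesis by auto
  next
    case False
    then show ?thesis using z F_mono[of "Suc n" j] by auto
  qed
  with z show "z \<in> D" by (auto simp: D_def)
qed

lemma emeasure_zero_digits: "emeasure \<Omega> {c. \<forall>k\<in>{..n}. c k \<in> {0}} = ennreal (1 / (\<Prod>k\<le>n. real (card (C k))))"
proof -
  interpret product_prob_space U UNIV by (rule product_U)
  have "emeasure \<Omega> {c. \<forall>k\<in>{..n}. c k \<in> {0}} = (\<Prod>k\<le>n. emeasure (U k) {0})"
    using emeasure_PiM_Collect[of "{..n}" "\<lambda>_. {0}"] by (simp add: \<Omega>_def space_PiM)
  also have "\<dots> = (\<Prod>k\<le>n. ennreal (1 / card (C k)))"
    using C_zero by (intro prod.cong) (auto simp: emeasure_U)
  also have "\<dots> = ennreal (\<Prod>k\<le>n. 1 / card (C k))"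
    by (rule prod_ennreal) simp
  finally show ?thesis by (simp add: prod_dividef)
qed

text \<open>
  The points that first appear in tower \<open>Suc n\<close> form a set in \<open>D\<close> of measure at least \<open>h (Suc n)\<close> divided by the number
  of possible choices of the first digits, and this tends to infinity by \<open>h_ge_product\<close>.
\<close>

lemma M_infinite: "emeasure M (space M) = \<infinity>"
proof -
  have "ennreal (h 0 * 2 ^ Suc n) \<le> emeasure m D" for n
  proof -
    let ?B = "{c::point. \<forall>k\<in>{..n}. c k \<in> {0}}" and ?E = "{s \<in> F (Suc n). \<not> covered n s}"
    let ?R = "{z. z 0 \<in> ?E \<and> (\<lambda>n. z (Suc n)) \<in> ?B}"
    have P: "0 < (\<Prod>k\<le>n. real (card (C k)))" using card_C_pos by (intro prod_pos) simp
    have "h 0 * 2 ^ Suc n * (\<Prod>k\<le>n. real (card (C k))) \<le> h (Suc n)"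
      using h_ge_product[of "Suc n"] by (simp add: lessThan_Suc_atMost)
    then have "h 0 * 2 ^ Suc n \<le> h (Suc n) * (1 / (\<Prod>k\<le>n. real (card (C k))))"
      using P by (simp add: field_simps)
    then have "ennreal (h 0 * 2 ^ Suc n) \<le> ennreal (h (Suc n)) * ennreal (1 / (\<Prod>k\<le>n. real (card (C k))))"
      using P h_gt_0[of "Suc n"] by (simp add: ennreal_mult[symmetric] ennreal_leI less_imp_le)
    also have "\<dots> \<le> emeasure lborel ?E * emeasure \<Omega> ?B"
      unfolding emeasure_zero_digits by (intro mult_right_mono emeasure_uncovered) simp
    also have "\<dots> = emeasure m ?R"
    proof (rule emeasure_m_rect[symmetric])
      have "{s \<in> space borel. covered n s} \<in> sets borel" using covered_pred by (rule predE)
      moreover have "?E = F (Suc n) - {s \<in> space borel. covered n s}" by auto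
      ultimately show "?E \<in> sets borel" by simp
      have "?B = (\<Inter>k\<in>{..n}. (\<lambda>c. c k) -` {0} \<inter> space borel)" by auto
      also have "(\<lambda>c::point. c k) -` {0} \<inter> space borel \<in> sets borel" for k
        by (rule measurable_sets[OF coordinate]) simp
      then have "(\<Inter>k\<in>{..n}. (\<lambda>c::point. c k) -` {0} \<inter> space borel) \<in> sets borel"
        by (intro sets.finite_INT) auto
      finally show "?B \<in> sets borel" .
    qed
    also have "\<dots> \<le> emeasure m D"
    proof (rule emeasure_mono_AE)
      show "AE z in m. z \<in> ?R \<longrightarrow> z \<in> D"
        using AE_Z by eventually_elim (use uncovered_subset_D[of n] in auto)
    qed simp
    finally show ?thesis .
  qed
  then have le: "ennreal (h 0 * 2 ^ Suc n) \<le> emeasure m D" for n .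
  have "emeasure m D = \<infinity>"
  proof (rule ccontr)
    assume "emeasure m D \<noteq> \<infinity>"
    then obtain r where r: "emeasure m D = ennreal r" "0 \<le> r" by (cases "emeasure m D") auto
    obtain n where "r / h 0 < 2 ^ n" using real_arch_pow[of 2 "r / h 0"] by auto
    then have "r < h 0 * 2 ^ Suc n" using h_pos r(2) by (simp add: field_simps)
    with le[of n] r h_pos show False by (simp add: ennreal_le_iff)
  qed
  then show ?thesis using emeasure_M[of D] by (simp add: sets_M)
qed

subsection \<open>The space is standard\<close>

lemma sigma_finite_M: "sigma_finite_measure M"
proof
  let ?W = "\<lambda>R::nat. D \<inter> window (real R)"
  have s: "?W R \<in> sets M" for R by (simp add: sets_M)
  have "emeasure M (?W R) \<noteq> \<infinity>" for R
  proof -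
    have "emeasure M (?W R) \<le> emeasure m (window R)"
      using s by (simp add: emeasure_M emeasure_mono)
    then have "emeasure M (?W R) < \<infinity>" using emeasure_window[of R] by (rule le_less_trans)
    then show ?thesis by simp
  qed
  then show "\<exists>A. countable A \<and> A \<subseteq> sets M \<and> \<Union>A = space M \<and> (\<forall>a\<in>A. emeasure M a \<noteq> \<infinity>)"
    using s UN_window by (intro exI[of _ "range ?W"]) auto
qed

text \<open>
  Half-open intervals are intersections of an open and a closed set, and \<open>D\<close> is a countable intersection of
  finite Boolean combinations of such conditions on coordinates.
\<close>

lemma D_gdelta: "gdelta_in euclidean D"
proof -
  have met: "metrizable_space (euclidean :: point topology)"
    by (rule completely_metrizable_imp_metrizable_space[OF completely_metrizable_space_euclidean])
  have cl: "gdelta_in euclidean S" if "closed S" for S :: "point set"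
    by (rule closed_imp_gdelta_in[OF met]) (use that in simp)
  have op: "gdelta_in euclidean S" if "open S" for S :: "point set"
    by (rule open_imp_gdelta_in) (use that in simp)
  have cont: "continuous_on UNIV (\<lambda>z::point. z k)" for k
    by (rule continuous_on_product_coordinates)
  have clC: "closed {z::point. z k \<in> S}" if "closed S" for k S
    using closed_vimage[OF that cont[of k]] by (simp add: vimage_def)
  have opC: "open {z::point. z k \<in> S}" if "open S" for k S
    using open_vimage[OF that cont[of k]] by (simp add: vimage_def)
  have inF: "gdelta_in euclidean {z::point. z 0 \<in> F n}" for n
  proof -
    have "{z::point. z 0 \<in> F n} = {z. z 0 \<in> {-h n..}} \<inter> {z. z 0 \<in> {..<h n}}" by (auto simp: F_def)
    then show ?thesis using cl[OF clC[OF closed_atLeast, of 0 "-h n"]] op[OF opC[OF open_lessThan, of 0 "h n"]]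
      by (simp add: gdelta_in_Int)
  qed
  have nc: "gdelta_in euclidean {z::point. \<not> covered n (z 0)}" for n
  proof -
    have "{z::point. \<not> covered n (z 0)} = (\<Inter>c\<in>C n. {z. z 0 \<in> {..<c - h n}} \<union> {z. z 0 \<in> {c + h n..}})"
    proof -
      have "s - c \<notin> F n \<longleftrightarrow> s \<in> {..<c - h n} \<or> s \<in> {c + h n..}" for s c by (auto simp: F_def)
      then show ?thesis unfolding covered_def by blast
    qed
    moreover have "gdelta_in euclidean ({z::point. z 0 \<in> {..<c - h n}} \<union> {z. z 0 \<in> {c + h n..}})" for c
      by (intro gdelta_in_Un cl op clC opC) simp_all
    ultimately show ?thesis using C_finite C_ne
      by (simp only:, intro gdelta_in_Inter) (auto intro: countable_finite)
  qed
  have cond: "gdelta_in euclidean ({z::point. z 0 \<in> F n} \<union> ({z. z (Suc n) \<in> {0}} \<inter> {z. \<not> covered n (z 0)}))" for n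
    by (intro gdelta_in_Un gdelta_in_Int inF nc cl clC) simp
  have Zc: "gdelta_in euclidean {z::point. z (Suc n) \<in> C n}" for n
    using C_finite by (intro cl clC finite_imp_closed)
  have "D = (\<Inter>n. {z. z (Suc n) \<in> C n} \<inter> ({z::point. z 0 \<in> F n} \<union> ({z. z (Suc n) \<in> {0}} \<inter> {z. \<not> covered n (z 0)})))"
    by (auto simp: D_def Z_def)
  also have "gdelta_in euclidean \<dots>"
  proof (rule gdelta_in_Inter)
    fix S assume "S \<in> range (\<lambda>n. {z. z (Suc n) \<in> C n} \<inter> ({z::point. z 0 \<in> F n} \<union> ({z. z (Suc n) \<in> {0}} \<inter> {z. \<not> covered n (z 0)})))"
    then show "gdelta_in euclidean S" using gdelta_in_Int[OF Zc cond] by (elim rangeE) simp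
  qed auto
  finally show ?thesis .
qed

lemma M_standard: "standard_sigma_finite_measure M"
  unfolding standard_sigma_finite_measure_def
proof (intro conjI exI[of _ "top_of_set D"])
  show "completely_metrizable_space (top_of_set D)"
    by (rule completely_metrizable_space_gdelta_in[OF completely_metrizable_space_euclidean D_gdelta])
  have "second_countable (euclidean :: point topology)"
  proof -
    obtain B :: "point set set" where B: "countable B" "topological_basis B" using ex_countable_basis by blast
    show ?thesis unfolding second_countable_def
      using B topological_basis_open[OF B(2)] topological_basisE[OF B(2)]
      by (intro exI[of _ B]) (simp, metis)
  qed
  then show "separable_space (top_of_set D)"
    by (intro second_countable_imp_separable_space second_countable_subtopology)
  show "topspace (top_of_set D) = space M" by simp
  show "sets M = sigma_sets (topspace (top_of_set D)) {U. openin (top_of_set D) U}"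
  proof -
    have "sets M = (\<inter>) D ` sigma_sets UNIV {S. open S}"
      by (simp add: M_def sets_restrict_space sets_borel)
    also have "\<dots> = sigma_sets D ((\<inter>) D ` {S. open S})"
      by (rule sigma_sets_Int) (use D_borel in \<open>auto simp: sets_borel\<close>)
    also have "(\<inter>) D ` {S. open S} = {U. openin (top_of_set D) U}"
      by (auto simp: openin_open)
    finally show ?thesis by simp
  qed
qed (rule sigma_finite_M)

subsection \<open>Rank one\<close>

text \<open>
  The part of the space that is filled by the \<open>n\<close>-th tower; \<open>height n\<close> is its tower map.
\<close>

definition A :: "nat \<Rightarrow> point set" where "A n = {z \<in> D. z 0 \<in> F n}"

lemma A_borel[measurable]: "A n \<in> sets (borel :: point measure)"
proof -
  have "A n = D \<inter> ((\<lambda>z. z 0) -` F n \<inter> space borel)" by (auto simp: A_def)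
  then show ?thesis using measurable_sets[OF coordinate F_borel, of 0 n] by simp
qed

lemma A_mono: "n \<le> k \<Longrightarrow> A n \<subseteq> A k"
  using F_mono[of n k] by (auto simp: A_def)

lemma A_finite: "emeasure m (A n) < \<infinity>"
proof -
  have "emeasure m (A n) \<le> emeasure m (window (h n))"
    by (intro emeasure_mono) (auto simp: A_def F_def window_def)
  with emeasure_window[of "h n"] show ?thesis by simp
qed

lemma UN_A: "(\<Union>n. A n) = D"
proof -
  have "\<exists>n. z 0 \<in> F n" if "z \<in> D" for z
    using ex_in_tower[of z] that D_subset_Z D_height_in_F[OF that] by auto
  then show ?thesis by (auto simp: A_def)
qed

lemma T_tower:
  assumes z: "z \<in> A n" and t: "height n z + t \<in> F n"
  shows "T t z \<in> A n" "height n (T t z) = height n z + t"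
proof -
  have Z: "shift t z \<in> Z" using z D_subset_Z by (auto simp: A_def)
  have f: "height n (shift t z) \<in> F n" using t by (simp add: height_shift)
  show "T t z \<in> A n" "height n (T t z) = height n z + t"
    using rep_tower(1,2)[OF Z f] rep_in_D by (auto simp: A_def T_def height_shift)
qed

lemma height_in_F: "z \<in> A n \<Longrightarrow> height n z \<in> F n"
  using D_height_in_F by (auto simp: A_def)

text \<open>
  As long as the height stays in \<open>F n\<close>, the flow just adds to it (\<open>T_tower\<close>).
\<close>

lemma tower_is_rokhlin: "rokhlin_tower M T (A n) (height n) (F n)"
  unfolding rokhlin_tower_def
proof (intro conjI ballI allI impI)
  show "A n \<in> sets M" using A_borel by (auto simp: sets_M A_def)
  show "is_interval (F n)" "bounded (F n)"
    by (auto simp: F_def is_interval_co intro: bounded_subset[OF compact_imp_bounded[OF compact_Icc[of "-h n" "h n"]]])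
  have "height n \<in> measurable (restrict_space M (A n)) borel"
    by (intro measurable_restrict_space1 measurable_compose[OF id_M_borel height_measurable])
  moreover have "height n x \<in> F n" if "x \<in> space (restrict_space M (A n))" for x
    using that by (intro height_in_F) (simp add: space_restrict_space)
  ultimately show "height n \<in> measurable (restrict_space M (A n)) (restrict_space borel (F n))"
    by (intro measurable_restrict_space2 funcsetI)
next
  fix H t assume H: "H \<in> sets borel" "H \<subseteq> F n" "(+) t ` H \<subseteq> F n"
  show "height n -` ((+) t ` H) \<inter> A n = T t ` (height n -` H \<inter> A n)"
  proof (intro equalityI subsetI)
    fix w assume "w \<in> height n -` ((+) t ` H) \<inter> A n"
    then obtain s where s: "s \<in> H" "height n w = t + s" and w: "w \<in> A n" by auto
    then have "height n w + - t \<in> F n" using H(2) by auto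
    from T_tower[OF w this] s have "T (-t) w \<in> height n -` H \<inter> A n" by simp
    moreover have "T t (T (-t) w) = w" using T_minus[of w "-t"] w by (simp add: A_def)
    ultimately show "w \<in> T t ` (height n -` H \<inter> A n)" by (metis imageI)
  next
    fix w assume "w \<in> T t ` (height n -` H \<inter> A n)"
    then obtain z where z: "height n z \<in> H" "z \<in> A n" "w = T t z" by auto
    then have "height n z + t \<in> F n" using H(3) by (auto simp: image_subset_iff add.commute)
    from T_tower[OF z(2) this] z show "w \<in> height n -` ((+) t ` H) \<inter> A n"
      by (auto simp: add.commute)
  qed
qed

definition tower_close :: "nat \<Rightarrow> real \<Rightarrow> point set \<Rightarrow> bool" where
  "tower_close n e X \<longleftrightarrow>
     (\<exists>H\<in>sets borel. H \<subseteq> F n \<and> measure m (sym_diff X (height n -` H \<inter> A n)) \<le> e)"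

text \<open>
  Cutting down to a fixed \<open>A N\<close> keeps all measures finite. Asking for all large \<open>n\<close>, and not only for one,
  allows finitely many approximations to take place in the same tower.
\<close>

definition approximable :: "point set \<Rightarrow> bool" where
  "approximable E \<longleftrightarrow> (\<forall>N. \<forall>e>0. \<exists>n0. \<forall>n\<ge>n0. tower_close n e (E \<inter> A N))"

lemma tower_set_borel: "H \<in> sets borel \<Longrightarrow> height n -` H \<inter> A n \<in> sets borel"
  using measurable_sets[OF height_measurable, of H n] by (simp add: A_borel sets.Int)

lemma finite_in_A:
  assumes "S \<subseteq> A n" shows "emeasure m S \<noteq> \<infinity>"
  using emeasure_mono[OF assms, of m] A_finite[of n] by (auto simp: top_unique)

lemma fmeasurable_A: "S \<in> sets borel \<Longrightarrow> S \<subseteq> A n \<Longrightarrow> S \<in> fmeasurable m"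
  using finite_in_A[of S n] by (simp add: fmeasurable_def less_top)

lemma sym_diff_borel: "X \<in> sets N \<Longrightarrow> Y \<in> sets N \<Longrightarrow> sym_diff X Y \<in> sets N"
  by (intro sets.Un sets.Diff)

text \<open>
  The first coordinates of a point of \<open>A n\<close> are functions of its height in the \<open>n\<close>-th tower, namely those given by
  \<open>expand n\<close>; so cylinder sets are exactly of the required form for large \<open>n\<close>.
\<close>

lemma approximable_cylinder:
  assumes J: "finite J" and E: "\<And>k. k \<in> J \<Longrightarrow> E k \<in> sets borel"
  shows "approximable {z \<in> D. \<forall>k\<in>J. z k \<in> E k}"
  unfolding approximable_def
proof (intro allI impI)
  fix N and e :: real assume "0 < e"
  obtain K where K0: "\<And>k. k \<in> J \<Longrightarrow> k \<le> K" using J by (meson finite_nat_set_iff_bounded_le)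
  show "\<exists>n0. \<forall>n\<ge>n0. tower_close n e ({z \<in> D. \<forall>k\<in>J. z k \<in> E k} \<inter> A N)"
  proof (intro exI allI impI)
    fix n assume n: "max K N \<le> n"
    define H where "H = F n \<inter> (\<lambda>s. expand n s 0) -` F N \<inter> (\<Inter>k\<in>J. (\<lambda>s. expand n s k) -` E k)"
    have "(\<lambda>s. expand n s k) -` B \<in> sets borel" if "B \<in> sets borel" for k B
      using measurable_sets[OF expand_measurable that, of n k] by simp
    moreover have "H = F n \<inter> (\<lambda>s. expand n s 0) -` F N \<inter> (\<Inter>k\<in>insert 0 J. if k \<in> J then (\<lambda>s. expand n s k) -` E k else UNIV)"
      unfolding H_def by auto
    ultimately have Hb: "H \<in> sets borel" using J E
      by (simp only:) (intro sets.Int sets.finite_INT F_borel, auto)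
    have eq: "{z \<in> D. \<forall>k\<in>J. z k \<in> E k} \<inter> A N = height n -` H \<inter> A n"
    proof -
      have "z \<in> {z \<in> D. \<forall>k\<in>J. z k \<in> E k} \<inter> A N \<longleftrightarrow> z \<in> height n -` H \<inter> A n" if z: "z \<in> A n" for z
      proof -
        have "expand n (height n z) k = z k" if "k \<le> n" for k
          using D_expand[of z n k] z that by (auto simp: A_def)
        moreover have "height n z \<in> F n" by (rule height_in_F[OF z])
        moreover have "k \<le> n" if "k \<in> J" for k using K0[OF that] n by simp
        ultimately show ?thesis using z by (auto simp: H_def A_def)
      qed
      moreover have "A N \<subseteq> A n" by (rule A_mono) (use n in simp)
      ultimately show ?thesis by blast
    qed
    have "measure m (sym_diff ({z \<in> D. \<forall>k\<in>J. z k \<in> E k} \<inter> A N) (height n -` H \<inter> A n)) \<le> e"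
      unfolding eq using \<open>0 < e\<close> by simp
    moreover have "H \<subseteq> F n" unfolding H_def by blast
    ultimately show "tower_close n e ({z \<in> D. \<forall>k\<in>J. z k \<in> E k} \<inter> A N)"
      using Hb unfolding tower_close_def by blast
  qed
qed

lemma approximable_compl:
  assumes E: "E \<in> sets borel" "E \<subseteq> D" and app: "approximable E" shows "approximable (D - E)"
  unfolding approximable_def
proof (intro allI impI)
  fix N and e :: real assume e: "0 < e"
  have whole: "approximable D" using approximable_cylinder[of "{0}" "\<lambda>_. UNIV"] by simp
  from app e obtain n1 where n1: "\<And>n. n \<ge> n1 \<Longrightarrow> tower_close n (e / 2) (E \<inter> A N)"
    unfolding approximable_def by (meson half_gt_zero)
  from whole e obtain n2 where n2: "\<And>n. n \<ge> n2 \<Longrightarrow> tower_close n (e / 2) (D \<inter> A N)"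
    unfolding approximable_def by (meson half_gt_zero)
  show "\<exists>n0. \<forall>n\<ge>n0. tower_close n e ((D - E) \<inter> A N)"
  proof (intro exI allI impI)
    fix n assume n: "max N (max n1 n2) \<le> n"
    then obtain H1 H2 where H1: "H1 \<in> sets borel" "H1 \<subseteq> F n" "measure m (sym_diff (E \<inter> A N) (height n -` H1 \<inter> A n)) \<le> e / 2"
      and H2: "H2 \<in> sets borel" "H2 \<subseteq> F n" "measure m (sym_diff (D \<inter> A N) (height n -` H2 \<inter> A n)) \<le> e / 2"
      using n1[of n] n2[of n] by (auto simp: tower_close_def)
    let ?S1 = "sym_diff (E \<inter> A N) (height n -` H1 \<inter> A n)" and ?S2 = "sym_diff (D \<inter> A N) (height n -` H2 \<inter> A n)"
    have b: "?S1 \<in> sets borel" "?S2 \<in> sets borel"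
      by (intro sym_diff_borel sets.Int E H1(1) H2(1) tower_set_borel A_borel D_borel)+
    have sub: "?S1 \<subseteq> A n" "?S2 \<subseteq> A n" using A_mono[of N n] n by auto
    have H: "H2 - H1 \<in> sets borel" using H1 H2 by simp
    have "measure m (sym_diff ((D - E) \<inter> A N) (height n -` (H2 - H1) \<inter> A n)) \<le> measure m (?S1 \<union> ?S2)"
    proof (rule measure_mono_fmeasurable)
      show "sym_diff ((D - E) \<inter> A N) (height n -` (H2 - H1) \<inter> A n) \<in> sets m"
        unfolding sets_m by (intro sym_diff_borel sets.Int sets.Diff E H tower_set_borel A_borel D_borel)
      show "?S1 \<union> ?S2 \<in> fmeasurable m" using b sub by (intro fmeasurable_A[of _ n]) auto
    qed blast
    also have "\<dots> \<le> measure m ?S1 + measure m ?S2"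
      using b by (intro measure_Un_le) simp_all
    also have "\<dots> \<le> e" using H1(3) H2(3) by simp
    finally show "tower_close n e ((D - E) \<inter> A N)"
      using H H2(2) unfolding tower_close_def by (intro bexI[of _ "H2 - H1"] conjI) blast+
  qed
qed

text \<open>
  All but finitely many of the sets carry little measure, and the finitely many others are approximated
  simultaneously, with the error \<open>e / 2\<close> divided among them.
\<close>

lemma approximable_union:
  assumes E: "\<And>i. E i \<in> sets borel" "\<And>i. E i \<subseteq> D" and app: "\<And>i. approximable (E i)" and dis: "disjoint_family E"
  shows "approximable (\<Union>i::nat. E i)"
  unfolding approximable_def
proof (intro allI impI)
  fix N and e :: real assume e: "0 < e"
  note fmA = fmeasurable_A
  have UE: "(\<Union>i. E i) \<in> sets borel" using E(1) by auto
  have "(\<lambda>i. measure m (E i \<inter> A N)) sums measure m (\<Union>i. E i \<inter> A N)"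
  proof (rule measure_UNION)
    show "emeasure m (\<Union>i. E i \<inter> A N) \<noteq> \<infinity>" by (rule finite_in_A[of _ N]) auto
    show "disjoint_family (\<lambda>i. E i \<inter> A N)" using dis by (fastforce simp: disjoint_family_on_def)
    show "range (\<lambda>i. E i \<inter> A N) \<subseteq> sets m" using E(1) by auto
  qed
  then have lim: "(\<lambda>K. \<Sum>i<K. measure m (E i \<inter> A N)) \<longlonglongrightarrow> measure m (\<Union>i. E i \<inter> A N)" by (simp add: sums_def)
  have "\<forall>\<^sub>F K in sequentially. measure m (\<Union>i. E i \<inter> A N) - e / 2 < (\<Sum>i<K. measure m (E i \<inter> A N))"
    using order_tendstoD(1)[OF lim] e by simp
  then obtain K where K: "measure m (\<Union>i. E i \<inter> A N) - e / 2 < (\<Sum>i<K. measure m (E i \<inter> A N))"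
    by (auto simp: eventually_sequentially)
  let ?R = "((\<Union>i. E i) - (\<Union>i<K. E i)) \<inter> A N"
  have "measure m ?R \<le> e / 2"
  proof -
    have 1: "measure m (\<Union>i<K. E i \<inter> A N) = (\<Sum>i<K. measure m (E i \<inter> A N))"
    proof (rule measure_finite_Union)
      show "emeasure m (E i \<inter> A N) \<noteq> \<infinity>" for i by (rule finite_in_A[of _ N]) simp
      show "disjoint_family_on (\<lambda>i. E i \<inter> A N) {..<K}" using dis by (fastforce simp: disjoint_family_on_def)
      show "(\<lambda>i. E i \<inter> A N) ` {..<K} \<subseteq> sets m" using E(1) by auto
    qed simp
    have "?R = (\<Union>i. E i \<inter> A N) - (\<Union>i<K. E i \<inter> A N)" by auto
    also have "measure m \<dots> = measure m (\<Union>i. E i \<inter> A N) - measure m (\<Union>i<K. E i \<inter> A N)"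
      using E(1) by (intro measurable_measure_Diff fmA[of _ N]) auto
    finally show ?thesis using K 1 by simp
  qed
  have "\<exists>n0. \<forall>n\<ge>n0. tower_close n (e / (2 * Suc K)) (E i \<inter> A N)" for i
  proof -
    have "0 < e / (2 * Suc K)" using e by simp
    with app[of i] show ?thesis unfolding approximable_def by blast
  qed
  then obtain n0 where n0: "\<And>i n. n \<ge> n0 i \<Longrightarrow> tower_close n (e / (2 * Suc K)) (E i \<inter> A N)"
    by metis
  show "\<exists>n0. \<forall>n\<ge>n0. tower_close n e ((\<Union>i. E i) \<inter> A N)"
  proof (intro exI allI impI)
    fix n assume n: "max N (\<Sum>i<K. n0 i) \<le> n"
    have "n0 i \<le> n" if "i < K" for i
      using member_le_sum[of i "{..<K}" n0] that n by auto
    then have "\<exists>H. H \<in> sets borel \<and> H \<subseteq> F n \<and> measure m (sym_diff (E i \<inter> A N) (height n -` H \<inter> A n)) \<le> e / (2 * Suc K)" if "i < K" for i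
      using n0[of i n] that unfolding tower_close_def by blast
    then obtain H where H: "\<And>i. i < K \<Longrightarrow> H i \<in> sets borel" "\<And>i. i < K \<Longrightarrow> H i \<subseteq> F n"
      "\<And>i. i < K \<Longrightarrow> measure m (sym_diff (E i \<inter> A N) (height n -` H i \<inter> A n)) \<le> e / (2 * Suc K)" by metis
    let ?H = "\<Union>i<K. H i"
    let ?S = "\<lambda>i. sym_diff (E i \<inter> A N) (height n -` H i \<inter> A n)"
    have Hb: "?H \<in> sets borel" using H(1) by auto
    have An: "A N \<subseteq> A n" using A_mono n by simp
    have Sb: "?S i \<in> fmeasurable m" if "i < K" for i
    proof (rule fmA[of _ n])
      show "?S i \<in> sets borel" by (intro sym_diff_borel sets.Int E(1) H(1)[OF that] tower_set_borel A_borel)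
      show "?S i \<subseteq> A n" using An by blast
    qed
    have Rb: "?R \<in> fmeasurable m" using E(1) by (intro fmA[of _ N]) auto
    have "measure m (sym_diff ((\<Union>i. E i) \<inter> A N) (height n -` ?H \<inter> A n)) \<le> measure m (?R \<union> (\<Union>i<K. ?S i))"
    proof (rule measure_mono_fmeasurable)
      show "sym_diff ((\<Union>i. E i) \<inter> A N) (height n -` ?H \<inter> A n) \<in> sets m"
        unfolding sets_m by (intro sym_diff_borel sets.Int UE Hb tower_set_borel A_borel)
      have "(\<Union>i<K. ?S i) \<in> fmeasurable m" by (rule fmeasurable.finite_UN) (simp_all only: Sb lessThan_iff finite_lessThan)
      with Rb show "?R \<union> (\<Union>i<K. ?S i) \<in> fmeasurable m" by (rule fmeasurable.Un)
    qed blast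
    also have "\<dots> \<le> measure m ?R + measure m (\<Union>i<K. ?S i)"
    proof (rule measure_Un_le)
      show "?R \<in> sets m" using Rb by (rule fmeasurableD)
      show "(\<Union>i<K. ?S i) \<in> sets m"
        by (rule sets.finite_UN) (simp_all only: Sb[THEN fmeasurableD] lessThan_iff finite_lessThan)
    qed
    also have "measure m (\<Union>i<K. ?S i) \<le> (\<Sum>i<K. measure m (?S i))"
      by (rule measure_UNION_le) (simp_all only: Sb[THEN fmeasurableD] lessThan_iff finite_lessThan)
    also have "\<dots> \<le> (\<Sum>i<K. e / (2 * Suc K))" by (intro sum_mono H(3)) simp
    also have "\<dots> \<le> e / 2" using e by (simp add: field_simps)
    finally have "measure m (sym_diff ((\<Union>i. E i) \<inter> A N) (height n -` ?H \<inter> A n)) \<le> e" using \<open>measure m ?R \<le> e / 2\<close> by simp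
    then show "tower_close n e ((\<Union>i. E i) \<inter> A N)"
      using Hb H(2) unfolding tower_close_def by (intro bexI[of _ ?H]) auto
  qed
qed

lemma approximable_measurable:
  assumes "E \<in> sets M" shows "approximable E"
proof -
  let ?P = "prod_algebra UNIV (\<lambda>_::nat. borel :: real measure)"
  have P: "sets (borel :: point measure) = sigma_sets UNIV ?P"
    using sets_PiM[of UNIV "\<lambda>_::nat. borel :: real measure"] by (simp add: sets_PiM_equal_borel)
  have G: "sets M = sigma_sets D ((\<inter>) D ` ?P)"
  proof -
    have "sets M = (\<inter>) D ` sigma_sets UNIV ?P" by (simp add: M_def sets_restrict_space P)
    also have "\<dots> = sigma_sets D ((\<inter>) D ` ?P)"
      by (rule sigma_sets_Int) (use D_borel P in auto)
    finally show ?thesis .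
  qed
  have stable: "Int_stable ((\<inter>) D ` ?P)"
  proof (rule Int_stableI)
    fix a b assume "a \<in> (\<inter>) D ` ?P" "b \<in> (\<inter>) D ` ?P"
    then obtain X Y where XY: "a = D \<inter> X" "b = D \<inter> Y" "X \<in> ?P" "Y \<in> ?P" by blast
    have "X \<inter> Y \<in> ?P" using Int_stable_prod_algebra XY(3,4) unfolding Int_stable_def by blast
    moreover have "a \<inter> b = D \<inter> (X \<inter> Y)" using XY by blast
    ultimately show "a \<inter> b \<in> (\<inter>) D ` ?P" by blast
  qed
  have sub: "(\<inter>) D ` ?P \<subseteq> Pow D" by blast
  from assms have "E \<in> sigma_sets D ((\<inter>) D ` ?P)" unfolding G .
  with stable sub show ?thesis
  proof (induction rule: sigma_sets_induct_disjoint)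
    case (basic X)
    then obtain X' where X': "X' \<in> ?P" "X = D \<inter> X'" by blast
    obtain J E where J: "X' = prod_emb UNIV (\<lambda>_. borel) J (Pi\<^sub>E J E)" "finite J" "\<And>i. i \<in> J \<Longrightarrow> E i \<in> sets borel"
      using X'(1) by (rule prod_algebraE) blast
    have "X = {z \<in> D. \<forall>k\<in>J. z k \<in> E k}"
      unfolding X'(2) J(1) by (auto simp: prod_emb_def PiE_iff)
    with approximable_cylinder[OF J(2,3)] show ?case by simp
  next
    case empty
    show ?case using approximable_cylinder[of "{0}" "\<lambda>_. {}"] by simp
  next
    case (compl X)
    then have "X \<in> sets M" by (simp add: G)
    then show ?case using compl(2) by (intro approximable_compl) (auto simp: sets_M)
  next
    case (union X)
    then have "X i \<in> sets M" for i by (auto simp: G)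
    then show ?case using union by (intro approximable_union) (auto simp: sets_M)
  qed
qed

lemma h_ge_n: "real n \<le> h n"
proof (induction n)
  case 0 then show ?case using h_pos by simp
next
  case (Suc n) then show ?case using C_nest[OF C_zero, of n] by simp
qed

text \<open>
  A set of finite measure is nearly contained in some \<open>A N\<close>, and there it is approximable like every measurable set,
  by the Dynkin system argument in \<open>approximable_measurable\<close>.
\<close>

lemma T_rank_one: "rank_one_flow M T"
  unfolding rank_one_flow_def
proof (rule conjI[OF T_flow], rule exI[of _ A], rule exI[of _ height], rule exI[of _ F],
    intro conjI allI ballI impI)
  show "rokhlin_tower M T (A n) (height n) (F n)" for n by (rule tower_is_rokhlin)
  show "filterlim (\<lambda>n. measure lborel (F n)) at_top sequentially"
  proof (rule filterlim_at_top_mono[OF filterlim_real_sequentially], rule always_eventually, rule allI)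
    show "real n \<le> measure lborel (F n)" for n
      using h_ge_n[of n] h_gt_0[of n] by (simp add: F_def)
  qed
next
  fix X assume X: "X \<in> sets M" "emeasure M X < \<infinity>"
  have Xb: "X \<in> sets borel" "X \<subseteq> D" using X(1) by (auto simp: sets_M)
  have Xf: "emeasure m X \<noteq> \<infinity>" using X by (simp add: emeasure_M)
  have sM: "sym_diff X (height n -` H \<inter> A n) \<in> sets M" if "H \<in> sets borel" for n H
    using sym_diff_borel[OF Xb(1) tower_set_borel[OF that, of n]] Xb(2) by (auto simp: sets_M A_def)
  have "\<exists>H. (\<forall>n. H n \<in> sets borel \<and> H n \<subseteq> F n) \<and>
     (\<lambda>n. emeasure M (sym_diff X (height n -` H n \<inter> A n))) \<longlonglongrightarrow> 0"
  proof (rule choose_tendsto_0)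
    show "\<exists>H. H \<in> sets borel \<and> H \<subseteq> F n" for n by (rule exI[of _ "{}"]) simp
  next
    fix e :: real assume e: "0 < e"
    have "(\<lambda>N. emeasure m (X - A N)) \<longlonglongrightarrow> emeasure m (\<Inter>N. X - A N)"
    proof (rule Lim_emeasure_decseq)
      show "range (\<lambda>N. X - A N) \<subseteq> sets m" using Xb(1) by auto
      show "decseq (\<lambda>N. X - A N)" using A_mono by (force simp: decseq_def)
      show "emeasure m (X - A N) \<noteq> \<infinity>" for N
        using emeasure_mono[of "X - A N" X m] Xb(1) Xf by (auto simp: top_unique)
    qed
    also have "(\<Inter>N. X - A N) = {}" using UN_A Xb(2) by blast
    finally have "(\<lambda>N. emeasure m (X - A N)) \<longlonglongrightarrow> 0" by simp
    then have "\<forall>\<^sub>F N in sequentially. emeasure m (X - A N) < ennreal (e / 2)"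
      using e by (intro order_tendstoD) auto
    then obtain N where N: "emeasure m (X - A N) < ennreal (e / 2)" by (auto simp: eventually_sequentially)
    have "0 < e / 2" using e by simp
    with approximable_measurable[OF X(1)] obtain n0 where n0: "\<And>n. n \<ge> n0 \<Longrightarrow> tower_close n (e / 2) (X \<inter> A N)"
      unfolding approximable_def by blast
    show "\<forall>\<^sub>F n in sequentially. \<exists>H. (H \<in> sets borel \<and> H \<subseteq> F n) \<and> emeasure M (sym_diff X (height n -` H \<inter> A n)) \<le> ennreal e"
    proof (rule eventually_sequentiallyI)
      fix n assume n: "max N n0 \<le> n"
      then obtain H where H: "H \<in> sets borel" "H \<subseteq> F n" "measure m (sym_diff (X \<inter> A N) (height n -` H \<inter> A n)) \<le> e / 2"
        using n0[of n] by (auto simp: tower_close_def)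
      let ?S = "sym_diff (X \<inter> A N) (height n -` H \<inter> A n)"
      have Sb: "?S \<in> sets borel" by (intro sym_diff_borel sets.Int Xb(1) tower_set_borel H(1) A_borel)
      have Ssub: "?S \<subseteq> A n" using A_mono[of N n] n by auto
      have "emeasure m ?S = ennreal (measure m ?S)"
        using finite_in_A[OF Ssub] by (simp add: emeasure_eq_ennreal_measure)
      also have "\<dots> \<le> ennreal (e / 2)" using H(3) by (rule ennreal_leI)
      finally have S: "emeasure m ?S \<le> ennreal (e / 2)" .
      have "emeasure M (sym_diff X (height n -` H \<inter> A n)) = emeasure m (sym_diff X (height n -` H \<inter> A n))"
        by (rule emeasure_M[OF sM[OF H(1)]])
      also have "\<dots> \<le> emeasure m ((X - A N) \<union> ?S)"
        using Xb(1) Sb by (intro emeasure_mono) auto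
      also have "\<dots> \<le> emeasure m (X - A N) + emeasure m ?S"
        using Xb(1) Sb by (intro emeasure_subadditive) auto
      also have "\<dots> \<le> ennreal (e / 2) + ennreal (e / 2)" using N S by (intro add_mono) auto
      also have "\<dots> = ennreal e" using e by (simp flip: ennreal_plus)
      finally show "\<exists>H. (H \<in> sets borel \<and> H \<subseteq> F n) \<and> emeasure M (sym_diff X (height n -` H \<inter> A n)) \<le> ennreal e"
        using H(1,2) by blast
    qed
  qed
  then show "\<exists>H. (\<forall>n. H n \<in> sets borel \<and> H n \<subseteq> F n) \<and>
     (\<lambda>n. emeasure M (sym_diff X (height n -` H n \<inter> A n))) \<longlonglongrightarrow> 0" .
qed

end

section \<open>Ergodicity of rational translations and digit rotations\<close>

context cut_and_stack
begin

definition rotate_tail :: "(nat \<Rightarrow> nat) \<Rightarrow> point \<Rightarrow> point" where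
  "rotate_tail g c = (\<lambda>n. rot n (g n) (c n))"

lemma rotate_tail_preserving: "measure_preserving_map \<Omega> (rotate_tail g)"
  unfolding rotate_tail_def[abs_def] by (rule \<Omega>_preserving) (rule rot_bij rot_measurable)+

lemma cylinder_borel:
  assumes "finite J" "\<And>k. k \<in> J \<Longrightarrow> E k \<in> sets borel"
  shows "{c::point. \<forall>k\<in>J. c k \<in> E k} \<in> sets borel"
proof -
  have "{c::point. \<forall>k\<in>J. c k \<in> E k} = (\<Inter>k\<in>J. (\<lambda>c. c k) -` E k \<inter> space borel) \<inter> UNIV" by auto
  also have "\<dots> \<in> sets borel"
  proof (cases "J = {}")
    case False
    then show ?thesis using assms measurable_sets[OF coordinate]
      by (intro sets.Int sets.finite_INT) auto
  qed simp
  finally show ?thesis .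
qed

lemma emeasure_cylinder:
  assumes "finite J" "\<And>k. k \<in> J \<Longrightarrow> E k \<in> sets borel"
  shows "emeasure \<Omega> {c. \<forall>k\<in>J. c k \<in> E k} = (\<Prod>k\<in>J. emeasure (U k) (E k))"
proof -
  interpret product_prob_space U UNIV by (rule product_U)
  show ?thesis
    using emeasure_PiM_Collect[of J E] assms by (simp add: \<Omega>_def space_PiM)
qed

lemma card_rotations_into:
  assumes "c \<in> C k" shows "card {g. g < card (C k) \<and> rot k g c \<in> E} = card (C k \<inter> E)"
proof (rule bij_betw_same_card[of "\<lambda>g. rot k g c"])
  show "bij_betw (\<lambda>g. rot k g c) {g. g < card (C k) \<and> rot k g c \<in> E} (C k \<inter> E)"
    unfolding bij_betw_def
  proof (intro conjI inj_onI set_eqI iffI)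
    fix g g' assume *: "g \<in> {g. g < card (C k) \<and> rot k g c \<in> E}" "g' \<in> {g. g < card (C k) \<and> rot k g c \<in> E}" "rot k g c = rot k g' c"
    have "rot k g c \<in> C k" using assms by (simp add: rot_in_C)
    from rot_ex1[OF assms this] * show "g = g'" by (metis (mono_tags, lifting) mem_Collect_eq)
  next
    fix c' assume "c' \<in> (\<lambda>g. rot k g c) ` {g. g < card (C k) \<and> rot k g c \<in> E}"
    then show "c' \<in> C k \<inter> E" using assms by (auto simp: rot_in_C)
  next
    fix c' assume "c' \<in> C k \<inter> E"
    with rot_ex1[OF assms, of c'] show "c' \<in> (\<lambda>g. rot k g c) ` {g. g < card (C k) \<and> rot k g c \<in> E}"
      by auto
  qed
qed

text \<open>
  Averaging the invariance of \<open>B\<close> over all rotations of digit \<open>k\<close> resamples this digit uniformly, so that it is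
  independent of \<open>B\<close> together with the other digits.
\<close>

lemma rotation_invariant_resample:
  assumes B: "B \<in> sets borel"
    and inv: "\<And>g. g \<in> rotations \<Longrightarrow> AE c in \<Omega>. c \<in> B \<longleftrightarrow> rotate_tail g c \<in> B"
    and J: "finite J" "k \<notin> J" and E: "\<And>j. j \<in> insert k J \<Longrightarrow> E j \<in> sets borel"
  shows "emeasure \<Omega> (B \<inter> {c. \<forall>j\<in>insert k J. c j \<in> E j}) = emeasure (U k) (E k) * emeasure \<Omega> (B \<inter> {c. \<forall>j\<in>J. c j \<in> E j})"
proof -
  let ?L = "card (C k)" and ?R = "B \<inter> {c. \<forall>j\<in>J. c j \<in> E j}" and ?S = "B \<inter> {c. \<forall>j\<in>insert k J. c j \<in> E j}"
  have R: "?R \<in> sets borel" using B J E by (intro sets.Int cylinder_borel) auto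
  have S: "?S \<in> sets borel" using B J E by (intro sets.Int cylinder_borel) auto
  define X where "X g = {c \<in> ?R. rot k g (c k) \<in> E k}" for g
  have X: "X g \<in> sets borel" for g
  proof -
    have "X g = ?R \<inter> ((\<lambda>c. rot k g (c k)) -` E k \<inter> space borel)" by (auto simp: X_def)
    then show ?thesis
      using R measurable_sets[OF measurable_compose[OF coordinate rot_measurable] E[OF insertI1], of k g k] by simp
  qed
  have eq: "emeasure \<Omega> (X g) = emeasure \<Omega> ?S" if g: "g < ?L" for g
  proof -
    let ?g = "(\<lambda>_. 0)(k := g)"
    have gr: "?g \<in> rotations"
    proof -
      have "\<forall>n\<ge>Suc k. ?g n = 0" by simp
      moreover have "\<forall>n. ?g n < card (C n)" using g card_C_pos by simp
      ultimately show ?thesis unfolding rotations_def by blast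
    qed
    have mp: "rotate_tail ?g \<in> measurable \<Omega> \<Omega>" "distr \<Omega> \<Omega> (rotate_tail ?g) = \<Omega>"
      using rotate_tail_preserving by (auto simp: measure_preserving_map_def)
    have rt: "rotate_tail ?g c j = (if j = k then rot k g (c k) else c j)" for c j
      by (simp add: rotate_tail_def rot_zero)
    have "emeasure \<Omega> ?S = emeasure (distr \<Omega> \<Omega> (rotate_tail ?g)) ?S" unfolding mp(2) ..
    also have "\<dots> = emeasure \<Omega> (rotate_tail ?g -` ?S \<inter> space \<Omega>)" using S by (intro emeasure_distr mp(1)) simp
    also have "\<dots> = emeasure \<Omega> (X g)"
    proof (rule emeasure_eq_AE)
      show "AE c in \<Omega>. (c \<in> rotate_tail ?g -` ?S \<inter> space \<Omega>) = (c \<in> X g)"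
        using inv[OF gr] by eventually_elim (use J(2) in \<open>auto simp: X_def rt split: if_splits\<close>)
      show "rotate_tail ?g -` ?S \<inter> space \<Omega> \<in> sets \<Omega>" using S by (intro measurable_sets[OF mp(1)]) simp
      show "X g \<in> sets \<Omega>" using X by simp
    qed
    finally show ?thesis by simp
  qed
  \<comment> \<open>for a fixed sequence in \<open>?R\<close>, the number of rotations that move digit \<open>k\<close> into \<open>E k\<close> is the number of elements of
    \<open>C k\<close> in \<open>E k\<close>, so the sum over all rotations can be evaluated under the integral\<close>
  have "of_nat ?L * emeasure \<Omega> ?S = (\<Sum>g<?L. emeasure \<Omega> (X g))" using eq by simp
  also have "\<dots> = (\<Sum>g<?L. \<integral>\<^sup>+ c. indicator (X g) c \<partial>\<Omega>)" using X by simp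
  also have "\<dots> = (\<integral>\<^sup>+ c. (\<Sum>g<?L. indicator (X g) c) \<partial>\<Omega>)"
    using X by (intro nn_integral_sum[symmetric]) simp
  also have "\<dots> = (\<integral>\<^sup>+ c. of_nat (card (C k \<inter> E k)) * indicator ?R c \<partial>\<Omega>)"
  proof (rule nn_integral_cong_AE)
    show "AE c in \<Omega>. (\<Sum>g<?L. indicator (X g) c) = (of_nat (card (C k \<inter> E k)) * indicator ?R c :: ennreal)"
      using AE_\<Omega>_digits
    proof eventually_elim
      case (elim c)
      have "(\<Sum>g<?L. indicator (X g) c :: ennreal) = (\<Sum>g<?L. if rot k g (c k) \<in> E k then indicator ?R c else 0)"
        by (intro sum.cong refl) (auto simp: X_def indicator_def)
      also have "\<dots> = (\<Sum>g\<in>{g. g < ?L \<and> rot k g (c k) \<in> E k}. indicator ?R c)"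
        by (subst sum.inter_filter[symmetric]) (auto intro!: sum.cong)
      also have "\<dots> = of_nat (card {g. g < ?L \<and> rot k g (c k) \<in> E k}) * indicator ?R c" by (rule sum_constant)
      also have "card {g. g < ?L \<and> rot k g (c k) \<in> E k} = card (C k \<inter> E k)"
        using elim by (intro card_rotations_into) blast
      finally show ?case .
    qed
  qed
  also have "\<dots> = of_nat (card (C k \<inter> E k)) * emeasure \<Omega> ?R"
    using R by (simp add: nn_integral_cmult_indicator)
  finally have *: "of_nat ?L * emeasure \<Omega> ?S = of_nat (card (C k \<inter> E k)) * emeasure \<Omega> ?R" .
  interpret prob_space \<Omega> by (rule prob_\<Omega>)
  have "real ?L * prob ?S = real (card (C k \<inter> E k)) * prob ?R"
    using * by (simp add: emeasure_eq_measure ennreal_of_nat_eq_real_of_nat ennreal_mult[symmetric])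
  then have "prob ?S = card (C k \<inter> E k) / ?L * prob ?R"
    using card_C_pos[of k] by (simp add: field_simps)
  then show ?thesis
    using E[OF insertI1] by (simp add: emeasure_eq_measure emeasure_U ennreal_mult[symmetric])
qed

text \<open>
  Resampling one digit after the other shows that \<open>B\<close> is independent of every cylinder set, hence of
  its own complement: a zero-one law.
\<close>

lemma rotation_invariant_trivial:
  assumes B: "B \<in> sets borel"
    and inv: "\<And>g. g \<in> rotations \<Longrightarrow> AE c in \<Omega>. c \<in> B \<longleftrightarrow> rotate_tail g c \<in> B"
  shows "(AE c in \<Omega>. c \<in> B) \<or> (AE c in \<Omega>. c \<notin> B)"
proof -
  interpret prob_space \<Omega> by (rule prob_\<Omega>)
  interpret P: product_prob_space U UNIV by (rule product_U)
  have B': "B \<in> sets \<Omega>" using B by simp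
  have indep: "emeasure \<Omega> (B \<inter> {c. \<forall>j\<in>J. c j \<in> E j}) = (\<Prod>j\<in>J. emeasure (U j) (E j)) * emeasure \<Omega> B"
    if "finite J" "\<And>j. j \<in> J \<Longrightarrow> E j \<in> sets borel" for J E
    using that
  proof (induction J rule: finite_induct)
    case (insert k J)
    have "emeasure \<Omega> (B \<inter> {c. \<forall>j\<in>insert k J. c j \<in> E j}) = emeasure (U k) (E k) * emeasure \<Omega> (B \<inter> {c. \<forall>j\<in>J. c j \<in> E j})"
      by (rule rotation_invariant_resample[OF B inv insert.hyps(1,2) insert.prems])
    also have "emeasure \<Omega> (B \<inter> {c. \<forall>j\<in>J. c j \<in> E j}) = (\<Prod>j\<in>J. emeasure (U j) (E j)) * emeasure \<Omega> B"
      by (rule insert.IH) (rule insert.prems, simp)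
    finally show ?case unfolding prod.insert[OF insert.hyps(1,2)] by (simp only: mult.assoc)
  qed simp
  show ?thesis
  proof (cases "emeasure \<Omega> B = 0")
    case True
    then have "AE c in \<Omega>. c \<notin> B" using B' by (intro AE_not_in) (simp add: null_sets_def)
    then show ?thesis ..
  next
    case False
    have "uniform_measure \<Omega> B = \<Omega>"
      unfolding \<Omega>_def
    proof (rule P.PiM_eq)
      fix J E assume J: "finite J" and E: "\<And>j. j \<in> J \<Longrightarrow> E j \<in> sets (U j)"
      have s: "prod_emb UNIV U J (Pi\<^sub>E J E) = {c. \<forall>j\<in>J. c j \<in> E j}"
        by (auto simp: prod_emb_def PiE_iff)
      have E': "\<And>j. j \<in> J \<Longrightarrow> E j \<in> sets borel" using E by simp
      have "emeasure (uniform_measure \<Omega> B) {c. \<forall>j\<in>J. c j \<in> E j} = emeasure \<Omega> (B \<inter> {c. \<forall>j\<in>J. c j \<in> E j}) / emeasure \<Omega> B"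
        using B cylinder_borel[OF J E'] by (intro emeasure_uniform_measure) simp_all
      also have "\<dots> = (\<Prod>j\<in>J. emeasure (U j) (E j))"
      proof -
        have "emeasure \<Omega> (B \<inter> {c. \<forall>j\<in>J. c j \<in> E j}) = (\<Prod>j\<in>J. emeasure (U j) (E j)) * emeasure \<Omega> B"
          by (rule indep) (use J E' in auto)
        then show ?thesis using False emeasure_finite[of B] by (simp only: ennreal_mult_divide_eq infinity_ennreal_def simp_thms)
      qed
      finally show "emeasure (uniform_measure (PiM UNIV U) B) (prod_emb UNIV U J (Pi\<^sub>E J E)) = (\<Prod>j\<in>J. emeasure (U j) (E j))"
        unfolding s \<Omega>_def .
    qed simp
    moreover have "emeasure (uniform_measure \<Omega> B) (UNIV - B) = emeasure \<Omega> (B \<inter> (UNIV - B)) / emeasure \<Omega> B"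
      using B by (intro emeasure_uniform_measure) simp_all
    ultimately have "emeasure \<Omega> (UNIV - B) = 0" by simp
    then have "AE c in \<Omega>. c \<notin> UNIV - B" using B by (intro AE_not_in) (simp add: null_sets_def)
    then show ?thesis by simp
  qed
qed

definition symmetries :: "(point \<Rightarrow> point) set" where
  "symmetries = shift ` \<rat> \<union> rotate_digits ` rotations"

lemma AE_lborel_translate:
  assumes "Measurable.pred borel P" shows "(AE y in lborel. P (y + t :: real)) \<longleftrightarrow> (AE y in lborel. P y)"
proof -
  have "(AE y in lborel. P y) \<longleftrightarrow> (AE y in distr lborel borel ((+) t). P y)" unfolding lborel_distr_plus ..
  also have "\<dots> \<longleftrightarrow> (AE y in lborel. P (t + y))"
    using assms by (intro AE_distr_iff) (simp_all add: pred_def)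
  finally show ?thesis by (simp add: add.commute)
qed

lemma slice_measurable: "(\<lambda>y. case_nat y c) \<in> measurable borel (borel :: point measure)"
  by (rule case_nat_borel) simp_all

lemma symmetries_measurable: "S \<in> symmetries \<Longrightarrow> S \<in> measurable m m"
  using shift_preserving rotate_digits_preserving by (auto simp: symmetries_def measure_preserving_map_def)

text \<open>
  For almost every sequence of digits the section in coordinate 0 is invariant under rational translations, hence null or
  conull. Which of the two holds does not change under digit rotations, since these move the section by a
  translation; so the zero-one law decides.
\<close>

lemma ergodic_symmetries: "ergodic_family m symmetries"
  unfolding ergodic_family_def
proof (intro conjI ballI impI)
  show "countable symmetries"
    unfolding symmetries_def using countable_rat rotations_countable by (intro countable_Un countable_image)
  show "symmetries \<subseteq> measurable m m" using symmetries_measurable by blast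
next
  fix A assume A: "A \<in> sets m" and inv: "\<forall>S\<in>symmetries. AE x in m. (x \<in> A) = (S x \<in> A)"
  have Ab: "A \<in> sets borel" using A by simp
  interpret prob_space \<Omega> by (rule prob_\<Omega>)
  have pA: "Measurable.pred borel (\<lambda>z. z \<in> A)" using Ab by simp
  have slice: "{y. case_nat y c \<in> A} \<in> sets borel" for c
    using measurable_sets[OF slice_measurable Ab, of c] by (simp add: vimage_def)
  have pslice: "Measurable.pred borel (\<lambda>y. case_nat y c \<in> A)" for c
    using slice by (simp add: pred_def)
  have inv': "AE c in \<Omega>. AE y in lborel. (case_nat y c \<in> A) = (S (case_nat y c) \<in> A)" if "S \<in> symmetries" for S
  proof -
    have "S \<in> measurable borel (borel :: point measure)"
      using symmetries_measurable[OF that] by (simp cong: measurable_cong_sets)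
    from measurable_compose[OF this pA] have "Measurable.pred borel (\<lambda>z. (z \<in> A) = (S z \<in> A))"
      by (rule pred_intros_logic(6)[OF pA])
    from AE_m[OF this] inv that show ?thesis by blast
  qed
  have "AE c in \<Omega>. \<forall>r\<in>\<rat>. AE y in lborel. (case_nat y c \<in> A) = (case_nat (y + r) c \<in> A)"
    unfolding AE_ball_countable[OF countable_rat]
  proof
    fix r :: real assume "r \<in> \<rat>"
    then have "shift r \<in> symmetries" by (simp add: symmetries_def)
    from inv'[OF this] show "AE c in \<Omega>. AE y in lborel. (case_nat y c \<in> A) = (case_nat (y + r) c \<in> A)"
      by (simp add: shift_eq_move move_def)
  qed
  then have triv: "AE c in \<Omega>. (AE y in lborel. case_nat y c \<in> A) \<or> (AE y in lborel. case_nat y c \<notin> A)"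
  proof eventually_elim
    case (elim c)
    then have "\<And>r. r \<in> \<rat> \<Longrightarrow> AE y in lborel. (y \<in> {y. case_nat y c \<in> A}) = (y + r \<in> {y. case_nat y c \<in> A})" by simp
    from lborel_rational_invariant_trivial[OF slice this] show ?case by simp
  qed
  define B where "B = {c. AE y in lborel. case_nat y c \<in> A}"
  have B: "B \<in> sets borel"
  proof -
    have "(\<lambda>p. case_nat (snd p) (fst p)) \<in> measurable (borel \<Otimes>\<^sub>M lborel) (borel :: point measure)"
      by (rule case_nat_borel) simp_all
    from measurable_compose[OF this pA] have "Measurable.pred borel (\<lambda>c. AE y in lborel. case_nat y c \<in> A)"
      by (intro lborel.pred_AE)
    then show ?thesis by (simp add: B_def pred_def)
  qed
  have "(AE c in \<Omega>. c \<in> B) \<or> (AE c in \<Omega>. c \<notin> B)"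
  proof (rule rotation_invariant_trivial[OF B])
    fix g assume "g \<in> rotations"
    then have "rotate_digits g \<in> symmetries" by (simp add: symmetries_def)
    from inv'[OF this] show "AE c in \<Omega>. (c \<in> B) = (rotate_tail g c \<in> B)"
    proof eventually_elim
      case (elim c)
      then have e: "AE y in lborel. (case_nat y c \<in> A) = (case_nat (y + compensation g c) (rotate_tail g c) \<in> A)"
        by (simp add: rotate_digits_def move_def rotate_tail_def)
      have "(AE y in lborel. case_nat y c \<in> A) \<longleftrightarrow> (AE y in lborel. case_nat (y + compensation g c) (rotate_tail g c) \<in> A)"
      proof
        assume "AE y in lborel. case_nat y c \<in> A"
        with e show "AE y in lborel. case_nat (y + compensation g c) (rotate_tail g c) \<in> A" by eventually_elim simp
      next
        assume "AE y in lborel. case_nat (y + compensation g c) (rotate_tail g c) \<in> A"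
        with e show "AE y in lborel. case_nat y c \<in> A" by eventually_elim simp
      qed
      also have "\<dots> \<longleftrightarrow> (AE y in lborel. case_nat y (rotate_tail g c) \<in> A)"
        by (rule AE_lborel_translate[OF pslice])
      finally show ?case by (simp add: B_def)
    qed
  qed
  then show "(AE x in m. x \<in> A) \<or> (AE x in m. x \<notin> A)"
  proof
    assume "AE c in \<Omega>. c \<in> B"
    then have "AE x in m. x \<in> A" by (simp add: AE_m[OF pA] B_def)
    then show ?thesis ..
  next
    assume "AE c in \<Omega>. c \<notin> B"
    with triv have "AE c in \<Omega>. AE y in lborel. case_nat y c \<notin> A" by eventually_elim (auto simp: B_def)
    moreover have "Measurable.pred borel (\<lambda>z. z \<notin> A)" using pA by (rule pred_intros_logic(2))
    ultimately have "AE x in m. x \<notin> A" by (simp add: AE_m)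
    then show ?thesis ..
  qed
qed

end

context cut_and_stack
begin

text \<open>
  The perturbation in the mixing argument; it becomes invisible as \<open>\<epsilon>\<close> tends to 0 and \<open>n\<close> to infinity.
\<close>

definition kick :: "real \<Rightarrow> (real \<Rightarrow> real) \<Rightarrow> nat \<Rightarrow> point \<Rightarrow> point" where
  "kick \<epsilon> \<sigma> n = move (\<lambda>_. \<epsilon>) (\<lambda>j. if j = n then \<sigma> else (\<lambda>x. x))"

lemma kick_0: "kick \<epsilon> \<sigma> n z 0 = z 0 + \<epsilon>"
  and kick_Suc: "kick \<epsilon> \<sigma> n z (Suc j) = (if j = n then \<sigma> (z (Suc j)) else z (Suc j))"
  by (simp_all add: kick_def move_0 move_Suc)

lemma kick_preserving:
  assumes "bij_betw \<sigma> (C n) (C n)" "\<And>c. c \<notin> C n \<Longrightarrow> \<sigma> c = c"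
  shows "measure_preserving_map m (kick \<epsilon> \<sigma> n)"
  unfolding kick_def
proof (rule move_preserving)
  fix j
  show "bij_betw (if j = n then \<sigma> else (\<lambda>x. x)) (C j) (C j)" using assms(1) by (auto simp: bij_betw_def)
  show "(if j = n then \<sigma> else (\<lambda>x. x)) \<in> borel_measurable borel"
  proof (cases "j = n")
    case True
    have "\<sigma> \<in> borel_measurable borel" by (rule finite_perm_measurable[of n]) (rule assms(2))
    then show ?thesis using True by (simp only: refl if_True)
  next
    case False
    have "(\<lambda>x::real. x) \<in> borel_measurable borel" by simp
    then show ?thesis using False by (simp only: if_False)
  qed
qed simp

lemma measure_m_cylinder:
  assumes "E \<in> sets borel" "finite J" "\<And>k. k \<in> J \<Longrightarrow> X k \<in> sets borel"
  shows "measure m {z. z 0 \<in> E \<and> (\<forall>k\<in>J. z (Suc k) \<in> X k)} = measure lborel E * (\<Prod>k\<in>J. measure (U k) (X k))"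
proof -
  interpret U: prob_space "U k" for k by (rule prob_U)
  have "emeasure m {z. z 0 \<in> E \<and> (\<lambda>n. z (Suc n)) \<in> {c. \<forall>k\<in>J. c k \<in> X k}} = emeasure lborel E * (\<Prod>k\<in>J. emeasure (U k) (X k))"
    using emeasure_m_rect[OF assms(1) cylinder_borel[OF assms(2,3)]] emeasure_cylinder[OF assms(2,3)] by simp
  moreover have "(\<Prod>k\<in>J. emeasure (U k) (X k)) = ennreal (\<Prod>k\<in>J. measure (U k) (X k))"
    by (simp add: U.emeasure_eq_measure prod_ennreal)
  ultimately show ?thesis by (simp add: measure_def enn2real_mult prod_nonneg)
qed

definition cylinders :: "point set set" where
  "cylinders = {{z. z 0 \<in> E \<and> (\<forall>k\<in>J. z (Suc k) \<in> X k)} | E J X.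
     E \<in> sets borel \<and> finite J \<and> (\<forall>k\<in>J. X k \<in> sets borel)}"

lemma cylindersI: "E \<in> sets borel \<Longrightarrow> finite J \<Longrightarrow> (\<And>k. k \<in> J \<Longrightarrow> X k \<in> sets borel) \<Longrightarrow>
    {z. z 0 \<in> E \<and> (\<forall>k\<in>J. z (Suc k) \<in> X k)} \<in> cylinders"
  unfolding cylinders_def by blast

lemma cylindersD:
  assumes "Y \<in> cylinders"
  shows "\<exists>E J X. Y = {z. z 0 \<in> E \<and> (\<forall>k\<in>J. z (Suc k) \<in> X k)} \<and> E \<in> sets borel \<and> finite J \<and>
    (\<forall>k. X k \<in> sets borel) \<and> (\<forall>k. k \<notin> J \<longrightarrow> X k = UNIV)"
proof -
  obtain E J X where Y: "Y = {z. z 0 \<in> E \<and> (\<forall>k\<in>J. z (Suc k) \<in> X k)}" "E \<in> sets borel" "finite J"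
    "\<And>k. k \<in> J \<Longrightarrow> X k \<in> sets borel"
    using assms unfolding cylinders_def by blast
  let ?X = "\<lambda>k. if k \<in> J then X k else UNIV"
  have "Y = {z. z 0 \<in> E \<and> (\<forall>k\<in>J. z (Suc k) \<in> ?X k)}" unfolding Y(1) by simp
  moreover have "\<forall>k. ?X k \<in> sets borel" "\<forall>k. k \<notin> J \<longrightarrow> ?X k = UNIV" using Y(4) by simp_all
  ultimately show ?thesis using Y(2,3)
    by (intro exI[of _ E] exI[of _ J] exI[of _ ?X] conjI)
qed

lemma cylinders_borel: "Y \<in> cylinders \<Longrightarrow> Y \<in> sets borel"
proof -
  assume "Y \<in> cylinders"
  from cylindersD[OF this] obtain E J X where Y: "Y = {z. z 0 \<in> E \<and> (\<forall>k\<in>J. z (Suc k) \<in> X k)}"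
    "E \<in> sets borel" "finite J" "\<And>k. X k \<in> sets borel" by blast
  have "Y = ((\<lambda>z. z 0) -` E \<inter> space borel) \<inter> ((\<lambda>z n. z (Suc n)) -` {c. \<forall>k\<in>J. c k \<in> X k} \<inter> space borel)"
    unfolding Y(1) by auto
  also have "\<dots> \<in> sets borel"
    by (intro sets.Int measurable_sets[OF coordinate] measurable_sets[OF tail_measurable] cylinder_borel Y)
  finally show "Y \<in> sets borel" .
qed

lemma cylinders_stable: "Int_stable cylinders"
proof (rule Int_stableI)
  fix a b assume ab: "a \<in> cylinders" "b \<in> cylinders"
  obtain E J X where a: "a = {z. z 0 \<in> E \<and> (\<forall>k\<in>J. z (Suc k) \<in> X k)}" "E \<in> sets borel" "finite J"
    "\<And>k. X k \<in> sets borel" "\<And>k. k \<notin> J \<Longrightarrow> X k = UNIV"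
    using cylindersD[OF ab(1)] by blast
  obtain E' J' X' where b: "b = {z. z 0 \<in> E' \<and> (\<forall>k\<in>J'. z (Suc k) \<in> X' k)}" "E' \<in> sets borel" "finite J'"
    "\<And>k. X' k \<in> sets borel" "\<And>k. k \<notin> J' \<Longrightarrow> X' k = UNIV"
    using cylindersD[OF ab(2)] by blast
  have "a \<inter> b = {z. z 0 \<in> E \<inter> E' \<and> (\<forall>k\<in>J \<union> J'. z (Suc k) \<in> X k \<inter> X' k)}"
    unfolding a(1) b(1) using a(5) b(5) by blast
  then show "a \<inter> b \<in> cylinders" using a b by (simp only:) (intro cylindersI, auto)
qed

lemma cylinders_generate: "sets borel = sigma_sets UNIV cylinders"
proof
  let ?P = "prod_algebra UNIV (\<lambda>_::nat. borel :: real measure)"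
  have P: "sets (borel :: point measure) = sigma_sets UNIV ?P"
    using sets_PiM[of UNIV "\<lambda>_::nat. borel :: real measure"] by (simp add: sets_PiM_equal_borel)
  have "?P \<subseteq> cylinders"
  proof
    fix Y assume "Y \<in> ?P"
    then obtain J E where J: "Y = prod_emb UNIV (\<lambda>_. borel) J (Pi\<^sub>E J E)" "finite J" "\<And>i. i \<in> J \<Longrightarrow> E i \<in> sets borel"
      by (rule prod_algebraE) blast
    have "Y = {z. z 0 \<in> (if 0 \<in> J then E 0 else UNIV) \<and> (\<forall>k\<in>{k. Suc k \<in> J}. z (Suc k) \<in> E (Suc k))}"
      (is "_ = ?R")
    proof (intro set_eqI iffI)
      fix z assume "z \<in> Y" then show "z \<in> ?R" unfolding J(1) by (auto simp: prod_emb_def PiE_iff)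
    next
      fix z assume z: "z \<in> ?R"
      have "z k \<in> E k" if "k \<in> J" for k using z that by (cases k) auto
      then show "z \<in> Y" unfolding J(1) by (auto simp: prod_emb_def PiE_iff)
    qed
    moreover have "finite {k. Suc k \<in> J}"
      using finite_vimageI[OF J(2), of Suc] by (simp add: vimage_def)
    ultimately show "Y \<in> cylinders" using J(3) by (simp only:) (intro cylindersI, auto)
  qed
  then show "sets borel \<subseteq> sigma_sets UNIV cylinders" unfolding P by (intro sigma_sets_mono')
  show "sigma_sets UNIV cylinders \<subseteq> sets borel"
    using sets.sigma_sets_subset[of cylinders "borel :: point measure"] cylinders_borel by auto
qed

text \<open>
  A cylinder set involves only finitely many digits. For \<open>n\<close> beyond these, the permutation of digit \<open>n\<close>
  does not affect it and the condition that this digit lies in \<open>V n\<close> is independent of it with probability \<open>1/8\<close>;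
  what remains is the translation by \<open>\<epsilon> n\<close> in coordinate 0.
\<close>

lemma kick_joining_tendsto:
  assumes V: "\<And>n. V n \<subseteq> C n" "\<And>n. 8 * card (V n) = card (C n)"
    and \<sigma>: "\<And>n. bij_betw (\<sigma> n) (C n) (C n)" "\<And>n c. c \<notin> C n \<Longrightarrow> \<sigma> n c = c"
    and \<epsilon>: "\<epsilon> \<longlonglongrightarrow> 0" "\<And>n. \<bar>\<epsilon> n\<bar> \<le> b"
    and E: "E \<in> sets borel" and G: "G \<in> sets borel"
  shows "(\<lambda>n. measure m ({z \<in> window R. z (Suc n) \<in> V n} \<inter> kick (\<epsilon> n) (\<sigma> n) n -` E \<inter> G))
     \<longlonglongrightarrow> 1 / 8 * measure m (window R \<inter> E \<inter> G)"
proof -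
  have Vb: "V n \<in> sets borel" for n using V(1)[of n] C_finite[of n] by (intro borel_closed finite_imp_closed) (rule finite_subset)
  have UV: "measure (U n) (V n) = 1 / 8" for n
  proof -
    have "C n \<inter> V n = V n" using V(1) by blast
    moreover have "real (card (C n)) = 8 * real (card (V n))" using V(2)[of n] by linarith
    ultimately show ?thesis using card_C_pos[of n] by (simp add: measure_U[OF Vb])
  qed
  show ?thesis
  proof (rule joining_tendsto[where G=cylinders and K'="window (R + b)"])
    show "Int_stable cylinders" by (rule cylinders_stable)
    show "cylinders \<subseteq> Pow (space m)" by simp
    show "space m \<in> cylinders" using cylindersI[of UNIV "{}" "\<lambda>_. UNIV"] by simp
    show "sets m = sigma_sets (space m) cylinders" using cylinders_generate by simp
    show "measure_preserving_map m (kick (\<epsilon> n) (\<sigma> n) n)" for n by (rule kick_preserving[OF \<sigma>])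
    show "{z \<in> window R. z (Suc n) \<in> V n} \<in> sets m" for n
    proof -
      have "{z \<in> window R. z (Suc n) \<in> V n} = window R \<inter> ((\<lambda>z. z (Suc n)) -` V n \<inter> space borel)" by auto
      then show ?thesis using measurable_sets[OF coordinate Vb, of "Suc n"] by simp
    qed
    show "{z \<in> window R. z (Suc n) \<in> V n} \<subseteq> window R" for n by blast
    show "window R \<in> sets m" "window (R + b) \<in> sets m" by simp_all
    show "emeasure m (window R) < \<infinity>" "emeasure m (window (R + b)) < \<infinity>" by (rule emeasure_window)+
    show "kick (\<epsilon> n) (\<sigma> n) n z \<in> window (R + b)" if "z \<in> window R" for n z
      using that \<epsilon>(2)[of n] by (auto simp: window_def kick_0 abs_le_iff)
    show "E \<in> sets m" "G \<in> sets m" using E G by simp_all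
  next
    fix Y Y' assume YY: "Y \<in> cylinders" "Y' \<in> cylinders"
    obtain E J X where Y: "Y = {z. z 0 \<in> E \<and> (\<forall>k\<in>J. z (Suc k) \<in> X k)}" "E \<in> sets borel" "finite J"
      "\<And>k. X k \<in> sets borel" "\<And>k. k \<notin> J \<Longrightarrow> X k = UNIV"
      using cylindersD[OF YY(1)] by blast
    obtain E' J' X' where Y': "Y' = {z. z 0 \<in> E' \<and> (\<forall>k\<in>J'. z (Suc k) \<in> X' k)}" "E' \<in> sets borel" "finite J'"
      "\<And>k. X' k \<in> sets borel" "\<And>k. k \<notin> J' \<Longrightarrow> X' k = UNIV"
      using cylindersD[OF YY(2)] by blast
    let ?K = "J \<union> J'"
    let ?p = "\<Prod>k\<in>?K. measure (U k) (X k \<inter> X' k)"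
    have fK: "finite ?K" using Y(3) Y'(3) by simp
    have XX: "X k \<inter> X' k \<in> sets borel" for k using Y(4) Y'(4) by simp
    have lim_set: "measure m (window R \<inter> Y \<inter> Y') = measure lborel ({-R..R} \<inter> E \<inter> E') * ?p"
    proof -
      have "window R \<inter> Y \<inter> Y' = {z. z 0 \<in> {-R..R} \<inter> E \<inter> E' \<and> (\<forall>k\<in>?K. z (Suc k) \<in> X k \<inter> X' k)}"
        unfolding Y(1) Y'(1) window_def using Y(5) Y'(5) by blast
      then show ?thesis using measure_m_cylinder[OF _ fK XX, of "{-R..R} \<inter> E \<inter> E'"] Y(2) Y'(2) by simp
    qed
    have step: "measure m ({z \<in> window R. z (Suc n) \<in> V n} \<inter> kick (\<epsilon> n) (\<sigma> n) n -` Y \<inter> Y')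
        = measure lborel ({-R..R} \<inter> {y. y + \<epsilon> n \<in> E} \<inter> E') * (1 / 8 * ?p)" if n: "n \<notin> ?K" for n
    proof -
      let ?X = "\<lambda>k. if k = n then V n else X k \<inter> X' k"
      have "{z \<in> window R. z (Suc n) \<in> V n} \<inter> kick (\<epsilon> n) (\<sigma> n) n -` Y \<inter> Y'
        = {z. z 0 \<in> {-R..R} \<inter> {y. y + \<epsilon> n \<in> E} \<inter> E' \<and> (\<forall>k\<in>insert n ?K. z (Suc k) \<in> ?X k)}"
      proof (intro set_eqI iffI)
        fix z assume z: "z \<in> {z \<in> window R. z (Suc n) \<in> V n} \<inter> kick (\<epsilon> n) (\<sigma> n) n -` Y \<inter> Y'"
        have "z (Suc k) \<in> ?X k" if "k \<in> insert n ?K" for k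
        proof (cases "k = n")
          case False
          then have "z (Suc k) \<in> X k" using z Y(5)[of k] by (cases "k \<in> J") (auto simp: Y(1) kick_Suc)
          moreover have "z (Suc k) \<in> X' k" using z Y'(5)[of k] by (cases "k \<in> J'") (auto simp: Y'(1))
          ultimately show ?thesis using False by simp
        qed (use z in simp)
        then show "z \<in> {z. z 0 \<in> {-R..R} \<inter> {y. y + \<epsilon> n \<in> E} \<inter> E' \<and> (\<forall>k\<in>insert n ?K. z (Suc k) \<in> ?X k)}"
          using z by (auto simp: Y(1) Y'(1) window_def kick_0)
      next
        fix z assume z: "z \<in> {z. z 0 \<in> {-R..R} \<inter> {y. y + \<epsilon> n \<in> E} \<inter> E' \<and> (\<forall>k\<in>insert n ?K. z (Suc k) \<in> ?X k)}"
        have "z (Suc k) \<in> X k" "k \<noteq> n" if "k \<in> J" for k using z that n by (auto split: if_splits)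
        moreover have "z (Suc k) \<in> X' k" if "k \<in> J'" for k using z that n by (auto split: if_splits)
        moreover have "z (Suc n) \<in> V n" using z by auto
        ultimately show "z \<in> {z \<in> window R. z (Suc n) \<in> V n} \<inter> kick (\<epsilon> n) (\<sigma> n) n -` Y \<inter> Y'"
          using z by (auto simp: Y(1) Y'(1) window_def kick_0 kick_Suc)
      qed
      moreover have "measure m {z. z 0 \<in> {-R..R} \<inter> {y. y + \<epsilon> n \<in> E} \<inter> E' \<and> (\<forall>k\<in>insert n ?K. z (Suc k) \<in> ?X k)}
        = measure lborel ({-R..R} \<inter> {y. y + \<epsilon> n \<in> E} \<inter> E') * (\<Prod>k\<in>insert n ?K. measure (U k) (?X k))"
      proof (rule measure_m_cylinder)
        have "(\<lambda>y. y + \<epsilon> n) -` E \<inter> space borel \<in> sets borel" by (rule measurable_sets[OF _ Y(2)]) simp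
        then show "{-R..R} \<inter> {y. y + \<epsilon> n \<in> E} \<inter> E' \<in> sets borel" using Y'(2) by (simp add: vimage_def)
      qed (use fK Vb XX in auto)
      moreover have "(\<Prod>k\<in>insert n ?K. measure (U k) (?X k)) = measure (U n) (V n) * (\<Prod>k\<in>?K. measure (U k) (?X k))"
        using n fK by (subst prod.insert) auto
      moreover have "(\<Prod>k\<in>?K. measure (U k) (?X k)) = ?p"
        using n by (intro prod.cong) auto
      ultimately show ?thesis by (simp only: UV)
    qed
    have lim: "(\<lambda>n. measure lborel ({-R..R} \<inter> {y. y + \<epsilon> n \<in> E} \<inter> E') * (1 / 8 * ?p)) \<longlonglongrightarrow> measure lborel ({-R..R} \<inter> E \<inter> E') * (1 / 8 * ?p)"
      by (intro tendsto_mult lborel_translation_tendsto \<epsilon> Y Y' tendsto_const)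
    have "\<forall>\<^sub>F n in sequentially. n \<notin> ?K"
    proof -
      obtain N where "\<And>k. k \<in> ?K \<Longrightarrow> k < N" using fK by (meson finite_nat_set_iff_bounded)
      then show ?thesis by (intro eventually_sequentiallyI[of N]) (auto simp: not_less dest: leD)
    qed
    then have ev: "\<forall>\<^sub>F n in sequentially. measure lborel ({-R..R} \<inter> {y. y + \<epsilon> n \<in> E} \<inter> E') * (1 / 8 * ?p)
       = measure m ({z \<in> window R. z (Suc n) \<in> V n} \<inter> kick (\<epsilon> n) (\<sigma> n) n -` Y \<inter> Y')"
      by eventually_elim (rule step[symmetric])
    have "(\<lambda>n. measure m ({z \<in> window R. z (Suc n) \<in> V n} \<inter> kick (\<epsilon> n) (\<sigma> n) n -` Y \<inter> Y'))
       \<longlonglongrightarrow> measure lborel ({-R..R} \<inter> E \<inter> E') * (1 / 8 * ?p)"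
      by (rule Lim_transform_eventually[OF lim ev])
    then show "(\<lambda>n. measure m ({z \<in> window R. z (Suc n) \<in> V n} \<inter> kick (\<epsilon> n) (\<sigma> n) n -` Y \<inter> Y'))
       \<longlonglongrightarrow> 1 / 8 * measure m (window R \<inter> Y \<inter> Y')"
      unfolding lim_set by (simp only: ac_simps)
  qed
qed

text \<open>
  If permuting the digit changes it by \<open>d + s\<close>, this change can be traded for a translation. Thus translating
  by \<open>\<epsilon> + d\<close> amounts to the kick followed by the translation by \<open>-s\<close>. Later \<open>d\<close> is a large multiple of \<open>\<beta>\<close>, so that \<open>\<epsilon> + d\<close>
  is a multiple of \<open>t\<close>, and \<open>s\<close> is 0 or a rational.
\<close>

lemma kick_same_orbit:
  assumes "\<sigma> (z (Suc n)) - z (Suc n) = d + s"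
  shows "same_orbit (shift (\<epsilon> + d) z) (shift (-s) (kick \<epsilon> \<sigma> n z))"
proof -
  have "height n (shift (-s) (kick \<epsilon> \<sigma> n z)) = height n z + \<epsilon> - s"
  proof -
    have "height n (kick \<epsilon> \<sigma> n z) = height n z + \<epsilon>"
      by (simp add: height_alt kick_0 kick_Suc)
    then show ?thesis by (simp add: height_shift)
  qed
  then have "height (Suc n) (shift (\<epsilon> + d) z) = height (Suc n) (shift (-s) (kick \<epsilon> \<sigma> n z))"
    using assms by (simp add: height_Suc height_shift) (simp add: shift_def kick_Suc)
  moreover have "shift (\<epsilon> + d) z k = shift (-s) (kick \<epsilon> \<sigma> n z) k" if "k > Suc n" for k
    using that by (cases k) (auto simp: shift_def kick_Suc)
  ultimately show ?thesis unfolding same_orbit_def by blast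
qed

end

section \<open>Infinite ergodic index\<close>

lemma AE_power_component:
  assumes sf: "sigma_finite_measure M" and I: "finite I" "i \<in> I"
    and P: "AE z in M. z \<in> S" and S: "S \<in> sets M"
  shows "AE x in PiM I (\<lambda>_. M). x i \<in> S"
proof -
  interpret product_sigma_finite "\<lambda>_. M" using sf by (simp add: product_sigma_finite_def)
  let ?E = "\<lambda>j. if j = i then space M - S else space M"
  have "space M - S \<in> null_sets M" using P S by (simp add: AE_iff_null_sets[symmetric] set_diff_eq[symmetric] AE_iff_null Diff_eq)
  then have "emeasure M (?E i) = 0" by (simp add: null_sets_def)
  then have "emeasure (PiM I (\<lambda>_. M)) (Pi\<^sub>E I ?E) = 0"
    using I S by (subst emeasure_PiM) (auto intro!: prod_zero)
  then have "Pi\<^sub>E I ?E \<in> null_sets (PiM I (\<lambda>_. M))"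
    using I S by (auto simp: null_sets_def intro!: sets_PiM_I_finite)
  then have "AE x in PiM I (\<lambda>_. M). x \<notin> Pi\<^sub>E I ?E" by (rule AE_not_in)
  then show ?thesis using AE_space
  proof eventually_elim
    case (elim x)
    then have x: "x j \<in> space M" if "j \<in> I" for j using that by (auto simp: space_PiM)
    have ext: "x \<in> extensional I" using elim by (auto simp: space_PiM PiE_def)
    show ?case
    proof (rule ccontr)
      assume "x i \<notin> S"
      then have "x \<in> Pi\<^sub>E I ?E" using x ext by (auto simp: PiE_def)
      with elim show False by blast
    qed
  qed
qed

text \<open>
  In \<open>pattern\<close>, the permutation may depend on \<open>k\<close> and \<open>a\<close>, but the proportion \<open>1/8\<close> does not. This
  uniformity lets \<open>k\<close> be chosen after \<open>t\<close>.
\<close>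

locale mixing_cut_and_stack = cut_and_stack +
  fixes \<beta> q :: "nat \<Rightarrow> real"
  assumes q_recurs: "r \<in> \<rat> \<Longrightarrow> \<exists>n\<ge>N. q n = r"
    and pattern: "\<lbrakk>1 \<le> k; k \<le> Suc n; a \<in> {0, 1}\<rbrakk> \<Longrightarrow>
      \<exists>V \<sigma>. V \<subseteq> C n \<and> 8 * card V = card (C n) \<and> bij_betw \<sigma> (C n) (C n) \<and>
        (\<forall>c. c \<notin> C n \<longrightarrow> \<sigma> c = c) \<and> (\<forall>c\<in>V. \<sigma> c - c = real k * \<beta> n + a * q n)"
begin

text \<open>
  Dirichlet's theorem for \<open>\<beta> n / t\<close>.
\<close>

lemma return_times:
  assumes t: "t \<noteq> 0"
  obtains k :: "nat \<Rightarrow> nat" and j :: "nat \<Rightarrow> int"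
  where "\<And>n. 1 \<le> k n" "\<And>n. k n \<le> Suc n" "\<And>n. \<bar>of_int (j n) * t - real (k n) * \<beta> n\<bar> \<le> \<bar>t\<bar> / Suc n"
proof -
  have "\<exists>k::nat. \<exists>j::int. 1 \<le> k \<and> k \<le> Suc n \<and> \<bar>of_int j * t - real k * \<beta> n\<bar> \<le> \<bar>t\<bar> / Suc n" for n
  proof -
    obtain j k :: int where jk: "0 < k" "k \<le> int (Suc n)" "\<bar>of_int k * (\<beta> n / t) - of_int j\<bar> < 1 / real (Suc n)"
      by (rule Dirichlet_approx[OF zero_less_Suc, of n "\<beta> n / t"]) (rule that)
    have "\<bar>of_int j * t - of_int k * \<beta> n\<bar> = \<bar>of_int k * (\<beta> n / t) - of_int j\<bar> * \<bar>t\<bar>"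
    proof -
      have "of_int j * t - of_int k * \<beta> n = - ((of_int k * (\<beta> n / t) - of_int j) * t)"
        using t by (simp add: field_simps)
      then show ?thesis by (simp only: abs_minus_cancel abs_mult)
    qed
    also have "\<dots> \<le> 1 / real (Suc n) * \<bar>t\<bar>" using jk(3) by (intro mult_right_mono) auto
    finally have "\<bar>of_int j * t - of_int k * \<beta> n\<bar> \<le> \<bar>t\<bar> / Suc n" by simp
    with jk(1,2) show ?thesis by (intro exI[of _ "nat k"] exI[of _ j]) auto
  qed
  then show thesis using that by metis
qed

text \<open>
  At a stage with \<open>q n = r\<close>, translate all coordinates by the multiple of \<open>t\<close> that is close to
  \<open>k n * \<beta> n\<close>. Where the digits lie in the sets \<open>V\<close>, this is the same, up to \<open>same_orbit\<close>, as
  applying the kicks \<open>\<Psi> n\<close> and then translating the coordinate \<open>i0\<close> alone by \<open>-r\<close>. So there \<open>x \<in> S\<close> iff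
  \<open>\<Psi> n x \<in> S'\<close>, where \<open>S'\<close> is the translated set. But \<open>\<Psi> n\<close> tends to the identity and the sets \<open>V\<close> capture
  asymptotically a fixed positive proportion of every set; as the stages with \<open>q n = r\<close> never end, \<open>S\<close> and \<open>S'\<close> must agree
  mod null sets.
\<close>

lemma coordinate_shift_invariant:
  fixes I :: "'i set"
  defines "N \<equiv> PiM I (\<lambda>_. m)"
  assumes t: "t \<noteq> 0" and I: "finite I" "i0 \<in> I" and r: "r \<in> \<rat>"
    and S: "S \<in> sets N"
    and orbit: "\<And>x y. \<lbrakk>x \<in> space N; y \<in> space N; \<And>i. i \<in> I \<Longrightarrow> x i \<in> Z \<and> y i \<in> Z \<and> same_orbit (x i) (y i)\<rbrakk> \<Longrightarrow> x \<in> S \<longleftrightarrow> y \<in> S"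
    and tinv: "\<And>x j. \<lbrakk>x \<in> space N; \<And>i. i \<in> I \<Longrightarrow> x i \<in> Z\<rbrakk> \<Longrightarrow> x \<in> S \<longleftrightarrow> (\<lambda>i\<in>I. shift (of_int j * t) (x i)) \<in> S"
  shows "AE x in N. x \<in> S \<longleftrightarrow> x(i0 := shift (-r) (x i0)) \<in> S"
proof -
  interpret product_sigma_finite "\<lambda>_. m" using sigma_finite_m by (simp add: product_sigma_finite_def)
  obtain k :: "nat \<Rightarrow> nat" and j :: "nat \<Rightarrow> int" where kj: "\<And>n. 1 \<le> k n" "\<And>n. k n \<le> Suc n"
    "\<And>n. \<bar>of_int (j n) * t - real (k n) * \<beta> n\<bar> \<le> \<bar>t\<bar> / Suc n"
    using return_times[OF t] by blast
  define \<epsilon> where "\<epsilon> n = of_int (j n) * t - real (k n) * \<beta> n" for n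
  have \<epsilon>0: "\<epsilon> \<longlonglongrightarrow> 0"
  proof (rule Lim_null_comparison)
    show "\<forall>\<^sub>F n in sequentially. norm (\<epsilon> n) \<le> \<bar>t\<bar> * (1 / Suc n)"
      using kj(3) by (intro always_eventually) (simp add: \<epsilon>_def)
    have "(\<lambda>n. 1 / real (Suc n)) \<longlonglongrightarrow> 0"
      using LIMSEQ_inverse_real_of_nat by (simp add: inverse_eq_divide)
    from tendsto_mult[OF tendsto_const[of "\<bar>t\<bar>"] this] show "(\<lambda>n. \<bar>t\<bar> * (1 / Suc n)) \<longlonglongrightarrow> 0" by simp
  qed
  have \<epsilon>b: "\<bar>\<epsilon> n\<bar> \<le> \<bar>t\<bar>" for n
  proof -
    have "\<bar>t\<bar> / Suc n \<le> \<bar>t\<bar>" by (simp add: field_simps)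
    with kj(3)[of n] show ?thesis by (simp add: \<epsilon>_def)
  qed
  \<comment> \<open>only coordinate \<open>i0\<close> uses the pattern that involves \<open>q n\<close>\<close>
  define a :: "'i \<Rightarrow> real" where "a i = (if i = i0 then 1 else 0)" for i
  define good where "good i n p \<longleftrightarrow> fst p \<subseteq> C n \<and> 8 * card (fst p) = card (C n) \<and> bij_betw (snd p) (C n) (C n) \<and>
        (\<forall>c. c \<notin> C n \<longrightarrow> snd p c = c) \<and> (\<forall>c\<in>fst p. snd p c - c = real (k n) * \<beta> n + a i * q n)"
    for i n and p :: "real set \<times> (real \<Rightarrow> real)"
  define V where "V i n = fst (SOME p. good i n p)" for i n
  define \<sigma> where "\<sigma> i n = snd (SOME p. good i n p)" for i n
  have V\<sigma>_good: "good i n (V i n, \<sigma> i n)" for i n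
  proof -
    have "a i \<in> {0, 1}" by (simp add: a_def)
    from pattern[OF kj(1,2) this, of n] have "\<exists>p. good i n p" by (auto simp: good_def)
    then have "good i n (SOME p. good i n p)" by (rule someI_ex)
    then show ?thesis by (simp add: V_def \<sigma>_def)
  qed
  have V\<sigma>: "\<And>i n. V i n \<subseteq> C n" "\<And>i n. 8 * card (V i n) = card (C n)" "\<And>i n. bij_betw (\<sigma> i n) (C n) (C n)"
    "\<And>i n c. c \<notin> C n \<Longrightarrow> \<sigma> i n c = c" "\<And>i n c. c \<in> V i n \<Longrightarrow> \<sigma> i n c - c = real (k n) * \<beta> n + a i * q n"
    using V\<sigma>_good by (simp_all add: good_def)
  define \<psi> where "\<psi> i n = kick (\<epsilon> n) (\<sigma> i n) n" for i n
  define \<Psi> where "\<Psi> n x = (\<lambda>i\<in>I. \<psi> i n (x i))" for n and x :: "'i \<Rightarrow> point"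
  define Y where "Y R i n = {z \<in> window R. z (Suc n) \<in> V i n}" for R i n
  have \<psi>p: "measure_preserving_map m (\<psi> i n)" for i n
    unfolding \<psi>_def by (rule kick_preserving[OF V\<sigma>(3,4)])
  have Yb: "Y R i n \<in> sets m" for R i n
  proof -
    have "closed (V i n)" using V\<sigma>(1)[of i n] C_finite[of n] by (intro finite_imp_closed) (rule finite_subset)
    then have "V i n \<in> sets borel" by (rule borel_closed)
    moreover have "Y R i n = window R \<inter> ((\<lambda>z. z (Suc n)) -` V i n \<inter> space borel)" by (auto simp: Y_def)
    ultimately show ?thesis using measurable_sets[OF coordinate, of "V i n" "Suc n"] by simp
  qed
  let ?W = "\<lambda>R::real. \<Pi>\<^sub>E i\<in>I. window R"
  have joint: "(\<lambda>n. measure N ((\<Pi>\<^sub>E i\<in>I. Y R i n) \<inter> \<Psi> n -` E \<inter> G)) \<longlonglongrightarrow> (\<Prod>i\<in>I. 1 / 8) * measure N (?W R \<inter> E \<inter> G)"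
    if "E \<in> sets N" "G \<in> sets N" for E G R
    unfolding N_def \<Psi>_def
  proof (rule joining_tendsto_power[OF sigma_finite_m I(1), where K'="window (R + \<bar>t\<bar>)"])
    show "measure_preserving_map m (\<psi> i n)" for i n by (rule \<psi>p)
    show "Y R i n \<in> sets m" for i n by (rule Yb)
    show "Y R i n \<subseteq> window R" for i n by (auto simp: Y_def)
    show "window R \<in> sets m" "window (R + \<bar>t\<bar>) \<in> sets m" by simp_all
    show "emeasure m (window R) < \<infinity>" "emeasure m (window (R + \<bar>t\<bar>)) < \<infinity>" by (rule emeasure_window)+
    show "\<psi> i n x \<in> window (R + \<bar>t\<bar>)" if "x \<in> window R" for i n x
      using that \<epsilon>b[of n] by (auto simp: window_def \<psi>_def kick_0 abs_le_iff)
    show "(\<lambda>n. measure m (Y R i n \<inter> \<psi> i n -` E' \<inter> G')) \<longlonglongrightarrow> 1 / 8 * measure m (window R \<inter> E' \<inter> G')"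
      if "E' \<in> sets m" "G' \<in> sets m" for i E' G'
      unfolding Y_def \<psi>_def
      by (rule kick_joining_tendsto[OF V\<sigma>(1-4) \<epsilon>0 \<epsilon>b]) (use that in simp_all)
  qed (use that in \<open>simp_all add: N_def\<close>)
  define S' where "S' = {x \<in> space N. x(i0 := shift (-r) (x i0)) \<in> S}"
  have upd: "(\<lambda>x. x(i0 := shift (-r) (x i0))) \<in> measurable N N"
  proof -
    have "measure_preserving_map N (\<lambda>x. \<lambda>i\<in>I. (if i = i0 then shift (-r) else shift 0) (x i))"
      unfolding N_def by (rule measure_preserving_map_power[OF sigma_finite_m I(1)]) (auto intro: shift_preserving)
    then have "(\<lambda>x. \<lambda>i\<in>I. (if i = i0 then shift (-r) else shift 0) (x i)) \<in> measurable N N"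
      by (simp add: measure_preserving_map_def)
    then show ?thesis
      by (rule measurable_cong[THEN iffD1, rotated])
         (use I(2) in \<open>auto simp: N_def space_PiM PiE_def extensional_def fun_eq_iff shift_def\<close>)
  qed
  have S': "S' \<in> sets N" using measurable_sets[OF upd S] by (simp add: S'_def vimage_def Int_def conj_commute)
  have AZ: "AE x in N. \<forall>i\<in>I. x i \<in> Z"
    unfolding N_def using I(1)
    by (subst AE_finite_all) (auto intro!: AE_power_component sigma_finite_m AE_Z)
  have \<Psi>sp: "\<Psi> n x \<in> space N" for n x by (auto simp: \<Psi>_def N_def space_PiM)
  have key: "x \<in> S \<longleftrightarrow> \<Psi> n x \<in> S'" if n: "q n = r" and x: "x \<in> space N" "\<forall>i\<in>I. x i \<in> Z" "x \<in> (\<Pi>\<^sub>E i\<in>I. Y R i n)" for n x R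
  proof -
    let ?v = "(\<Psi> n x)(i0 := shift (-r) (\<Psi> n x i0))"
    let ?u = "\<lambda>i\<in>I. shift (of_int (j n) * t) (x i)"
    have kZ: "\<psi> i n (x i) \<in> Z" if "i \<in> I" for i
    proof -
      have "\<sigma> i n c \<in> C n" if "c \<in> C n" for c using V\<sigma>(3)[of i n] that by (auto simp: bij_betw_def)
      then show ?thesis using x(2) that by (auto simp: Z_def \<psi>_def kick_Suc)
    qed
    have vi: "?v i = shift (- (a i * q n)) (\<psi> i n (x i))" if "i \<in> I" for i
      using that n by (auto simp: \<Psi>_def a_def shift_def)
    have "x \<in> S \<longleftrightarrow> ?u \<in> S" by (rule tinv) (use x in auto)
    also have "\<dots> \<longleftrightarrow> ?v \<in> S"
    proof (rule orbit)
      show "?u \<in> space N" by (auto simp: N_def space_PiM)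
      show "?v \<in> space N" using I(2) by (auto simp: N_def space_PiM \<Psi>_def extensional_def)
      fix i assume i: "i \<in> I"
      have xV: "x i (Suc n) \<in> V i n" using x(3) i by (auto simp: Y_def)
      have "same_orbit (shift (\<epsilon> n + real (k n) * \<beta> n) (x i)) (shift (- (a i * q n)) (\<psi> i n (x i)))"
        unfolding \<psi>_def by (rule kick_same_orbit) (rule V\<sigma>(5)[OF xV])
      moreover have "\<epsilon> n + real (k n) * \<beta> n = of_int (j n) * t" by (simp add: \<epsilon>_def)
      ultimately have "same_orbit (?u i) (?v i)" unfolding vi[OF i] using i by simp
      moreover have "?u i \<in> Z" using i x(2) by simp
      moreover have "?v i \<in> Z" unfolding vi[OF i] using kZ[OF i] by simp
      ultimately show "?u i \<in> Z \<and> ?v i \<in> Z \<and> same_orbit (?u i) (?v i)" by blast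
    qed
    finally show ?thesis using \<Psi>sp by (simp add: S'_def)
  qed
  have zero: "measure N Q = 0" if "AE x in N. x \<notin> Q" for Q
  proof (cases "Q \<in> sets N")
    case True
    with that have "Q \<in> null_sets N" by (subst AE_iff_null_sets)
    then show ?thesis by (simp add: measure_eq_0_null_sets)
  qed (simp add: measure_notin_sets)
  \<comment> \<open>the limits exist along all \<open>n\<close>, so vanishing at the infinitely many stages with \<open>q n = r\<close> is enough\<close>
  have lim0: "L = 0" if f: "f \<longlonglongrightarrow> L" and z: "\<And>n. q n = r \<Longrightarrow> f n = 0" for f :: "nat \<Rightarrow> real" and L
  proof (rule ccontr)
    assume "L \<noteq> 0"
    from tendsto_imp_eventually_ne[OF f this] obtain n0 where n0: "\<And>n. n \<ge> n0 \<Longrightarrow> f n \<noteq> 0"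
      by (auto simp: eventually_sequentially)
    from q_recurs[OF r, of n0] obtain n where "n \<ge> n0" "q n = r" by blast
    with n0 z show False by blast
  qed
  have p: "(\<Prod>i\<in>I. 1 / 8 :: real) \<noteq> 0" by simp
  have 1: "measure N (?W R \<inter> S' \<inter> (space N - S)) = 0" for R
  proof -
    have "(\<Prod>i\<in>I. 1 / 8) * measure N (?W R \<inter> S' \<inter> (space N - S)) = 0"
    proof (rule lim0[OF joint[OF S']])
      show "space N - S \<in> sets N" using S by auto
      fix n assume n: "q n = r"
      show "measure N ((\<Pi>\<^sub>E i\<in>I. Y R i n) \<inter> \<Psi> n -` S' \<inter> (space N - S)) = 0"
      proof (rule zero)
        show "AE x in N. x \<notin> (\<Pi>\<^sub>E i\<in>I. Y R i n) \<inter> \<Psi> n -` S' \<inter> (space N - S)"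
          using AZ by eventually_elim (use key[OF n] in blast)
      qed
    qed
    with p show ?thesis by simp
  qed
  have 2: "measure N (?W R \<inter> (space N - S') \<inter> S) = 0" for R
  proof -
    have "(\<Prod>i\<in>I. 1 / 8) * measure N (?W R \<inter> (space N - S') \<inter> S) = 0"
    proof (rule lim0[OF joint[OF _ S]])
      show "space N - S' \<in> sets N" using S' by auto
      fix n assume n: "q n = r"
      show "measure N ((\<Pi>\<^sub>E i\<in>I. Y R i n) \<inter> \<Psi> n -` (space N - S') \<inter> S) = 0"
      proof (rule zero)
        show "AE x in N. x \<notin> (\<Pi>\<^sub>E i\<in>I. Y R i n) \<inter> \<Psi> n -` (space N - S') \<inter> S"
          using AZ AE_space by eventually_elim (use key[OF n] in blast)
      qed
    qed
    with p show ?thesis by simp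
  qed
  have Wf: "emeasure N (?W R) \<noteq> \<infinity>" and Wb: "?W R \<in> sets N" for R
    unfolding N_def using I(1) emeasure_window[of R]
    by (simp_all add: emeasure_PiM less_top[symmetric] ennreal_prod_eq_top sets_PiM_I_finite del: prod_constant)
  have null: "AE x in N. x \<notin> Q" if Q: "Q \<in> sets N" and z: "\<And>R::nat. measure N (?W (real R) \<inter> Q) = 0" for Q
  proof -
    have ae: "AE x in N. \<forall>R::nat. x \<notin> ?W (real R) \<inter> Q"
      unfolding AE_all_countable
    proof
      fix R :: nat
      have "emeasure N (?W (real R) \<inter> Q) \<noteq> \<infinity>"
        using emeasure_mono[of "?W (real R) \<inter> Q" "?W (real R)" N] Wb Wf by (auto simp: top_unique)
      then have "emeasure N (?W (real R) \<inter> Q) = 0"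
        using z[of R] by (simp add: emeasure_eq_ennreal_measure)
      then show "AE x in N. x \<notin> ?W (real R) \<inter> Q"
        using Wb Q by (intro AE_not_in) (auto simp: null_sets_def)
    qed
    have exW: "\<exists>R::nat. x \<in> ?W (real R)" if "x \<in> space N" for x
    proof -
      obtain R :: nat where R: "(\<Sum>i\<in>I. \<bar>x i 0\<bar>) \<le> real R" using real_arch_simple by blast
      have "\<bar>x i 0\<bar> \<le> real R" if "i \<in> I" for i
        using member_le_sum[of i I "\<lambda>i. \<bar>x i 0\<bar>"] that I(1) R by force
      then have "x i \<in> window (real R)" if "i \<in> I" for i
        using that by (fastforce simp: window_def abs_le_iff)
      then have "x \<in> ?W (real R)" using \<open>x \<in> space N\<close> by (auto simp: N_def space_PiM PiE_def)
      then show ?thesis ..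
    qed
    show ?thesis using ae AE_space by eventually_elim (use exW in blast)
  qed
  have "AE x in N. x \<notin> S' \<inter> (space N - S)" by (rule null) (use S S' 1 in \<open>auto simp: Int_assoc\<close>)
  moreover have "AE x in N. x \<notin> (space N - S') \<inter> S" by (rule null) (use S S' 2 in \<open>auto simp: Int_assoc\<close>)
  ultimately show ?thesis using AE_space by eventually_elim (auto simp: S'_def)
qed

text \<open>
  The powers of \<open>M\<close> live on smaller sets of functions than the powers of \<open>m\<close>. Both the image of the former in the
  larger space and the restriction of the latter to the power of \<open>D\<close> are the power of \<open>m\<close> restricted to \<open>D\<close>.
\<close>

lemma AE_power_restrict:
  fixes I :: "'i set"
  assumes I: "finite I" and P: "AE x in PiM I (\<lambda>_. m). x \<in> S" and S: "S \<in> sets (PiM I (\<lambda>_. m))"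
  shows "AE x in PiM I (\<lambda>_. M). x \<in> S"
proof -
  interpret product_sigma_finite "\<lambda>_. m" using sigma_finite_m by (simp add: product_sigma_finite_def)
  interpret PM: product_sigma_finite "\<lambda>_. M" using sigma_finite_M by (simp add: product_sigma_finite_def)
  define m' where "m' = density m (indicator D)"
  have em': "emeasure m' X = emeasure m (D \<inter> X)" if "X \<in> sets borel" for X
    unfolding m'_def using that by (subst emeasure_restricted) simp_all
  have sm': "sets m' = sets m" by (simp add: m'_def)
  have "sigma_finite_measure m'"
  proof
    show "\<exists>A. countable A \<and> A \<subseteq> sets m' \<and> \<Union>A = space m' \<and> (\<forall>a\<in>A. emeasure m' a \<noteq> \<infinity>)"
    proof (intro exI[of _ "range (\<lambda>R::nat. window (real R))"] conjI ballI)
      show "range (\<lambda>R::nat. window (real R)) \<subseteq> sets m'" by (auto simp: sm')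
      show "\<Union> (range (\<lambda>R::nat. window (real R))) = space m'" using UN_window by (simp add: m'_def)
      fix a assume "a \<in> range (\<lambda>R::nat. window (real R))"
      then obtain R :: nat where a: "a = window (real R)" by blast
      have "emeasure m' a \<le> emeasure m a" unfolding a by (subst em') (auto intro: emeasure_mono)
      then show "emeasure m' a \<noteq> \<infinity>" using emeasure_window[of R] by (auto simp: a top_unique)
    qed simp
  qed
  then interpret PM': product_sigma_finite "\<lambda>_. m'" by (simp add: product_sigma_finite_def)
  have sets': "sets (PiM I (\<lambda>_. m')) = sets (PiM I (\<lambda>_. m))" by (rule sets_PiM_cong) (simp_all add: sm')
  have idm: "(\<lambda>x. x) \<in> measurable (PiM I (\<lambda>_. M)) (PiM I (\<lambda>_. m))"
  proof -
    have "(\<lambda>z. z) \<in> measurable M m" using id_M_borel by (simp cong: measurable_cong_sets)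
    then have "(\<lambda>x. \<lambda>i\<in>I. x i) \<in> measurable (PiM I (\<lambda>_. M)) (PiM I (\<lambda>_. m))"
      by (intro measurable_restrict measurable_compose[OF measurable_component_singleton])
    then show ?thesis
      by (rule measurable_cong[THEN iffD1, rotated]) (auto simp: space_PiM PiE_def extensional_restrict)
  qed
  have boxD: "X \<inter> D \<in> sets M" if "X \<in> sets borel" for X using that by (auto simp: sets_M)
  have 1: "distr (PiM I (\<lambda>_. M)) (PiM I (\<lambda>_. m)) (\<lambda>x. x) = PiM I (\<lambda>_. m')"
  proof (rule PM'.PiM_eqI[OF I])
    show "sets (distr (PiM I (\<lambda>_. M)) (PiM I (\<lambda>_. m)) (\<lambda>x. x)) = sets (PiM I (\<lambda>_. m'))" by (simp add: sets')
    fix X assume X: "\<And>i. i \<in> I \<Longrightarrow> X i \<in> sets m'"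
    have Xb: "X i \<in> sets borel" if "i \<in> I" for i using X[OF that] by (simp add: sm')
    have "emeasure (distr (PiM I (\<lambda>_. M)) (PiM I (\<lambda>_. m)) (\<lambda>x. x)) (Pi\<^sub>E I X)
      = emeasure (PiM I (\<lambda>_. M)) ((\<lambda>x. x) -` Pi\<^sub>E I X \<inter> space (PiM I (\<lambda>_. M)))"
      using Xb I by (intro emeasure_distr idm sets_PiM_I_finite) simp_all
    also have "(\<lambda>x. x) -` Pi\<^sub>E I X \<inter> space (PiM I (\<lambda>_. M)) = (\<Pi>\<^sub>E i\<in>I. X i \<inter> D)"
      by (auto simp: space_PiM PiE_def Pi_def)
    also have "emeasure (PiM I (\<lambda>_. M)) (\<Pi>\<^sub>E i\<in>I. X i \<inter> D) = (\<Prod>i\<in>I. emeasure M (X i \<inter> D))"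
      using I boxD Xb by (intro PM.emeasure_PiM) auto
    also have "\<dots> = (\<Prod>i\<in>I. emeasure m' (X i))"
      using boxD Xb by (intro prod.cong refl) (simp add: emeasure_M em' Int_commute)
    finally show "emeasure (distr (PiM I (\<lambda>_. M)) (PiM I (\<lambda>_. m)) (\<lambda>x. x)) (Pi\<^sub>E I X) = (\<Prod>i\<in>I. emeasure m' (X i))" .
  qed
  have DI: "(\<Pi>\<^sub>E i\<in>I. D) \<in> sets (PiM I (\<lambda>_. m))" using I by (intro sets_PiM_I_finite) simp_all
  have 2: "density (PiM I (\<lambda>_. m)) (indicator (\<Pi>\<^sub>E i\<in>I. D)) = PiM I (\<lambda>_. m')"
  proof (rule PM'.PiM_eqI[OF I])
    show "sets (density (PiM I (\<lambda>_. m)) (indicator (\<Pi>\<^sub>E i\<in>I. D))) = sets (PiM I (\<lambda>_. m'))" by (simp add: sets')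
    fix X assume X: "\<And>i. i \<in> I \<Longrightarrow> X i \<in> sets m'"
    have Xb: "X i \<in> sets borel" if "i \<in> I" for i using X[OF that] by (simp add: sm')
    have "emeasure (density (PiM I (\<lambda>_. m)) (indicator (\<Pi>\<^sub>E i\<in>I. D))) (Pi\<^sub>E I X) = emeasure (PiM I (\<lambda>_. m)) ((\<Pi>\<^sub>E i\<in>I. D) \<inter> Pi\<^sub>E I X)"
      using Xb I DI by (intro emeasure_restricted sets_PiM_I_finite) simp_all
    also have "(\<Pi>\<^sub>E i\<in>I. D) \<inter> Pi\<^sub>E I X = (\<Pi>\<^sub>E i\<in>I. D \<inter> X i)" by (rule PiE_Int)
    also have "emeasure (PiM I (\<lambda>_. m)) (\<Pi>\<^sub>E i\<in>I. D \<inter> X i) = (\<Prod>i\<in>I. emeasure m (D \<inter> X i))"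
      using I Xb by (intro emeasure_PiM) auto
    also have "\<dots> = (\<Prod>i\<in>I. emeasure m' (X i))"
      using Xb by (intro prod.cong refl) (simp add: em')
    finally show "emeasure (density (PiM I (\<lambda>_. m)) (indicator (\<Pi>\<^sub>E i\<in>I. D))) (Pi\<^sub>E I X) = (\<Prod>i\<in>I. emeasure m' (X i))" .
  qed
  have "AE x in density (PiM I (\<lambda>_. m)) (indicator (\<Pi>\<^sub>E i\<in>I. D)). x \<in> S"
    using P DI by (subst AE_density) (auto elim: eventually_mono)
  then have "AE x in distr (PiM I (\<lambda>_. M)) (PiM I (\<lambda>_. m)) (\<lambda>x. x). x \<in> S" unfolding 1 2 .
  then show ?thesis by (rule AE_distrD[OF idm])
qed

text \<open>
  An invariant set is lifted along \<open>rep\<close> to a set \<open>S\<close> of tuples of codes. The lift is invariant under digit rotations,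
  because these do not change the point that is coded, and mod null sets under rational translations of
  each coordinate by the preceding analysis; so it is null or conull.
\<close>

lemma T_infinite_ergodic_index:
  assumes t: "t \<noteq> 0" shows "infinite_ergodic_index M (T t)"
  unfolding infinite_ergodic_index_def
proof (intro conjI allI impI)
  show "measure_preserving_map M (T t)" by (rule T_preserving)
  fix p :: nat assume "1 \<le> p"
  let ?I = "{..<p}"
  let ?N = "PiM ?I (\<lambda>_. m)" and ?MN = "PiM ?I (\<lambda>_. M)"
  have mp: "measure_preserving_map ?MN (cartesian_power p (T s))" for s
    using measure_preserving_map_power[OF sigma_finite_M, of ?I "\<lambda>_. T s"] T_preserving
    by (simp add: cartesian_power_def[abs_def])
  show "ergodic ?MN (cartesian_power p (T t))"
    unfolding ergodic_def
  proof (intro conjI ballI impI)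
    show "measure_preserving_map ?MN (cartesian_power p (T t))" by (rule mp)
    fix X assume X: "X \<in> sets ?MN" and inv: "cartesian_power p (T t) -` X \<inter> space ?MN = X"
    have spM: "x \<in> space ?MN \<longleftrightarrow> x \<in> (\<Pi>\<^sub>E i\<in>?I. D)" for x by (simp add: space_PiM)
    have cp: "cartesian_power p (T s) x \<in> space ?MN" if "x \<in> space ?MN" for s x
      using T_in_D by (auto simp: cartesian_power_def space_PiM)
    have one: "x \<in> X \<longleftrightarrow> cartesian_power p (T t) x \<in> X" if "x \<in> space ?MN" for x
      using inv that by blast
    have nat: "x \<in> X \<longleftrightarrow> cartesian_power p (T (real n * t)) x \<in> X" if x: "x \<in> space ?MN" for x n
    proof (induction n)
      case 0
      have "cartesian_power p (T (real 0 * t)) x = x"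
      proof
        fix i show "cartesian_power p (T (real 0 * t)) x i = x i"
          using x T_0[of "x i"] by (cases "i < p") (auto simp: cartesian_power_def space_PiM PiE_def extensional_def)
      qed
      then show ?case by simp
    next
      case (Suc n)
      have "cartesian_power p (T t) (cartesian_power p (T (real n * t)) x) = cartesian_power p (T (real (Suc n) * t)) x"
        unfolding cartesian_power_def
      proof (rule restrict_ext)
        fix i assume i: "i \<in> ?I"
        then have "x i \<in> D" using x by (auto simp: space_PiM)
        from T_add[OF this, of t "real n * t"] i
        show "T t ((\<lambda>i\<in>?I. T (real n * t) (x i)) i) = T (real (Suc n) * t) (x i)"
          by (simp add: distrib_right)
      qed
      with one[OF cp[OF x, of "real n * t"]] Suc show ?case by simp
    qed
    have int: "x \<in> X \<longleftrightarrow> cartesian_power p (T (of_int j * t)) x \<in> X" if x: "x \<in> space ?MN" for x and j :: int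
    proof (cases "0 \<le> j")
      case True
      then show ?thesis using nat[OF x, of "nat j"] by simp
    next
      case False
      let ?y = "cartesian_power p (T (of_int j * t)) x"
      have "cartesian_power p (T (real (nat (- j)) * t)) ?y = x"
      proof
        fix i
        show "cartesian_power p (T (real (nat (- j)) * t)) ?y i = x i"
        proof (cases "i \<in> ?I")
          case True
          then have "x i \<in> D" using x by (auto simp: space_PiM)
          then show ?thesis using True False T_minus[of "x i" "of_int j * t"] by (simp add: cartesian_power_def)
        next
          case False
          then show ?thesis using x by (auto simp: cartesian_power_def space_PiM PiE_def extensional_def)
        qed
      qed
      with nat[OF cp[OF x], of "of_int j * t" "nat (-j)"] show ?thesis by simp
    qed
    let ?rep = "\<lambda>x. \<lambda>i\<in>?I. rep (x i)"
    have repm: "?rep \<in> measurable ?N ?MN"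
    proof -
      have "rep \<in> measurable m M" using rep_measurable by (simp cong: measurable_cong_sets)
      then show ?thesis
        by (intro measurable_restrict) (rule measurable_compose[OF measurable_component_singleton])
    qed
    define S where "S = {x \<in> space ?N. ?rep x \<in> X}"
    have S: "S \<in> sets ?N" using measurable_sets[OF repm X] by (simp add: S_def vimage_def Int_def conj_commute)
    have rep_sp: "?rep x \<in> space ?MN" for x by (auto simp: space_PiM rep_in_D)
    have orbit: "x \<in> S \<longleftrightarrow> y \<in> S" if "x \<in> space ?N" "y \<in> space ?N" "\<And>i. i \<in> ?I \<Longrightarrow> x i \<in> Z \<and> y i \<in> Z \<and> same_orbit (x i) (y i)" for x y
    proof -
      have "?rep x = ?rep y" using that(3) rep_cong by (intro restrict_ext) blast
      with that(1,2) show ?thesis by (simp add: S_def)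
    qed
    have tinv: "x \<in> S \<longleftrightarrow> (\<lambda>i\<in>?I. shift (of_int j * t) (x i)) \<in> S" if x: "x \<in> space ?N" "\<And>i. i \<in> ?I \<Longrightarrow> x i \<in> Z" for x j
    proof -
      have "?rep (\<lambda>i\<in>?I. shift (of_int j * t) (x i)) = cartesian_power p (T (of_int j * t)) (?rep x)"
        unfolding cartesian_power_def using x(2) rep_shift_rep by (intro restrict_ext) (simp add: T_def)
      moreover have "(\<lambda>i\<in>?I. shift (of_int j * t) (x i)) \<in> space ?N" by (auto simp: space_PiM)
      ultimately show ?thesis using x(1) int[OF rep_sp] by (simp only: S_def mem_Collect_eq simp_thms)
    qed
    have "(AE x in ?N. x \<in> S) \<or> (AE x in ?N. x \<notin> S)"
    proof (rule ergodic_family_power[OF sigma_finite_m ergodic_symmetries _ S])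
      fix i \<theta> assume i: "i \<in> ?I" and \<theta>: "\<theta> \<in> symmetries"
      then consider r where "r \<in> \<rat>" "\<theta> = shift r" | g where "g \<in> rotations" "\<theta> = rotate_digits g"
        unfolding symmetries_def by blast
      then show "AE x in ?N. (x \<in> S) = (x(i := \<theta> (x i)) \<in> S)"
      proof cases
        case 1
        have "AE x in ?N. (x \<in> S) = (x(i := shift (- (- r)) (x i)) \<in> S)"
        proof (rule coordinate_shift_invariant[OF t finite_lessThan i _ S])
          show "- r \<in> \<rat>" using 1(1) by simp
        next
          fix x y assume "x \<in> space ?N" "y \<in> space ?N" "\<And>i. i \<in> ?I \<Longrightarrow> x i \<in> Z \<and> y i \<in> Z \<and> same_orbit (x i) (y i)"
          then show "(x \<in> S) = (y \<in> S)" by (rule orbit)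
        next
          fix x j assume "x \<in> space ?N" "\<And>i. i \<in> ?I \<Longrightarrow> x i \<in> Z"
          then show "(x \<in> S) = ((\<lambda>i\<in>?I. shift (of_int j * t) (x i)) \<in> S)" by (rule tinv)
        qed
        then show ?thesis by (simp only: 1(2) minus_minus)
      next
        case 2
        have "rep (rotate_digits g z) = rep z" for z
        proof (cases "z \<in> Z")
          case True
          then show ?thesis by (intro rep_cong rotate_digits_same_orbit 2) (simp_all add: rotate_digits_in_Z)
        next
          case False
          then show ?thesis by (simp add: rep_def rotate_digits_in_Z)
        qed
        then have c: "?rep (x(i := \<theta> (x i))) = ?rep x" for x
          using 2(2) by (intro restrict_ext) simp
        show ?thesis
        proof (rule AE_I2)
          fix x assume x: "x \<in> space ?N"
          then have "x(i := \<theta> (x i)) \<in> space ?N" using i by (auto simp: space_PiM PiE_def extensional_def)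
          with x c show "(x \<in> S) = (x(i := \<theta> (x i)) \<in> S)" by (simp only: S_def mem_Collect_eq simp_thms)
        qed
      qed
    qed simp
    moreover have XS: "x \<in> X \<longleftrightarrow> x \<in> S" if x: "x \<in> space ?MN" for x
    proof -
      have "?rep x = x"
      proof
        fix i show "?rep x i = x i"
          using x rep_id[of "x i"] by (cases "i < p") (auto simp: space_PiM PiE_def extensional_def)
      qed
      moreover have "x \<in> space ?N" using x by (auto simp: space_PiM PiE_def)
      ultimately show ?thesis by (simp add: S_def)
    qed
    ultimately show "X \<in> null_sets ?MN \<or> space ?MN - X \<in> null_sets ?MN"
    proof (elim disjE)
      assume "AE x in ?N. x \<in> S"
      then have "AE x in ?MN. x \<in> S" by (rule AE_power_restrict[OF finite_lessThan _ S])
      then have "AE x in ?MN. x \<notin> space ?MN - X" using AE_space by eventually_elim (use XS in blast)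
      then have "space ?MN - X \<in> null_sets ?MN" using X by (subst AE_iff_null_sets) auto
      then show ?thesis ..
    next
      assume "AE x in ?N. x \<notin> S"
      then have "AE x in ?N. x \<in> space ?N - S" using AE_space by eventually_elim blast
      then have "AE x in ?MN. x \<in> space ?N - S" by (rule AE_power_restrict[OF finite_lessThan]) (use S in auto)
      then have "AE x in ?MN. x \<notin> X" using AE_space by eventually_elim (use XS in blast)
      then have "X \<in> null_sets ?MN" using X by (subst AE_iff_null_sets) auto
      then show ?thesis ..
    qed
  qed
qed

end

section \<open>Digit sets with the mixing pattern\<close>

definition rational_sequence :: "nat \<Rightarrow> real" where
  "rational_sequence n = of_rat (from_nat (fst (prod_decode n)))"

lemma rational_sequence_recurs:
  assumes "r \<in> \<rat>" shows "\<exists>n\<ge>N. rational_sequence n = r"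
proof -
  obtain s where s: "r = of_rat s" using assms by (rule Rats_cases)
  have "rational_sequence (prod_encode (to_nat s, N)) = r" by (simp add: rational_sequence_def s)
  moreover have "N \<le> prod_encode (to_nat s, N)" by (rule le_prod_encode_2)
  ultimately show ?thesis by blast
qed

text \<open>
  Pairs of a binary word of length \<open>2 * K\<close>, given as the set of positions of the letter 1, and a position in
  it. Their order in the concatenation of all words is \<open>position K\<close>.
\<close>

definition words :: "nat \<Rightarrow> (nat set \<times> nat) set" where
  "words K = Pow {..<2 * K} \<times> {..<2 * K}"

definition position :: "nat \<Rightarrow> nat set \<times> nat \<Rightarrow> nat" where
  "position K w = set_encode (fst w) * (2 * K) + snd w"

definition offset :: "nat \<Rightarrow> real \<Rightarrow> real \<Rightarrow> nat set \<times> nat \<Rightarrow> real" where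
  "offset K b r w = real (position K w) * b + (if snd w \<in> fst w then r else 0)"

lemma finite_words: "finite (words K)" by (simp add: words_def)

lemma card_words: "card (words K) = 2 ^ (2 * K) * (2 * K)"
  by (simp add: words_def card_cartesian_product card_Pow)

lemma position_inj: "inj_on (position K) (words K)"
proof (rule inj_onI)
  fix w w' assume w: "w \<in> words K" "w' \<in> words K" and eq: "position K w = position K w'"
  have s: "snd w < 2 * K" "snd w' < 2 * K" using w by (auto simp: words_def)
  have "snd w = position K w mod (2 * K)" "snd w' = position K w' mod (2 * K)"
    using s by (simp_all add: position_def)
  moreover have "set_encode (fst w) = position K w div (2 * K)" "set_encode (fst w') = position K w' div (2 * K)"
    using s by (simp_all add: position_def)
  ultimately have "snd w = snd w'" "set_encode (fst w) = set_encode (fst w')" using eq by simp_all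
  moreover have "fst w \<subseteq> {..<2 * K}" "fst w' \<subseteq> {..<2 * K}" using w by (auto simp: words_def)
  then have "finite (fst w)" "finite (fst w')" by (simp_all only: finite_subset[OF _ finite_lessThan])
  ultimately show "w = w'"
    using set_encode_eq by (auto simp: prod_eq_iff)
qed

text \<open>
  Different positions differ by at least 1, and the summand depending on the letter changes the difference by at most
  \<open>\<bar>r\<bar>\<close>.
\<close>

lemma offset_separated:
  assumes "w \<in> words K" "w' \<in> words K" "w \<noteq> w'" "0 \<le> b"
  shows "b - \<bar>r\<bar> \<le> \<bar>offset K b r w - offset K b r w'\<bar>"
proof -
  let ?d = "real (position K w) - real (position K w')"
  have "position K w \<noteq> position K w'" using position_inj assms(1-3) by (auto simp: inj_on_def)
  then have "1 \<le> \<bar>?d\<bar>" by linarith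
  then have "b \<le> \<bar>?d\<bar> * b" using assms(4) by (simp add: mult_le_cancel_right1)
  also have "\<dots> = \<bar>?d * b\<bar>" using assms(4) by (simp add: abs_mult)
  finally have "b \<le> \<bar>?d * b\<bar>" .
  moreover have "offset K b r w - offset K b r w' = ?d * b + ((if snd w \<in> fst w then r else 0) - (if snd w' \<in> fst w' then r else 0))"
    by (simp add: offset_def left_diff_distrib)
  moreover have "\<bar>(if snd w \<in> fst w then r else 0) - (if snd w' \<in> fst w' then r else 0)\<bar> \<le> \<bar>r\<bar>" by simp
  ultimately show ?thesis by linarith
qed

lemma offset_inj: "\<bar>r\<bar> < b \<Longrightarrow> inj_on (offset K b r) (words K)"
  using offset_separated[of _ K _ b r] by (intro inj_onI) (smt (verit))

lemma card_subsets_with_pattern: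
  assumes "j < L" "j' < L" "j \<noteq> j'"
  shows "card {W. W \<subseteq> {..<L} \<and> j \<notin> W \<and> (j' \<in> W \<longleftrightarrow> P)} = 2 ^ (L - 2)"
proof -
  have c: "card (Pow ({..<L} - {j, j'})) = 2 ^ (L - 2)"
    using assms by (subst card_Pow) (auto simp: card_Diff_subset)
  show ?thesis
  proof (cases P)
    case True
    have "{W. W \<subseteq> {..<L} \<and> j \<notin> W \<and> (j' \<in> W \<longleftrightarrow> P)} = insert j' ` Pow ({..<L} - {j, j'})"
    proof (intro equalityI subsetI)
      fix W assume "W \<in> {W. W \<subseteq> {..<L} \<and> j \<notin> W \<and> (j' \<in> W \<longleftrightarrow> P)}"
      then have "W = insert j' (W - {j'})" "W - {j'} \<in> Pow ({..<L} - {j, j'})" using True by auto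
      then show "W \<in> insert j' ` Pow ({..<L} - {j, j'})" by (rule image_eqI)
    qed (use True assms in auto)
    moreover have "inj_on (insert j') (Pow ({..<L} - {j, j'}))" by (rule inj_onI) blast
    ultimately show ?thesis using c by (simp add: card_image)
  next
    case False
    then have "{W. W \<subseteq> {..<L} \<and> j \<notin> W \<and> (j' \<in> W \<longleftrightarrow> P)} = Pow ({..<L} - {j, j'})" by auto
    with c show ?thesis by simp
  qed
qed

text \<open>
  The permutation moves a position cyclically by \<open>k\<close> inside its word. The set \<open>V\<close> consists of the positions in the
  first half of a word that carry the letter 0 and see the letter \<open>a\<close> at distance \<open>k\<close>. From there,
  \<open>k \<le> K\<close> steps do not leave the word. Prescribing two letters keeps a quarter of all words, and half
  of the positions are used; this gives the proportion \<open>1/8\<close> for every \<open>k\<close>.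
\<close>

lemma offset_pattern:
  assumes k: "1 \<le> k" "k \<le> K" and b: "\<bar>r\<bar> < b" and a: "a \<in> {0, 1}"
  shows "\<exists>V \<sigma>. V \<subseteq> offset K b r ` words K \<and> 8 * card V = card (offset K b r ` words K) \<and>
    bij_betw \<sigma> (offset K b r ` words K) (offset K b r ` words K) \<and>
    (\<forall>c. c \<notin> offset K b r ` words K \<longrightarrow> \<sigma> c = c) \<and> (\<forall>c\<in>V. \<sigma> c - c = real k * b + a * r)"
proof -
  let ?o = "offset K b r" and ?I = "words K"
  define \<rho> where "\<rho> w = (fst w, (snd w + k) mod (2 * K))" for w :: "nat set \<times> nat"
  define V where "V = {w. fst w \<subseteq> {..<2 * K} \<and> snd w < K \<and> snd w \<notin> fst w \<and> (snd w + k \<in> fst w \<longleftrightarrow> a = 1)}"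
  define \<sigma> where "\<sigma> c = (if c \<in> ?o ` ?I then ?o (\<rho> (the_inv_into ?I ?o c)) else c)" for c
  have inj: "inj_on ?o ?I" using b by (rule offset_inj)
  have \<sigma>: "\<sigma> (?o w) = ?o (\<rho> w)" if "w \<in> ?I" for w
    using that inj by (simp add: \<sigma>_def the_inv_into_f_f)
  have \<rho>I: "\<rho> w \<in> ?I" if "w \<in> ?I" for w
    using that k by (auto simp: \<rho>_def words_def)
  have \<rho>inj: "inj_on \<rho> ?I"
  proof (rule inj_onI)
    fix w w' assume w: "w \<in> ?I" "w' \<in> ?I" "\<rho> w = \<rho> w'"
    have red: "(j + k) mod (2 * K) = (if j + k < 2 * K then j + k else j + k - 2 * K)" if "j < 2 * K" for j
    proof (cases "j + k < 2 * K")
      case False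
      then have "(j + k) mod (2 * K) = (j + k - 2 * K) mod (2 * K)" by (simp add: le_mod_geq)
      moreover have "j + k - 2 * K < 2 * K" using that k False by linarith
      then have "(j + k - 2 * K) mod (2 * K) = j + k - 2 * K" by (rule mod_less)
      ultimately show ?thesis using False by simp
    qed simp
    have "snd w < 2 * K" "snd w' < 2 * K" using w by (auto simp: words_def)
    moreover from this have "(if snd w + k < 2 * K then snd w + k else snd w + k - 2 * K) = (if snd w' + k < 2 * K then snd w' + k else snd w' + k - 2 * K)"
      using w(3) red by (simp add: \<rho>_def)
    ultimately have "snd w = snd w'" by (auto split: if_splits)
    then show "w = w'" using w(3) by (simp add: \<rho>_def prod_eq_iff)
  qed
  have VI: "V \<subseteq> ?I" by (auto simp: V_def words_def)
  have bij: "bij_betw \<sigma> (?o ` ?I) (?o ` ?I)"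
  proof -
    have "inj_on \<sigma> (?o ` ?I)"
    proof (rule inj_onI)
      fix c c' assume "c \<in> ?o ` ?I" "c' \<in> ?o ` ?I" and eq: "\<sigma> c = \<sigma> c'"
      then obtain w w' where w: "w \<in> ?I" "w' \<in> ?I" "c = ?o w" "c' = ?o w'" by blast
      then have "?o (\<rho> w) = ?o (\<rho> w')" using eq \<sigma> by simp
      then have "\<rho> w = \<rho> w'" using inj \<rho>I w by (simp add: inj_on_eq_iff)
      then show "c = c'" using \<rho>inj w by (simp add: inj_on_eq_iff)
    qed
    moreover have "\<sigma> ` (?o ` ?I) \<subseteq> ?o ` ?I" using \<sigma> \<rho>I by auto
    ultimately show ?thesis using finite_words by (simp add: bij_betw_def endo_inj_surj)
  qed
  have cardV: "card V = K * 2 ^ (2 * K - 2)"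
  proof -
    let ?W = "\<lambda>j. {W. W \<subseteq> {..<2 * K} \<and> j \<notin> W \<and> (j + k \<in> W \<longleftrightarrow> a = 1)}"
    have fW: "finite (?W j)" for j by (rule finite_subset[of _ "Pow {..<2 * K}"]) auto
    have "V = prod.swap ` Sigma {..<K} ?W"
      unfolding V_def by (auto simp: image_iff)
    then have "card V = card (Sigma {..<K} ?W)" by (simp add: card_image)
    also have "\<dots> = (\<Sum>j<K. card (?W j))" using fW by (intro card_SigmaI) auto
    also have "\<dots> = (\<Sum>j<K. 2 ^ (2 * K - 2))"
      using k by (intro sum.cong refl card_subsets_with_pattern) auto
    finally show ?thesis by simp
  qed
  have "8 * card V = card ?I"
  proof -
    have "(2::nat) ^ (2 * K) = 2 ^ (2 * K - 2) * 4"
    proof -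
      have "2 * K = (2 * K - 2) + 2" using k by simp
      then have "(2::nat) ^ (2 * K) = 2 ^ ((2 * K - 2) + 2)" by (rule arg_cong)
      also have "\<dots> = 2 ^ (2 * K - 2) * 4" by (simp add: power_add)
      finally show ?thesis .
    qed
    then show ?thesis by (simp add: cardV card_words)
  qed
  then have card: "8 * card (?o ` V) = card (?o ` ?I)"
    using inj VI by (simp add: card_image inj_on_subset)
  have val: "\<sigma> c - c = real k * b + a * r" if c: "c \<in> ?o ` V" for c
  proof -
    obtain w where w: "w \<in> V" "c = ?o w" using c by blast
    then have wI: "w \<in> ?I" using VI by blast
    have "snd w + k < 2 * K" using w(1) k by (auto simp: V_def)
    then have "\<rho> w = (fst w, snd w + k)" by (simp add: \<rho>_def)
    then have "\<sigma> c = ?o (fst w, snd w + k)" using \<sigma>[OF wI] w(2) by simp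
    then show ?thesis using w a by (auto simp: offset_def position_def V_def algebra_simps)
  qed
  show ?thesis
  proof (intro exI[of _ "?o ` V"] exI[of _ \<sigma>] conjI)
    show "?o ` V \<subseteq> ?o ` ?I" using VI by blast
    show "\<forall>c. c \<notin> ?o ` ?I \<longrightarrow> \<sigma> c = c" by (simp add: \<sigma>_def)
    show "\<forall>c\<in>?o ` V. \<sigma> c - c = real k * b + a * r" using val by blast
  qed (rule card bij)+
qed

text \<open>
  Twice the half-length of the current tower, for disjointness, plus room for the rational
  summand.
\<close>

definition step :: "nat \<Rightarrow> real \<Rightarrow> real" where
  "step n x = 2 * x + \<bar>rational_sequence n\<bar>"

definition offsets :: "nat \<Rightarrow> real \<Rightarrow> real set" where
  "offsets n x = offset (Suc n) (step n x) (rational_sequence n) ` words (Suc n)"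

text \<open>
  Nesting with margin 1 needs the first two summands and the sum over all offsets, which bounds every single one;
  the summand with the cardinality makes the copies fill at most half of the next tower.
\<close>

primrec half_length :: "nat \<Rightarrow> real" where
  "half_length 0 = 1"
| "half_length (Suc n) = 1 + half_length n + 2 * half_length n * card (offsets n (half_length n))
     + (\<Sum>c\<in>offsets n (half_length n). \<bar>c\<bar>)"

lemma half_length_pos: "0 < half_length n"
  by (induction n) (auto intro!: add_pos_nonneg sum_nonneg)

lemma offsets_finite: "finite (offsets n x)"
  by (simp add: offsets_def finite_words)

interpretation construction: mixing_cut_and_stack "\<lambda>n. offsets n (half_length n)" half_length
  "\<lambda>n. step n (half_length n)" rational_sequence
proof
  fix n :: nat
  let ?x = "half_length n" and ?C = "offsets n (half_length n)"
  have x: "0 < ?x" by (rule half_length_pos)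
  show "finite ?C" by (rule offsets_finite)
  have "({}, 0) \<in> words (Suc n)" by (simp add: words_def)
  moreover have "offset (Suc n) (step n ?x) (rational_sequence n) ({}, 0) = 0" by (simp add: offset_def position_def)
  ultimately show "0 \<in> ?C" unfolding offsets_def by (metis image_eqI)
  show "0 < half_length 0" by simp
  show "2 * ?x \<le> \<bar>c - c'\<bar>" if c: "c \<in> ?C" "c' \<in> ?C" "c \<noteq> c'" for c c'
  proof -
    obtain w w' where w: "w \<in> words (Suc n)" "w' \<in> words (Suc n)"
      "c = offset (Suc n) (step n ?x) (rational_sequence n) w" "c' = offset (Suc n) (step n ?x) (rational_sequence n) w'"
      using c(1,2) unfolding offsets_def by blast
    then have "w \<noteq> w'" using c(3) by blast
    moreover have "0 \<le> step n ?x" using x by (simp add: step_def)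
    ultimately have "step n ?x - \<bar>rational_sequence n\<bar> \<le> \<bar>c - c'\<bar>"
      unfolding w(3,4) using w(1,2) by (intro offset_separated)
    then show ?thesis by (simp add: step_def)
  qed
  have s: "0 \<le> (\<Sum>c\<in>?C. \<bar>c\<bar>)" by (rule sum_nonneg) simp
  show "\<bar>c\<bar> + ?x + 1 \<le> half_length (Suc n)" if "c \<in> ?C" for c
  proof -
    have "\<bar>c\<bar> \<le> (\<Sum>c\<in>?C. \<bar>c\<bar>)" using that offsets_finite by (intro member_le_sum) auto
    moreover have "0 \<le> 2 * ?x * card ?C" using x by simp
    ultimately show ?thesis by simp
  qed
  show "2 * ?x * card ?C \<le> half_length (Suc n)" using x s by simp
next
  show "\<exists>n\<ge>N. rational_sequence n = r" if "r \<in> \<rat>" for r N using that by (rule rational_sequence_recurs)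
next
  fix k n :: nat and a :: real assume "1 \<le> k" "k \<le> Suc n" "a \<in> {0, 1}"
  then show "\<exists>V \<sigma>. V \<subseteq> offsets n (half_length n) \<and> 8 * card V = card (offsets n (half_length n)) \<and>
        bij_betw \<sigma> (offsets n (half_length n)) (offsets n (half_length n)) \<and>
        (\<forall>c. c \<notin> offsets n (half_length n) \<longrightarrow> \<sigma> c = c) \<and>
        (\<forall>c\<in>V. \<sigma> c - c = real k * step n (half_length n) + a * rational_sequence n)"
    unfolding offsets_def using half_length_pos[of n] by (intro offset_pattern) (auto simp: step_def)
qed

theorem theorem0p1:
  shows "\<exists>(M :: point measure) T.
    standard_sigma_finite_measure M \<and> emeasure M (space M) = \<infinity> \<and>
    rank_one_flow M T \<and>
    (\<forall>t. t \<noteq> 0 \<longrightarrow> infinite_ergodic_index M (T t))"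
  using construction.M_standard construction.M_infinite construction.T_rank_one
    construction.T_infinite_ergodic_index by blast

end
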